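(* Let $\Omega\subset\mathbb{R}^N$, $N\ge 2$, be a bounded domain of class $C^3$ and let $p\in(1,p_N)$. (a) There exists $\overline{\lambda}=\overline{\lambda}(\Omega,p)>0$, depending only on $p$, $N$ and $\Omega$, such that if $(\alpha_\lambda,\psi_\lambda)$ is a solution of $(\mathbf{P})_\lambda$ (with $\lambda\ge 0$), then $\lambda\le\overline{\lambda}$. (b) Let $\overline{I}=\overline{I}(\Omega,p)=\overline{\lambda}(\Omega,p)^{\frac{p}{p-1}}$. Then $\gamma_I<0$ for any solution $(\gamma_I,v_I)$ of $(\mathbf{F})_I$ with $I>\overline{I}$.
   Context: $p_N=+\infty$ if $N=2$ and $p_N=\frac{N}{N-2}$ if $N\ge3$. $(v)_+=\max\{v,0\}$, $\nu$ is the exterior unit normal to $\partial\Omega$, and $r\in(0,1)$. Problem $(\mathbf{F})_I$, for fixed $I>0$: find $\gamma\in\mathbb{R}$ and $v\in C^{2,r}(\overline{\Omega})$ such that $$-\Delta v=(v)_+^p \ \text{ in }\Omega,\qquad -\int_{\partial\Omega}\frac{\partial v}{\partial\nu}=I,\qquad v=\gamma\ \text{ on }\partial\Omega .$$ Problem $(\mathbf{P})_\lambda$, for fixed $\lambda\ge0$: find $\alpha\in\mathbb{R}$ and $\psi\in C^{2,r}(\overline{\Omega})$ such that $$-\Delta\psi=(\alpha+\lambda\psi)^p\ \text{ in }\Omega,\qquad \int_\Omega(\alpha+\lambda\psi)^p=1,\qquad \psi>0\ \text{ in }\Omega,\quad \psi=0\ \text{ on }\partial\Omega,\qquad \alpha\ge0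 .$$ A solution of $(\mathbf{P})_\lambda$ is denoted $(\alpha_\lambda,\psi_\lambda)$ and a solution of $(\mathbf{F})_I$ is denoted $(\gamma_I,v_I)$. *)

theory Defs
  imports "HOL-Analysis.Analysis"
begin

definition partial_deriv ::
    "'a::euclidean_space \<Rightarrow> ('a \<Rightarrow> real) \<Rightarrow> 'a \<Rightarrow> real" where
  "partial_deriv i f x = frechet_derivative f (at x) i"

definition gradient :: "('a::euclidean_space \<Rightarrow> real) \<Rightarrow> 'a \<Rightarrow> 'a" where
  "gradient f x = (\<Sum>i\<in>Basis. partial_deriv i f x *\<^sub>R i)"

definition laplacian :: "('a::euclidean_space \<Rightarrow> real) \<Rightarrow> 'a \<Rightarrow> real" where
  "laplacian f x = (\<Sum>i\<in>Basis. partial_deriv i (partial_deriv i f) x)"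

text \<open>The set \<open>S\<close> is meant to be open in the next definition.\<close>

primrec C_k_on :: "nat \<Rightarrow> 'a::euclidean_space set \<Rightarrow> ('a \<Rightarrow> real) \<Rightarrow> bool" where
  "C_k_on 0 S f \<longleftrightarrow> continuous_on S f"
| "C_k_on (Suc k) S f \<longleftrightarrow>
     f differentiable_on S \<and> (\<forall>i\<in>Basis. C_k_on k S (partial_deriv i f))"

definition extends_continuously ::
    "'a::euclidean_space set \<Rightarrow> ('a \<Rightarrow> real) \<Rightarrow> bool" where
  "extends_continuously \<Omega> f \<longleftrightarrow>
     (\<exists>h. continuous_on (closure \<Omega>) h \<and> (\<forall>x\<in>\<Omega>. h x = f x))"

definition hoelder_on :: "real \<Rightarrow> 'a::euclidean_space set \<Rightarrow> ('a \<Rightarrow> real) \<Rightarrow> bool" where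
  "hoelder_on r S f \<longleftrightarrow>
     (\<exists>C. \<forall>x\<in>S. \<forall>y\<in>S. \<bar>f x - f y\<bar> \<le> C * dist x y powr r)"

text \<open>Membership in \<open>C\<^sup>2\<^sup>,\<^sup>r\<close> of the closure of the open set \<open>\<Omega>\<close>. Only the values on
  the closure of \<open>\<Omega>\<close> matter. Since \<open>v\<close> itself carries the boundary values, \<open>v\<close> is required to be
  continuous on the closure, whereas the derivatives, taken inside \<open>\<Omega>\<close>, have to extend.\<close>

definition C2_hoelder ::
    "real \<Rightarrow> 'a::euclidean_space set \<Rightarrow> ('a \<Rightarrow> real) \<Rightarrow> bool" where
  "C2_hoelder r \<Omega> v \<longleftrightarrow>
     C_k_on 2 \<Omega> v \<and>
     continuous_on (closure \<Omega>) v \<and>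
     (\<forall>i\<in>Basis. extends_continuously \<Omega> (partial_deriv i v)) \<and>
     (\<forall>i\<in>Basis. \<forall>j\<in>Basis.
        extends_continuously \<Omega> (partial_deriv i (partial_deriv j v)) \<and>
        hoelder_on r \<Omega> (partial_deriv i (partial_deriv j v)))"

text \<open>After a rotation taking the last coordinate axis to the unit vector \<open>e\<close>, the set \<open>\<Omega>\<close> is,
  inside the open set \<open>U\<close>, the region below the graph of a \<open>C\<^sup>k\<close> function of the other
  coordinates. Functions on the hyperplane orthogonal to \<open>e\<close> are encoded as functions \<open>g\<close> on the
  whole space that are constant in direction \<open>e\<close>; in particular the gradient of \<open>g\<close> is orthogonal
  to \<open>e\<close>. It follows that the part of the boundary of \<open>\<Omega>\<close> in \<open>U\<close> is
  the set of \<open>y \<in> U\<close> with \<open>y \<bullet> e = g y\<close>.\<close>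

definition graph_chart ::
    "nat \<Rightarrow> 'a::euclidean_space set \<Rightarrow> 'a set \<Rightarrow> 'a \<Rightarrow> ('a \<Rightarrow> real) \<Rightarrow> bool" where
  "graph_chart k \<Omega> U e g \<longleftrightarrow>
     open U \<and> norm e = 1 \<and> C_k_on k UNIV g \<and> (\<forall>y t. g (y + t *\<^sub>R e) = g y) \<and>
     \<Omega> \<inter> U = {y \<in> U. y \<bullet> e < g y}"

definition bounded_domain_of_class :: "nat \<Rightarrow> 'a::euclidean_space set \<Rightarrow> bool" where
  "bounded_domain_of_class k \<Omega> \<longleftrightarrow>
     open \<Omega> \<and> connected \<Omega> \<and> \<Omega> \<noteq> {} \<and> bounded \<Omega> \<and>
     (\<forall>x\<in>frontier \<Omega>. \<exists>U e g. x \<in> U \<and> graph_chart k \<Omega> U e g)"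

text \<open>For a domain of class \<open>C\<^sup>1\<close> the vector below does not depend on the chart.\<close>

definition exterior_normal :: "'a::euclidean_space set \<Rightarrow> 'a \<Rightarrow> 'a" where
  "exterior_normal \<Omega> x =
     (THE n. \<exists>U e g. graph_chart 1 \<Omega> U e g \<and> x \<in> U \<and>
        n = (e - gradient g x) /\<^sub>R sqrt (1 + (norm (gradient g x))\<^sup>2))"

text \<open>Surface measure on the graph of \<open>g\<close> over the hyperplane orthogonal to \<open>e\<close>: the image of
  \<open>sqrt (1 + \<bar>\<nabla>g\<bar>\<^sup>2) dy'\<close> under the graph map \<open>y' \<mapsto> y' + g y' e\<close>, where \<open>dy'\<close> is
  Lebesgue measure on the hyperplane. The latter is the projection to the hyperplane of Lebesgue
  measure on the slab of thickness one below; density and graph map are constant in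
  direction \<open>e\<close>.\<close>

definition graph_measure ::
    "'a::euclidean_space \<Rightarrow> ('a \<Rightarrow> real) \<Rightarrow> 'a measure" where
  "graph_measure e g =
     distr
       (density lborel
          (\<lambda>y. indicator {y. 0 \<le> y \<bullet> e \<and> y \<bullet> e \<le> 1} y *
                ennreal (sqrt (1 + (norm (gradient g y))\<^sup>2))))
       borel
       (\<lambda>y. y + (g y - y \<bullet> e) *\<^sub>R e)"

text \<open>The surface measure of \<open>\<partial>\<Omega>\<close>, as a Borel measure on the whole space. It is
  determined by its restrictions to charts, since countably many charts cover the boundary.\<close>

definition surface_measure :: "'a::euclidean_space set \<Rightarrow> 'a measure" where
  "surface_measure \<Omega> =
     (THE \<sigma>. sets \<sigma> = sets borel \<and> emeasure \<sigma> (- frontier \<Omega>) = 0 \<and>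
        (\<forall>U e g A. graph_chart 1 \<Omega> U e g \<and> A \<in> sets borel \<and> A \<subseteq> frontier \<Omega> \<inter> U \<longrightarrow>
           emeasure \<sigma> A = emeasure (graph_measure e g) A))"

text \<open>At a boundary point, the gradient is the value of its continuous extension from \<open>\<Omega>\<close>.\<close>

definition normal_deriv ::
    "'a::euclidean_space set \<Rightarrow> ('a \<Rightarrow> real) \<Rightarrow> 'a \<Rightarrow> real" where
  "normal_deriv \<Omega> v x = Lim (at x within \<Omega>) (gradient v) \<bullet> exterior_normal \<Omega> x"

definition critical_exponent :: "nat \<Rightarrow> ereal" where
  "critical_exponent N = (if N = 2 then \<infinity> else ereal (real N / (real N - 2)))"

definition solves_F ::
    "'a::euclidean_space set \<Rightarrow> real \<Rightarrow> real \<Rightarrow> real \<Rightarrow> real \<Rightarrow> ('a \<Rightarrow> real) \<Rightarrow> bool" where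
  "solves_F \<Omega> p r I \<gamma> v \<longleftrightarrow>
     C2_hoelder r \<Omega> v \<and>
     (\<forall>x\<in>\<Omega>. - laplacian v x = (max (v x) 0) powr p) \<and>
     - (LINT x:frontier \<Omega>|surface_measure \<Omega>. normal_deriv \<Omega> v x) = I \<and>
     (\<forall>x\<in>frontier \<Omega>. v x = \<gamma>)"

definition solves_P ::
    "'a::euclidean_space set \<Rightarrow> real \<Rightarrow> real \<Rightarrow> real \<Rightarrow> real \<Rightarrow> ('a \<Rightarrow> real) \<Rightarrow> bool" where
  "solves_P \<Omega> p r lam \<alpha> \<psi> \<longleftrightarrow>
     C2_hoelder r \<Omega> \<psi> \<and>
     (\<forall>x\<in>\<Omega>. - laplacian \<psi> x = (\<alpha> + lam * \<psi> x) powr p) \<and>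
     (LINT x:\<Omega>|lborel. (\<alpha> + lam * \<psi> x) powr p) = 1 \<and>
     (\<forall>x\<in>\<Omega>. \<psi> x > 0) \<and>
     (\<forall>x\<in>frontier \<Omega>. \<psi> x = 0) \<and>
     \<alpha> \<ge> 0"

end

theory Submission
  imports Defs
begin

text \<open>
Write \<open>N\<close> for the dimension. Both problems lead to functions \<open>u\<close> with
\<open>- \<Delta>u = u\<^sup>p\<close> and \<open>u > \<gamma>\<close> in \<open>\<Omega>\<close>, and \<open>u = \<gamma> \<ge> 0\<close> on the boundary; they are called
positive solutions below. If \<open>(\<alpha>, \<psi>)\<close> solves problem P with \<open>\<lambda> > 0\<close>, then
\<open>u = \<lambda>\<^bsup>1/(p-1)\<^esup> (\<alpha> + \<lambda>\<psi>)\<close> is a positive solution and \<open>\<integral>u\<^sup>p = \<lambda>\<^bsup>p/(p-1)\<^esup>\<close>. If \<open>(\<gamma>, v)\<close> solves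
problem F and \<open>\<gamma> \<ge> 0\<close>, then by the minimum principles \<open>v\<close> is a positive solution or constant, and
in the second case \<open>I = 0\<close>. So it suffices to bound, by constants that depend only on \<open>\<Omega>\<close> and
\<open>p\<close>, the integral of \<open>u\<^sup>p\<close> and the boundary flux of all positive solutions; the
number \<open>lambda_bar\<close> is the power \<open>(p - 1)/p\<close> of the larger of these constants and 1.

The heart is a bound for \<open>u\<close> near the boundary (\<open>boundary_bound\<close>). It comes from the method of moving
spheres. Take a ball that touches \<open>\<Omega>\<close> from outside at a boundary point, with centre \<open>y\<close>, and
compare \<open>u\<close> in the cap that a slightly larger concentric ball cuts off from \<open>\<Omega>\<close> with its Kelvin
transform. Since \<open>(N - 2) p < N + 2\<close>, the Kelvin transform satisfies the equation with a
strict inequality, so the comparison \<open>moving_spheres\<close> cannot break down while the radius grows. It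
says that \<open>u\<close>, multiplied by a power of the distance to \<open>y\<close>, increases along the rays from
\<open>y\<close> as they enter \<open>\<Omega>\<close>. As \<open>y\<close> may vary in a small ball, a point \<open>x\<close> close to the boundary sees
a whole ball of fixed radius in \<open>\<Omega>\<close> on which \<open>u\<close> is at least a fixed multiple of \<open>u(x)\<close>. But a
positive solution cannot be large on a ball of given radius
(\<open>positive_solution_minimum_bound\<close>), so \<open>u(x)\<close> is bounded, and compactness of the boundary
makes the bound uniform.

Two consequences finish the proof. Away from the boundary, testing the equation with
powers of \<open>r\<^sup>2 - |x - z|\<^sup>2\<close> bounds \<open>\<integral>u\<^sup>p\<close> over balls, because \<open>p > 1\<close> allows the term with \<open>u\<close>
to be absorbed by the one with \<open>u\<^sup>p\<close>; a finite cover bounds the whole integral. At the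
boundary, a barrier turns the bound for \<open>u\<close> into one for the normal derivative, so the flux is
at most a constant times the area of the boundary.
That the area is finite follows from the Hopf lemma: a normal derivative which is bounded away from 0
can be integrable only over a set of finite measure, and the integral of a function that is not
integrable is 0.
\<close>

section \<open>Functions with a Laplacian at a point\<close>

text \<open>The maximum principle arguments below need second derivatives at one point only. Carrying the
gradient field \<open>G\<close> along makes the product and chain rules composable, and avoids
\<open>frechet_derivative\<close> as an operation.\<close>

definition has_laplacian ::
    "('a::euclidean_space \<Rightarrow> real) \<Rightarrow> ('a \<Rightarrow> 'a) \<Rightarrow> real \<Rightarrow> 'a \<Rightarrow> bool" where
  "has_laplacian f G L x \<longleftrightarrow>
     (\<forall>\<^sub>F y in nhds x. (f has_derivative (\<lambda>h. G y \<bullet> h)) (at y)) \<and>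
     (\<exists>D. (G has_derivative D) (at x) \<and> L = (\<Sum>i\<in>Basis. D i \<bullet> i))"

lemma has_laplacianI:
  assumes "\<forall>\<^sub>F y in nhds x. (f has_derivative (\<lambda>h. G y \<bullet> h)) (at y)"
    and "(G has_derivative D) (at x)" and "L = (\<Sum>i\<in>Basis. D i \<bullet> i)"
  shows "has_laplacian f G L x"
  using assms by (auto simp: has_laplacian_def)

lemma has_laplacian_add:
  assumes "has_laplacian f F L x" "has_laplacian g G M x"
  shows "has_laplacian (\<lambda>y. f y + g y) (\<lambda>y. F y + G y) (L + M) x"
proof -
  obtain D E where D: "(F has_derivative D) (at x)" "L = (\<Sum>i\<in>Basis. D i \<bullet> i)"
    and E: "(G has_derivative E) (at x)" "M = (\<Sum>i\<in>Basis. E i \<bullet> i)"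
    using assms by (auto simp: has_laplacian_def)
  have 1: "\<forall>\<^sub>F y in nhds x. ((\<lambda>y. f y + g y) has_derivative (\<lambda>h. (F y + G y) \<bullet> h)) (at y)"
    using assms[unfolded has_laplacian_def, THEN conjunct1]
    by eventually_elim (auto intro!: derivative_eq_intros simp: inner_add_left)
  show ?thesis
    by (rule has_laplacianI[OF 1 has_derivative_add[OF D(1) E(1)]])
      (simp add: D E inner_add_left sum.distrib)
qed

lemma has_laplacian_cmult:
  assumes "has_laplacian f F L x"
  shows "has_laplacian (\<lambda>y. c * f y) (\<lambda>y. c *\<^sub>R F y) (c * L) x"
proof -
  obtain D where D: "(F has_derivative D) (at x)" "L = (\<Sum>i\<in>Basis. D i \<bullet> i)"
    using assms by (auto simp: has_laplacian_def)
  have 1: "\<forall>\<^sub>F y in nhds x. ((\<lambda>y. c * f y) has_derivative (\<lambda>h. (c *\<^sub>R F y) \<bullet> h)) (at y)"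
    using assms[unfolded has_laplacian_def, THEN conjunct1]
    by (elim eventually_mono) (auto intro!: derivative_eq_intros)
  show ?thesis
    by (rule has_laplacianI[OF 1 has_derivative_scaleR_right[OF D(1)]])
      (simp add: D sum_distrib_left)
qed

lemma has_laplacian_diff:
  assumes "has_laplacian f F L x" "has_laplacian g G M x"
  shows "has_laplacian (\<lambda>y. f y - g y) (\<lambda>y. F y - G y) (L - M) x"
  using has_laplacian_add[OF assms(1) has_laplacian_cmult[OF assms(2), of "-1"]] by simp

lemma has_laplacian_mult:
  assumes "has_laplacian f F L x" "has_laplacian g G M x"
  shows "has_laplacian (\<lambda>y. f y * g y) (\<lambda>y. f y *\<^sub>R G y + g y *\<^sub>R F y)
    (f x * M + 2 * (F x \<bullet> G x) + g x * L) x"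
proof -
  obtain D E where D: "(F has_derivative D) (at x)" "L = (\<Sum>i\<in>Basis. D i \<bullet> i)"
    and E: "(G has_derivative E) (at x)" "M = (\<Sum>i\<in>Basis. E i \<bullet> i)"
    using assms by (auto simp: has_laplacian_def)
  have f: "(f has_derivative (\<lambda>h. F x \<bullet> h)) (at x)" and g: "(g has_derivative (\<lambda>h. G x \<bullet> h)) (at x)"
    using assms by (auto simp: has_laplacian_def dest: eventually_nhds_x_imp_x)
  have 1: "\<forall>\<^sub>F y in nhds x. ((\<lambda>y. f y * g y) has_derivative (\<lambda>h. (f y *\<^sub>R G y + g y *\<^sub>R F y) \<bullet> h)) (at y)"
    using assms[unfolded has_laplacian_def, THEN conjunct1]
    by eventually_elim (auto intro!: derivative_eq_intros simp: inner_add_left)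
  have 2: "((\<lambda>y. f y *\<^sub>R G y + g y *\<^sub>R F y) has_derivative
     (\<lambda>h. f x *\<^sub>R E h + (F x \<bullet> h) *\<^sub>R G x + (g x *\<^sub>R D h + (G x \<bullet> h) *\<^sub>R F x))) (at x)"
    by (intro has_derivative_add has_derivative_scaleR f g D E)
  show ?thesis
    by (rule has_laplacianI[OF 1 2])
      (simp add: D E inner_add_left sum.distrib sum_distrib_left euclidean_inner[of "F x" "G x"] mult.commute)
qed

lemma has_laplacian_shift:
  assumes "has_laplacian f F L (x + a)"
  shows "has_laplacian (\<lambda>y. f (y + a)) (\<lambda>y. F (y + a)) L x"
proof -
  obtain D where D: "(F has_derivative D) (at (x + a))" "L = (\<Sum>i\<in>Basis. D i \<bullet> i)"
    using assms by (auto simp: has_laplacian_def)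
  have ev: "\<forall>\<^sub>F z in nhds (x + a). (f has_derivative (\<lambda>h. F z \<bullet> h)) (at z)"
    using assms by (auto simp: has_laplacian_def)
  have "((\<lambda>y. y + a) \<longlongrightarrow> x + a) (nhds x)"
    by (intro tendsto_intros filterlim_ident)
  from eventually_compose_filterlim[OF ev this]
  have "\<forall>\<^sub>F y in nhds x. (f has_derivative (\<lambda>h. F (y + a) \<bullet> h)) (at (y + a))" .
  then have 1: "\<forall>\<^sub>F y in nhds x. ((\<lambda>y. f (y + a)) has_derivative (\<lambda>h. F (y + a) \<bullet> h)) (at y)"
    apply (elim eventually_mono)
    subgoal for y
      by (rule has_derivative_compose[of "\<lambda>y. y + a" "\<lambda>h. h", rotated])
         (auto intro!: derivative_eq_intros)
    done
  have 2: "((\<lambda>y. F (y + a)) has_derivative D) (at x)"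
    by (rule has_derivative_compose[of "\<lambda>y. y + a" "\<lambda>h. h", OF _ D(1)])
         (auto intro!: derivative_eq_intros)
  show ?thesis by (rule has_laplacianI[OF 1 2 D(2)])
qed

text \<open>All barriers and test functions in this development are of the form \<open>H(|x - y|\<^sup>2)\<close>, which
is smooth at the centre, too.\<close>

lemma has_laplacian_radial:
  fixes x :: "'a::euclidean_space" and H H1 :: "real \<Rightarrow> real"
  assumes "\<forall>\<^sub>F s in nhds (x \<bullet> x). (H has_real_derivative H1 s) (at s)"
    and "(H1 has_real_derivative H2) (at (x \<bullet> x))"
  shows "has_laplacian (\<lambda>y. H (y \<bullet> y)) (\<lambda>y. (2 * H1 (y \<bullet> y)) *\<^sub>R y)
    (4 * (x \<bullet> x) * H2 + 2 * DIM('a) * H1 (x \<bullet> x)) x"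
proof -
  have "((\<lambda>y. y \<bullet> y) \<longlongrightarrow> x \<bullet> x) (nhds x)"
    by (intro tendsto_intros filterlim_ident)
  from eventually_compose_filterlim[OF assms(1) this]
  have 1: "\<forall>\<^sub>F y in nhds x. ((\<lambda>y. H (y \<bullet> y)) has_derivative (\<lambda>h. ((2 * H1 (y \<bullet> y)) *\<^sub>R y) \<bullet> h)) (at y)"
    apply (elim eventually_mono)
    subgoal for y
      apply (rule has_derivative_eq_rhs)
       apply (rule has_derivative_compose[of "\<lambda>y. y \<bullet> y", where g=H])
        apply (auto intro!: derivative_eq_intros simp: has_field_derivative_def)[2]
      apply (simp add: inner_commute algebra_simps)
      done
    done
  have H1: "((\<lambda>y. H1 (y \<bullet> y)) has_derivative (\<lambda>h. H2 * (2 * (x \<bullet> h)))) (at x)"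
      apply (rule has_derivative_eq_rhs)
       apply (rule has_derivative_compose[of "\<lambda>y. y \<bullet> y", where g=H1])
        apply (rule derivative_eq_intros refl)+
     apply (use assms(2) in \<open>auto simp: has_field_derivative_def\<close>)[1]
      apply (simp add: inner_commute algebra_simps)
      done
  have 2: "((\<lambda>y. (2 * H1 (y \<bullet> y)) *\<^sub>R y) has_derivative 
    (\<lambda>h. (2 * H1 (x \<bullet> x)) *\<^sub>R h + (2 * (H2 * (2 * (x \<bullet> h)))) *\<^sub>R x)) (at x)"
    by (intro has_derivative_scaleR has_derivative_mult_right H1 has_derivative_ident)
  have e: "(\<Sum>i\<in>Basis. (x \<bullet> i) * (x \<bullet> i)) = x \<bullet> x"
    by (simp add: euclidean_inner[of x x])
  show ?thesis
    by (rule has_laplacianI[OF 1 2])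
      (simp add: inner_add_left sum.distrib e[symmetric] sum_distrib_left sum_distrib_right algebra_simps)
qed

text \<open>The first-order term does not vanish unless \<open>N = 2\<close>; the weight in the Kelvin transform is
there to cancel it.\<close>

lemma has_laplacian_inversion:
  fixes x :: "'a::euclidean_space"
  assumes "has_laplacian u G L ((c / (x \<bullet> x)) *\<^sub>R x)" and x: "x \<noteq> 0"
  shows "has_laplacian (\<lambda>x. u ((c / (x \<bullet> x)) *\<^sub>R x))
     (\<lambda>x. (c / (x \<bullet> x)) *\<^sub>R (G ((c / (x \<bullet> x)) *\<^sub>R x) - (2 * (G ((c / (x \<bullet> x)) *\<^sub>R x) \<bullet> x) / (x \<bullet> x)) *\<^sub>R x))
     ((c / (x \<bullet> x))\<^sup>2 * L - 2 * c * (real DIM('a) - 2) * (G ((c / (x \<bullet> x)) *\<^sub>R x) \<bullet> x) / (x \<bullet> x)\<^sup>2) x"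
proof -
  define K where "K x = (c / (x \<bullet> x)) *\<^sub>R x" for x :: 'a
  obtain D where D: "(G has_derivative D) (at (K x))" "L = (\<Sum>i\<in>Basis. D i \<bullet> i)"
    using assms by (auto simp: has_laplacian_def K_def)
  have ev: "\<forall>\<^sub>F z in nhds (K x). (u has_derivative (\<lambda>h. G z \<bullet> h)) (at z)"
    using assms by (auto simp: has_laplacian_def K_def)
  have dq: "((\<lambda>y. c / (y \<bullet> y)) has_derivative (\<lambda>h. - 2 * c * (y \<bullet> h) / (y \<bullet> y)\<^sup>2)) (at y)" if "y \<noteq> 0" for y :: 'a
    using that
    by (auto intro!: derivative_eq_intros simp: field_simps power2_eq_square inner_commute)
  have dK: "(K has_derivative (\<lambda>h. (c / (y \<bullet> y)) *\<^sub>R h - (2 * c * (y \<bullet> h) / (y \<bullet> y)\<^sup>2) *\<^sub>R y)) (at y)"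
    if "y \<noteq> 0" for y
    unfolding K_def
    by (rule has_derivative_eq_rhs[OF has_derivative_scaleR[OF dq[OF that] has_derivative_ident]])
      (simp add: algebra_simps)
  have "(K \<longlongrightarrow> K x) (nhds x)"
    using has_derivative_continuous[OF dK[OF x]] by (simp add: isCont_def tendsto_at_iff_tendsto_nhds)
  from eventually_compose_filterlim[OF ev this]
  have 0: "\<forall>\<^sub>F y in nhds x. (u has_derivative (\<lambda>h. G (K y) \<bullet> h)) (at (K y))" .
  have nz: "\<forall>\<^sub>F y in nhds x. y \<noteq> 0"
    using x by (simp add: t1_space_nhds)
  have 1: "\<forall>\<^sub>F y in nhds x. ((\<lambda>x. u (K x)) has_derivative 
     (\<lambda>h. ((c / (y \<bullet> y)) *\<^sub>R (G (K y) - (2 * (G (K y) \<bullet> y) / (y \<bullet> y)) *\<^sub>R y)) \<bullet> h)) (at y)"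
    using 0 nz
  proof eventually_elim
    case (elim y)
    have yy: "y \<bullet> y \<noteq> 0" using elim by simp
    show ?case
      by (rule has_derivative_eq_rhs[OF has_derivative_compose[OF dK[OF elim(2)] elim(1)]])
        (use yy in \<open>simp add: fun_eq_iff inner_diff_left inner_diff_right field_simps power2_eq_square\<close>)
  qed
  define g where "g = G (K x)"
  define D' where "D' h = D ((c / (x \<bullet> x)) *\<^sub>R h - (2 * c * (x \<bullet> h) / (x \<bullet> x)\<^sup>2) *\<^sub>R x)" for h
  have dG: "((\<lambda>y. G (K y)) has_derivative D') (at x)"
    unfolding D'_def by (rule has_derivative_compose[OF dK[OF x] D(1)])
  interpret D: bounded_linear D using D(1) by (rule has_derivative_bounded_linear)
  define s where "s = x \<bullet> x"
  have s: "s \<noteq> 0" using x by (simp add: s_def)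
  have dr: "((\<lambda>y. 2 * (G (K y) \<bullet> y) / (y \<bullet> y)) has_derivative
      (\<lambda>h. 2 * (D' h \<bullet> x + g \<bullet> h) / s - 4 * (g \<bullet> x) * (x \<bullet> h) / s\<^sup>2)) (at x)"
    unfolding g_def s_def
    by (rule has_derivative_eq_rhs[OF has_derivative_divide[OF
          has_derivative_mult_right[OF has_derivative_inner[OF dG has_derivative_ident], of 2]
          has_derivative_inner[OF has_derivative_ident has_derivative_ident]]])
      (use x in \<open>simp_all add: fun_eq_iff field_simps power2_eq_square inner_commute\<close>)
  have 2: "((\<lambda>y. (c / (y \<bullet> y)) *\<^sub>R (G (K y) - (2 * (G (K y) \<bullet> y) / (y \<bullet> y)) *\<^sub>R y)) has_derivative
     (\<lambda>h. (c / s) *\<^sub>R (D' h - ((2 * (g \<bullet> x) / s) *\<^sub>R h + (2 * (D' h \<bullet> x + g \<bullet> h) / s - 4 * (g \<bullet> x) * (x \<bullet> h) / s\<^sup>2) *\<^sub>R x))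
       + (- 2 * c * (x \<bullet> h) / s\<^sup>2) *\<^sub>R (g - (2 * (g \<bullet> x) / s) *\<^sub>R x))) (at x)"
    unfolding g_def s_def
    by (intro has_derivative_scaleR dq[OF x] has_derivative_diff dG dr[unfolded g_def s_def] has_derivative_ident)
  have sD: "(\<Sum>i\<in>Basis. (D' i \<bullet> i)) = c / s * L - 2 * c / s\<^sup>2 * (D x \<bullet> x)"
  proof -
    have "D x \<bullet> x = (\<Sum>i\<in>Basis. (D x \<bullet> i) * (x \<bullet> i))" by (rule euclidean_inner)
    then show ?thesis
      unfolding D'_def D.diff D.scaleR D(2) inner_diff_left sum_subtractf sum_distrib_left
      by (simp add: s_def algebra_simps sum_distrib_left sum_divide_distrib)
  qed
  have sDx: "(\<Sum>i\<in>Basis. (D' i \<bullet> x) * (x \<bullet> i)) = - (c / s) * (D x \<bullet> x)"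
  proof -
    have "(\<Sum>i\<in>Basis. (D' i \<bullet> x) * (x \<bullet> i)) = D' (\<Sum>i\<in>Basis. (x \<bullet> i) *\<^sub>R i) \<bullet> x"
    proof -
      interpret D': bounded_linear D' using dG by (rule has_derivative_bounded_linear)
      show ?thesis by (simp add: D'.sum D'.scaleR inner_sum_left mult.commute)
    qed
    also have "\<dots> = D' x \<bullet> x" by (simp only: euclidean_representation)
    also have "\<dots> = - (c / s) * (D x \<bullet> x)"
      unfolding D'_def D.diff D.scaleR inner_diff_left using s
      by (simp add: field_simps power2_eq_square s_def[symmetric])
    finally show ?thesis .
  qed
  have e: "(\<Sum>i\<in>Basis. (x \<bullet> i) * (x \<bullet> i)) = s" "(\<Sum>i\<in>Basis. (g \<bullet> i) * (x \<bullet> i)) = g \<bullet> x"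
    by (simp_all add: euclidean_inner[of x x] euclidean_inner[of g x] s_def)
  have 3: "(\<Sum>i\<in>Basis. ((c / s) *\<^sub>R (D' i - ((2 * (g \<bullet> x) / s) *\<^sub>R i + (2 * (D' i \<bullet> x + g \<bullet> i) / s - 4 * (g \<bullet> x) * (x \<bullet> i) / s\<^sup>2) *\<^sub>R x))
       + (- 2 * c * (x \<bullet> i) / s\<^sup>2) *\<^sub>R (g - (2 * (g \<bullet> x) / s) *\<^sub>R x)) \<bullet> i)
     = (c / s)\<^sup>2 * L - 2 * c * (real DIM('a) - 2) * (g \<bullet> x) / s\<^sup>2" (is "?l = _")
  proof -
    have "?l = (\<Sum>i\<in>Basis. (c / s) * (D' i \<bullet> i) - (c / s) * (2 * (g \<bullet> x) / s)
        - (2 * c / s\<^sup>2) * ((D' i \<bullet> x) * (x \<bullet> i)) - (2 * c / s\<^sup>2) * ((g \<bullet> i) * (x \<bullet> i))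
        + (4 * c * (g \<bullet> x) / s^3) * ((x \<bullet> i) * (x \<bullet> i)) 
        - (2 * c / s\<^sup>2) * ((g \<bullet> i) * (x \<bullet> i)) + (4 * c * (g \<bullet> x) / s^3) * ((x \<bullet> i) * (x \<bullet> i)))"
      apply (rule sum.cong[OF refl])
      using s apply (simp add: inner_add_left inner_diff_left inner_add_right field_simps power2_eq_square power3_eq_cube)
      done
    also have "\<dots> = (c / s) * (c / s * L - 2 * c / s\<^sup>2 * (D x \<bullet> x)) - DIM('a) * ((c / s) * (2 * (g \<bullet> x) / s))
        - (2 * c / s\<^sup>2) * (- (c / s) * (D x \<bullet> x)) - (2 * c / s\<^sup>2) * (g \<bullet> x)
        + (4 * c * (g \<bullet> x) / s^3) * s - (2 * c / s\<^sup>2) * (g \<bullet> x) + (4 * c * (g \<bullet> x) / s^3) * s"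
      by (simp only: sum.distrib sum_subtractf sum_distrib_left[symmetric] sD sDx e sum_constant) simp
    also have "\<dots> = (c / s)\<^sup>2 * L - 2 * c * (real DIM('a) - 2) * (g \<bullet> x) / s\<^sup>2"
      using s by (simp add: field_simps power2_eq_square power3_eq_cube)
    finally show ?thesis .
  qed
  show ?thesis
    using has_laplacianI[OF 1 2 3[symmetric]] unfolding K_def g_def s_def .
qed

text \<open>The weight \<open>|x|\<^bsup>2-N\<^esup>\<close> is harmonic, and its gradient is radial, so that the mixed
term of the product rule cancels the first-order term of the inversion.\<close>

lemma has_laplacian_kelvin:
  fixes x :: "'a::euclidean_space"
  assumes u: "has_laplacian u G L ((c / (x \<bullet> x)) *\<^sub>R x)" and x: "x \<noteq> 0"
  shows "\<exists>F. has_laplacian (\<lambda>x. (x \<bullet> x) powr (1 - DIM('a) / 2) * u ((c / (x \<bullet> x)) *\<^sub>R x)) F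
     ((x \<bullet> x) powr (1 - DIM('a) / 2) * (c / (x \<bullet> x))\<^sup>2 * L) x"
proof -
  define a :: real where "a = 1 - DIM('a) / 2"
  define s where "s = x \<bullet> x"
  have s: "s > 0" using x by (simp add: s_def)
  have 1: "has_laplacian (\<lambda>y::'a. (y \<bullet> y) powr a) (\<lambda>y. (2 * (a * (y \<bullet> y) powr (a - 1))) *\<^sub>R y)
    (4 * (x \<bullet> x) * (a * ((a - 1) * (x \<bullet> x) powr (a - 1 - 1))) + 2 * DIM('a) * (a * (x \<bullet> x) powr (a - 1))) x"
  proof (rule has_laplacian_radial)
    have "\<forall>\<^sub>F s in nhds (x \<bullet> x). s \<in> {0<..}"
      by (rule eventually_nhds_in_open) (use s s_def in auto)
    then show "\<forall>\<^sub>F s in nhds (x \<bullet> x). ((\<lambda>s. s powr a) has_real_derivative a * s powr (a - 1)) (at s)"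
      by eventually_elim (auto intro: has_real_derivative_powr)
    show "((\<lambda>s. a * s powr (a - 1)) has_real_derivative a * ((a - 1) * (x \<bullet> x) powr (a - 1 - 1))) (at (x \<bullet> x))"
      by (intro DERIV_cmult has_real_derivative_powr) (use s in \<open>simp add: s_def\<close>)
  qed
  have p: "s powr (a - 1) = s powr a / s" "s powr (a - 1 - 1) = s powr a / s\<^sup>2"
    using s by (simp_all add: powr_diff power2_eq_square)
  define g where "g = G ((c / s) *\<^sub>R x) \<bullet> x"
  have eq: "s powr a * ((c / s)\<^sup>2 * L - 2 * c * (real DIM('a) - 2) * g / s\<^sup>2)
    + 2 * (((2 * (a * s powr (a - 1))) *\<^sub>R x) \<bullet> ((c / s) *\<^sub>R (G ((c / s) *\<^sub>R x) - (2 * g / s) *\<^sub>R x)))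
    + u ((c / s) *\<^sub>R x) * (4 * s * (a * ((a - 1) * s powr (a - 1 - 1))) + 2 * DIM('a) * (a * s powr (a - 1)))
    = s powr a * (c / s)\<^sup>2 * L"
  proof -
    have i: "x \<bullet> ((c / s) *\<^sub>R (G ((c / s) *\<^sub>R x) - (2 * g / s) *\<^sub>R x)) = - (c / s) * g"
      using s by (simp add: inner_diff_right s_def[symmetric] g_def inner_commute)
    have n: "real DIM('a) = 2 - 2 * a" by (simp add: a_def)
    show ?thesis
      unfolding p inner_scaleR_left i using s
      by (simp add: n field_simps power2_eq_square)
  qed
  show ?thesis
    using has_laplacian_mult[OF 1 has_laplacian_inversion[OF u x]]
    unfolding s_def[symmetric] g_def[symmetric] eq unfolding a_def by blast
qed

lemma second_derivative_test_real:
  fixes \<phi> :: "real \<Rightarrow> real"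
  assumes d: "\<forall>\<^sub>F t in nhds 0. (\<phi> has_real_derivative \<phi>' t) (at t)"
    and d2: "(\<phi>' has_real_derivative d) (at 0)"
    and min: "\<forall>\<^sub>F t in nhds 0. \<phi> 0 \<le> \<phi> t"
  shows "\<phi>' 0 = 0" "0 \<le> d"
proof -
  obtain e where e: "e > 0" "\<And>t. \<bar>t\<bar> < e \<Longrightarrow> (\<phi> has_real_derivative \<phi>' t) (at t)"
      "\<And>t. \<bar>t\<bar> < e \<Longrightarrow> \<phi> 0 \<le> \<phi> t"
    using eventually_conj[OF d min] unfolding eventually_nhds_metric by (auto simp: dist_real_def)
  show z: "\<phi>' 0 = 0"
    by (rule DERIV_local_min[OF e(2) e(1)]) (use e in auto)
  show "0 \<le> d"
  proof (rule ccontr)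
    assume "\<not> 0 \<le> d"
    then obtain e' where e': "e' > 0" "\<And>h. 0 < h \<Longrightarrow> h < e' \<Longrightarrow> \<phi>' h < 0"
      using DERIV_neg_dec_right[OF d2] z by auto
    define t where "t = min e e' / 2"
    have t: "0 < t" "t < e" "t < e'" using e e' by (auto simp: t_def)
    obtain h where "0 < h" "h < t" "\<phi> t - \<phi> 0 = (t - 0) * \<phi>' h"
      using MVT2[of 0 t \<phi> \<phi>'] t e(2) by auto
    moreover have "\<phi>' h < 0" using e' calculation t by auto
    ultimately have "\<phi> t - \<phi> 0 < 0" using t by (simp add: mult_pos_neg)
    then show False using e(3)[of t] t by simp
  qed
qed

text \<open>This is the only form in which second derivatives enter a comparison argument: every comparison
below looks at the minimum of a difference of functions with known Laplacians.\<close>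

lemma has_laplacian_local_min:
  assumes "has_laplacian f G L x" and min: "\<forall>\<^sub>F y in nhds x. f x \<le> f y"
  shows "0 \<le> L" "G x = 0"
proof -
  obtain D where D: "(G has_derivative D) (at x)" "L = (\<Sum>i\<in>Basis. D i \<bullet> i)"
    and ev: "\<forall>\<^sub>F y in nhds x. (f has_derivative (\<lambda>h. G y \<bullet> h)) (at y)"
    using assms by (auto simp: has_laplacian_def)
  interpret D: bounded_linear D using D(1) by (rule has_derivative_bounded_linear)
  have *: "G x \<bullet> i = 0 \<and> 0 \<le> D i \<bullet> i" for i
  proof -
    define \<phi> where "\<phi> t = f (x + t *\<^sub>R i)" for t
    have lim: "((\<lambda>t. x + t *\<^sub>R i) \<longlongrightarrow> x) (nhds 0)"
      by (rule tendsto_eq_intros filterlim_ident refl | simp)+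
    have d1: "\<forall>\<^sub>F t in nhds 0. (\<phi> has_real_derivative G (x + t *\<^sub>R i) \<bullet> i) (at t)"
      using eventually_compose_filterlim[OF ev lim]
    proof eventually_elim
      case (elim t)
      have "((\<lambda>t. x + t *\<^sub>R i) has_derivative (\<lambda>h. h *\<^sub>R i)) (at t)"
        by (auto intro!: derivative_eq_intros)
      from has_derivative_compose[OF this elim]
      show ?case
        unfolding has_field_derivative_def \<phi>_def by (rule has_derivative_eq_rhs) (simp add: fun_eq_iff)
    qed
    have "((\<lambda>t. x + t *\<^sub>R i) has_derivative (\<lambda>h. h *\<^sub>R i)) (at 0)"
        by (auto intro!: derivative_eq_intros)
    from has_derivative_compose[OF this, of G D] D
    have "((\<lambda>t. G (x + t *\<^sub>R i)) has_derivative (\<lambda>h. D (h *\<^sub>R i))) (at 0)" by simp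
    then have "((\<lambda>t. G (x + t *\<^sub>R i) \<bullet> i) has_derivative (\<lambda>h. D (h *\<^sub>R i) \<bullet> i)) (at 0)"
      by (rule has_derivative_inner_left)
    then have d2: "((\<lambda>t. G (x + t *\<^sub>R i) \<bullet> i) has_real_derivative D i \<bullet> i) (at 0)"
      unfolding has_field_derivative_def by (elim has_derivative_eq_rhs) (simp add: fun_eq_iff D.scaleR)
    have "\<forall>\<^sub>F t in nhds 0. \<phi> 0 \<le> \<phi> t"
      using eventually_compose_filterlim[OF min lim] by (simp add: \<phi>_def)
    from second_derivative_test_real[OF d1 d2 this] show ?thesis by simp
  qed
  show "0 \<le> L" unfolding D by (intro sum_nonneg) (use * in blast)
  show "G x = 0" using *[of "G x"] by simp
qed

lemma gradient_has_derivative: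
  assumes "f differentiable (at x)"
  shows "(f has_derivative (\<lambda>h. gradient f x \<bullet> h)) (at x)"
proof -
  have d: "(f has_derivative frechet_derivative f (at x)) (at x)"
    using assms frechet_derivative_works by blast
  interpret D: bounded_linear "frechet_derivative f (at x)"
    using d by (rule has_derivative_bounded_linear)
  have "frechet_derivative f (at x) h = gradient f x \<bullet> h" for h
  proof -
    have "frechet_derivative f (at x) h = frechet_derivative f (at x) (\<Sum>i\<in>Basis. (h \<bullet> i) *\<^sub>R i)"
      by (simp only: euclidean_representation)
    also have "\<dots> = gradient f x \<bullet> h"
      by (simp add: D.sum D.scaleR gradient_def partial_deriv_def inner_sum_left inner_commute[of h] mult.commute)
    finally show ?thesis .
  qed
  then show ?thesis by (intro has_derivative_eq_rhs[OF d] ext)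
qed

lemma C2_has_laplacian:
  assumes C: "C_k_on 2 \<Omega> u" and "open \<Omega>" "x \<in> \<Omega>"
  shows "has_laplacian u (gradient u) (laplacian u x) x"
proof (rule has_laplacianI)
  have d: "u differentiable (at y)" "\<forall>i\<in>Basis. partial_deriv i u differentiable (at y)" if "y \<in> \<Omega>" for y
    using C assms(2) that by (auto simp: numeral_2_eq_2 differentiable_on_eq_differentiable_at)
  show "\<forall>\<^sub>F y in nhds x. (u has_derivative (\<bullet>) (gradient u y)) (at y)"
    using eventually_nhds_in_open[OF assms(2,3)] by eventually_elim (intro gradient_has_derivative d)
  show "(gradient u has_derivative (\<lambda>h. \<Sum>i\<in>Basis. frechet_derivative (partial_deriv i u) (at x) h *\<^sub>R i)) (at x)"
    unfolding gradient_def[abs_def]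
    by (intro has_derivative_sum has_derivative_scaleR_left)
      (use d[OF assms(3)] frechet_derivative_works in blast)
  show "laplacian u x = (\<Sum>i\<in>Basis. (\<Sum>j\<in>Basis. frechet_derivative (partial_deriv j u) (at x) i *\<^sub>R j) \<bullet> i)"
    unfolding laplacian_def partial_deriv_def[of _ "partial_deriv _ _"]
    by (intro sum.cong refl) (simp add: inner_sum_left inner_Basis sum.delta' if_distrib cong: if_cong)
qed

lemma C_k_on_Suc_imp: "C_k_on (Suc k) S f \<Longrightarrow> C_k_on k S f"
  by (induction k arbitrary: f) (auto intro: differentiable_imp_continuous_on)

lemma C_k_on_mono: "C_k_on k S f \<Longrightarrow> j \<le> k \<Longrightarrow> C_k_on j S f"
  by (induction k) (auto simp: le_Suc_eq dest: C_k_on_Suc_imp simp del: C_k_on.simps(2))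

lemma partial_deriv_cong_open:
  assumes "open \<Omega>" "\<And>x. x \<in> \<Omega> \<Longrightarrow> f x = g x" "x \<in> \<Omega>"
  shows "partial_deriv i f x = partial_deriv i g x"
proof -
  have "(f has_derivative D) (at x) \<longleftrightarrow> (g has_derivative D) (at x)" for D
    using has_derivative_transform_within_open[OF _ assms(1,3), of f D UNIV g]
      has_derivative_transform_within_open[OF _ assms(1,3), of g D UNIV f] assms(2) by auto
  then show ?thesis by (simp add: partial_deriv_def frechet_derivative_def)
qed

lemma C_k_on_cong:
  assumes "open \<Omega>"
  shows "C_k_on k \<Omega> f \<Longrightarrow> (\<And>x. x \<in> \<Omega> \<Longrightarrow> f x = g x) \<Longrightarrow> C_k_on k \<Omega> g"
proof (induction k arbitrary: f g)
  case 0
  have "continuous_on \<Omega> f" using 0 by simp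
  then have "continuous_on \<Omega> g" by (rule continuous_on_eq) (rule 0(2))
  then show ?case by simp
next
  case (Suc k)
  have "g differentiable (at x)" if "x \<in> \<Omega>" for x
  proof -
    have "f differentiable (at x)"
      using Suc.prems assms that by (auto simp: differentiable_on_eq_differentiable_at)
    then obtain D where "(f has_derivative D) (at x)" by (auto simp: differentiable_def)
    then have "(g has_derivative D) (at x)"
      by (rule has_derivative_transform_within_open[OF _ assms that Suc.prems(2)])
    then show ?thesis by (rule differentiableI)
  qed
  then have "g differentiable_on \<Omega>" using assms by (simp add: differentiable_on_eq_differentiable_at)
  moreover have "C_k_on k \<Omega> (partial_deriv i g)" if "i \<in> Basis" for i
  proof (rule Suc.IH)
    show "C_k_on k \<Omega> (partial_deriv i f)" using Suc.prems(1) that by simp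
    show "partial_deriv i f x = partial_deriv i g x" if "x \<in> \<Omega>" for x
      using Suc.prems(2) that by (rule partial_deriv_cong_open[OF assms])
  qed
  ultimately show ?case by simp
qed

lemma partial_deriv_affine:
  assumes "f differentiable (at x)"
  shows "partial_deriv i (\<lambda>x. a + b * f x) x = b * partial_deriv i f x"
proof -
  have "((\<lambda>x. a + b * f x) has_derivative (\<lambda>h. b * frechet_derivative f (at x) h)) (at x)"
    using assms frechet_derivative_works by (auto intro!: derivative_eq_intros)
  from frechet_derivative_at[OF this] show ?thesis by (simp add: partial_deriv_def fun_eq_iff)
qed

text \<open>Needed because the functions of problem P become positive solutions only after an affine change.\<close>

lemma C_k_on_affine:
  assumes "open \<Omega>"
  shows "C_k_on k \<Omega> f \<Longrightarrow> C_k_on k \<Omega> (\<lambda>x. a + b * f x)"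
proof (induction k arbitrary: f a)
  case 0
  then show ?case by (auto intro!: continuous_intros)
next
  case (Suc k)
  have d: "f differentiable (at x)" if "x \<in> \<Omega>" for x
    using Suc.prems assms that by (auto simp: differentiable_on_eq_differentiable_at)
  have "C_k_on k \<Omega> (partial_deriv i (\<lambda>x. a + b * f x))" if "i \<in> Basis" for i
  proof (rule C_k_on_cong[OF assms])
    show "C_k_on k \<Omega> (\<lambda>x. 0 + b * partial_deriv i f x)" using Suc.prems that by (intro Suc.IH) simp
    show "0 + b * partial_deriv i f x = partial_deriv i (\<lambda>x. a + b * f x) x" if "x \<in> \<Omega>" for x
      using partial_deriv_affine[OF d[OF that]] by simp
  qed
  then show ?case using Suc.prems by (auto intro!: derivative_intros)
qed

lemma laplacian_affine:
  assumes op: "open \<Omega>" and C2: "C_k_on 2 \<Omega> f" and x: "x \<in> \<Omega>"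
  shows "laplacian (\<lambda>x. a + b * f x) x = b * laplacian f x"
proof -
  have d: "f differentiable (at x)" "\<And>i. i \<in> Basis \<Longrightarrow> partial_deriv i f differentiable (at x)" if "x \<in> \<Omega>" for x
    using C2 op that by (auto simp: numeral_2_eq_2 differentiable_on_eq_differentiable_at)
  have "partial_deriv i (partial_deriv i (\<lambda>x. a + b * f x)) x = b * partial_deriv i (partial_deriv i f) x" if "i \<in> Basis" for i
  proof -
    have "partial_deriv i (partial_deriv i (\<lambda>x. a + b * f x)) x = partial_deriv i (\<lambda>x. 0 + b * partial_deriv i f x) x"
      by (rule partial_deriv_cong_open[OF op _ x]) (simp add: partial_deriv_affine d)
    also have "\<dots> = b * partial_deriv i (partial_deriv i f) x" by (rule partial_deriv_affine) (use d x that in auto)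
    finally show ?thesis .
  qed
  then show ?thesis by (simp add: laplacian_def sum_distrib_left)
qed

section \<open>Moving spheres\<close>

text \<open>The condition \<open>u > \<gamma>\<close>, not just \<open>u \<ge> \<gamma>\<close>, excludes the zero function and makes the
comparison with the reflected function strict at boundary points.\<close>

definition positive_solution ::
    "'a::euclidean_space set \<Rightarrow> real \<Rightarrow> real \<Rightarrow> ('a \<Rightarrow> real) \<Rightarrow> bool" where
  "positive_solution \<Omega> p \<gamma> u \<longleftrightarrow>
     C_k_on 2 \<Omega> u \<and> continuous_on (closure \<Omega>) u \<and>
     (\<forall>x\<in>\<Omega>. - laplacian u x = u x powr p) \<and>
     (\<forall>x\<in>\<Omega>. \<gamma> < u x) \<and> (\<forall>x\<in>frontier \<Omega>. u x = \<gamma>) \<and> 0 \<le> \<gamma>"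

text \<open>The Kelvin transform of \<open>u\<close> with respect to the sphere about \<open>y\<close> of radius
\<open>sqrt c\<close>, normalised so that it agrees with \<open>u\<close> on that sphere: the weight is
\<open>(\<rho>/|x - y|)\<^bsup>N-2\<^esup>\<close> with \<open>\<rho>\<^sup>2 = c\<close>. The square of the radius is the convenient
parameter, since then no square roots occur.\<close>

definition sphere_reflection ::
    "'a::euclidean_space \<Rightarrow> real \<Rightarrow> ('a \<Rightarrow> real) \<Rightarrow> 'a \<Rightarrow> real" where
  "sphere_reflection y c u x =
     (c / ((x - y) \<bullet> (x - y))) powr (DIM('a) / 2 - 1) * u (y + (c / ((x - y) \<bullet> (x - y))) *\<^sub>R (x - y))"

lemma has_laplacian_sphere_reflection:
  fixes x y :: "'a::euclidean_space"
  assumes u: "has_laplacian u G L (y + (c / ((x - y) \<bullet> (x - y))) *\<^sub>R (x - y))" and x: "x \<noteq> y"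
    and c: "c > 0"
  shows "\<exists>F. has_laplacian (sphere_reflection y c u) F
     ((c / ((x - y) \<bullet> (x - y))) powr (DIM('a) / 2 - 1) * (c / ((x - y) \<bullet> (x - y)))\<^sup>2 * L) x"
proof -
  define N where "N = real DIM('a)"
  have "has_laplacian (\<lambda>z. u (z + y)) (\<lambda>z. G (z + y)) L ((c / ((x - y) \<bullet> (x - y))) *\<^sub>R (x - y))"
    by (rule has_laplacian_shift) (use u in \<open>simp add: add.commute\<close>)
  from has_laplacian_kelvin[OF this] x obtain F where
    "has_laplacian (\<lambda>z. (z \<bullet> z) powr (1 - N / 2) * u ((c / (z \<bullet> z)) *\<^sub>R z + y)) F
      (((x - y) \<bullet> (x - y)) powr (1 - N / 2) * (c / ((x - y) \<bullet> (x - y)))\<^sup>2 * L) (x + (- y))"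
    unfolding N_def by auto
  from has_laplacian_cmult[OF has_laplacian_shift[OF this], of "c powr (N / 2 - 1)"]
  obtain F' where F': "has_laplacian (\<lambda>z. c powr (N / 2 - 1) * (((z - y) \<bullet> (z - y)) powr (1 - N / 2) *
       u ((c / ((z - y) \<bullet> (z - y))) *\<^sub>R (z - y) + y))) F'
      (c powr (N / 2 - 1) * (((x - y) \<bullet> (x - y)) powr (1 - N / 2) * (c / ((x - y) \<bullet> (x - y)))\<^sup>2 * L)) x"
    by auto
  have q: "c powr (N / 2 - 1) * s powr (1 - N / 2) = (c / s) powr (N / 2 - 1)" if "s \<ge> 0" for s
    using that c powr_minus_divide[of s "N / 2 - 1"] by (simp add: powr_divide)
  show ?thesis
    using F' unfolding sphere_reflection_def[abs_def] N_def[symmetric] q[OF inner_ge_zero, symmetric]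
    by (auto simp: mult.assoc add.commute)
qed

lemma powr_diff_le_tangent:
  fixes s t p :: real
  assumes "0 < s" "s \<le> t" "1 < p"
  shows "t powr p - s powr p \<le> p * t powr (p - 1) * (t - s)"
proof (cases "s = t")
  case False
  have "((\<lambda>x. x powr p) has_real_derivative p * x powr (p - 1)) (at x)" if "s \<le> x" for x
    using that assms by (intro has_real_derivative_powr) auto
  then obtain z where z: "s < z" "z < t" "t powr p - s powr p = (t - s) * (p * z powr (p - 1))"
    using MVT2[of s t "\<lambda>x. x powr p" "\<lambda>x. p * x powr (p - 1)"] assms False by auto
  have "z powr (p - 1) \<le> t powr (p - 1)"
    using z assms by (intro powr_mono2) auto
  then have "(t - s) * (p * z powr (p - 1)) \<le> (t - s) * (p * t powr (p - 1))"
    using assms by (intro mult_left_mono) auto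
  then show ?thesis using z by (simp add: mult_ac)
qed simp

lemma positive_solutionD:
  assumes "positive_solution \<Omega> p \<gamma> u"
  shows "C_k_on 2 \<Omega> u" "continuous_on (closure \<Omega>) u" "\<And>x. x \<in> \<Omega> \<Longrightarrow> - laplacian u x = u x powr p"
    "\<And>x. x \<in> \<Omega> \<Longrightarrow> \<gamma> < u x" "\<And>x. x \<in> frontier \<Omega> \<Longrightarrow> u x = \<gamma>" "0 \<le> \<gamma>"
    "\<And>x. x \<in> \<Omega> \<Longrightarrow> 0 < u x" "\<And>x. x \<in> closure \<Omega> \<Longrightarrow> \<gamma> \<le> u x"
proof -
  show 1: "C_k_on 2 \<Omega> u" "continuous_on (closure \<Omega>) u" "\<And>x. x \<in> \<Omega> \<Longrightarrow> - laplacian u x = u x powr p"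
    "\<And>x. x \<in> \<Omega> \<Longrightarrow> \<gamma> < u x" "\<And>x. x \<in> frontier \<Omega> \<Longrightarrow> u x = \<gamma>" "0 \<le> \<gamma>"
    using assms by (auto simp: positive_solution_def)
  show "\<And>x. x \<in> \<Omega> \<Longrightarrow> 0 < u x" using 1(4,6) by (meson le_less_trans)
  show "\<gamma> \<le> u x" if "x \<in> closure \<Omega>" for x
    using that 1(4)[of x] 1(5)[of x] by (cases "x \<in> \<Omega>") (auto simp: frontier_def interior_def)
qed

lemma positive_solution_has_laplacian:
  assumes "positive_solution \<Omega> p \<gamma> u" "open \<Omega>" "x \<in> \<Omega>"
  shows "has_laplacian u (gradient u) (- (u x powr p)) x"
  using C2_has_laplacian[OF positive_solutionD(1)[OF assms(1)] assms(2,3)] positive_solutionD(3)[OF assms(1,3)]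
  by (metis minus_minus)

lemma positive_solution_bounded:
  assumes "positive_solution \<Omega> p \<gamma> u" "bounded \<Omega>"
  obtains m where "m > 0" "\<And>x. x \<in> closure \<Omega> \<Longrightarrow> u x \<le> m"
proof -
  have "bounded (u ` closure \<Omega>)"
    using assms by (intro compact_imp_bounded compact_continuous_image positive_solutionD(2)) auto
  then obtain m where "m > 0" "\<forall>z\<in>u ` closure \<Omega>. norm z \<le> m" using bounded_pos by blast
  then show thesis by (intro that[of m]) (auto simp: abs_le_iff)
qed

text \<open>The squared radius \<open>c\<close> grows from \<open>c0\<close>, where the open ball does not meet \<open>\<Omega>\<close>, to
\<open>c1\<close>; by \<open>ray\<close>, reflection maps the caps into \<open>\<Omega>\<close>. Let \<open>W c\<close> be the Kelvin
transform minus \<open>u\<close>. If \<open>W c\<close> is negative somewhere in its cap, then it is negative at a point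
at a definite distance from the sphere, because a comparison function shows that negative values in
a thin shell must come from its inner side (\<open>narrow\<close>). Hence at the smallest
bad parameter \<open>d\<close> there is a point strictly inside the sphere where \<open>W d\<close> vanishes, and this
is a minimum of \<open>W d\<close>. In the interior of \<open>\<Omega>\<close> it contradicts
\<open>\<Delta>(W d) = u\<^sup>p - q\<^bsup>a+2\<^esup> u(x\<^sup>*)\<^sup>p < 0\<close> at zeros of \<open>W d\<close>, where \<open>q = d/|x - y|\<^sup>2 > 1\<close> and
\<open>u = q\<^sup>a u(x\<^sup>*)\<close>; here \<open>a p < a + 2\<close> is used. On the boundary it contradicts
\<open>u(x\<^sup>*) > \<gamma>\<close>.\<close>

lemma moving_spheres:
  fixes \<Omega> :: "'a::euclidean_space set" and y :: 'a and u :: "'a \<Rightarrow> real" and p \<gamma> c0 c1 :: real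
  defines "S \<equiv> \<lambda>x. (x - y) \<bullet> (x - y)"
  defines "a \<equiv> DIM('a) / 2 - 1"
  assumes sol: "positive_solution \<Omega> p \<gamma> u" and op: "open \<Omega>" and bd: "bounded \<Omega>"
    and dim: "DIM('a) \<ge> 2" and p: "1 < p" "a * p < a + 2"
    and c0: "0 < c0" and far: "\<And>x. x \<in> closure \<Omega> \<Longrightarrow> c0 \<le> S x"
    and ray: "\<And>x t. x \<in> closure \<Omega> \<Longrightarrow> S x < c1 \<Longrightarrow> 1 < t \<Longrightarrow> t \<le> c1 / c0 \<Longrightarrow> y + t *\<^sub>R (x - y) \<in> \<Omega>"
    and x: "x \<in> \<Omega>" and t: "1 < t" "t * S x \<le> c1"
  shows "u x \<le> t powr a * u (y + t *\<^sub>R (x - y))"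
proof -
  note solD = positive_solutionD[OF sol]
  have a0: "a \<ge> 0" using dim by (simp add: a_def)
  define W where "W c x = sphere_reflection y c u x - u x" for c x
  define K where "K = {k \<in> closure \<Omega> \<times> {c0..c1}. S (fst k) \<le> snd k}"
  have Spos: "S x > 0" "x \<noteq> y" if "x \<in> closure \<Omega>" for x
    using far[OF that] c0 by (auto simp: S_def)
  have Wdef: "W c x = (c / S x) powr a * u (y + (c / S x) *\<^sub>R (x - y)) - u x" for c x
    by (simp add: W_def sphere_reflection_def S_def a_def)
  have refl_in: "y + (c / S x) *\<^sub>R (x - y) \<in> \<Omega>" if "x \<in> closure \<Omega>" "S x < c" "c \<le> c1" for x c
  proof (rule ray)
    show "c / S x \<le> c1 / c0" using that far[OF that(1)] c0 Spos[OF that(1)] by (intro frac_le) auto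
  qed (use that Spos in auto)
  have refl_cl: "y + (c / S x) *\<^sub>R (x - y) \<in> closure \<Omega>" if "x \<in> closure \<Omega>" "S x \<le> c" "c \<le> c1" for x c
    using refl_in[OF that(1) _ that(3)] that Spos[OF that(1)] closure_subset[of \<Omega>]
    by (cases "S x = c") auto
  have W1: "W c x = 0" if "S x = c" "x \<in> closure \<Omega>" for c x
    unfolding Wdef using that(1) Spos(1)[OF that(2)] by auto
  have Wbd: "W c x > 0" if "x \<in> closure \<Omega>" "x \<notin> \<Omega>" "S x < c" "c \<le> c1" for c x
  proof -
    let ?z = "u (y + (c / S x) *\<^sub>R (x - y))"
    have "u x = \<gamma>" by (rule solD(5)) (use that op in \<open>simp add: frontier_def interior_open\<close>)
    moreover have z: "\<gamma> < ?z" by (rule solD(4)[OF refl_in]) (use that in auto)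
    moreover have "1 \<le> (c / S x) powr a"
      using that Spos[OF that(1)] a0 by (intro ge_one_powr_ge_zero) auto
    then have "?z \<le> (c / S x) powr a * ?z" using z solD(6) by (intro mult_le_cancel_right1[THEN iffD2]) auto
    ultimately show ?thesis unfolding Wdef by linarith
  qed
  have contS: "continuous_on A S" for A unfolding S_def by (intro continuous_intros)
  have contW: "continuous_on K (\<lambda>k. W (snd k) (fst k))"
  proof -
    have nz: "\<forall>k\<in>K. S (fst k) \<noteq> 0" using Spos by (fastforce simp: K_def)
    have cS: "continuous_on K (\<lambda>k. S (fst k))"
      by (rule continuous_on_compose2[OF contS[of UNIV]]) (auto intro!: continuous_intros)
    have q: "continuous_on K (\<lambda>k. snd k / S (fst k))"
      by (intro continuous_intros cS nz)
    have "continuous_on K (\<lambda>k. u (y + (snd k / S (fst k)) *\<^sub>R (fst k - y)))"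
      by (rule continuous_on_compose2[OF solD(2)]) (auto simp: K_def intro!: refl_cl continuous_intros q[unfolded K_def])
    moreover have "continuous_on K (\<lambda>k. u (fst k))"
      by (rule continuous_on_compose2[OF solD(2)]) (auto simp: K_def intro!: continuous_intros)
    moreover have "continuous_on K (\<lambda>k. (snd k / S (fst k)) powr a)"
    proof (intro continuous_on_powr q continuous_intros ballI)
      fix k assume "k \<in> K"
      then show "snd k / S (fst k) \<noteq> 0" using Spos[of "fst k"] c0 by (auto simp: K_def)
    qed
    ultimately show ?thesis unfolding Wdef by (intro continuous_on_diff continuous_on_mult)
  qed
  have cK: "compact K"
  proof -
    have "K = (closure \<Omega> \<times> {c0..c1}) \<inter> {k. S (fst k) \<le> snd k}" by (auto simp: K_def)
    moreover have "closed {k. S (fst k) \<le> snd k}"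
      unfolding S_def by (intro closed_Collect_le continuous_intros)
    ultimately show ?thesis using bd by (auto intro!: compact_Int_closed compact_Times)
  qed
  have contWc: "continuous_on {x \<in> closure \<Omega>. S x \<le> c} (W c)" if "c0 \<le> c" "c \<le> c1" for c
  proof -
    have "continuous_on {x \<in> closure \<Omega>. S x \<le> c} (\<lambda>x. W (snd (x, c)) (fst (x, c)))"
      by (rule continuous_on_compose2[OF contW]) (use that in \<open>auto simp: K_def intro!: continuous_intros\<close>)
    then show ?thesis by simp
  qed
  have lapW: "\<exists>F. has_laplacian (W c) F (u x powr p - (c / S x) powr (a + 2) * u (y + (c / S x) *\<^sub>R (x - y)) powr p) x"
    if "x \<in> \<Omega>" "S x < c" "c \<le> c1" for c x
  proof -
    have xc: "x \<in> closure \<Omega>" using that closure_subset by auto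
    have q: "c / S x > 0" "c > 0" using Spos[OF xc] that by auto
    have "\<exists>F. has_laplacian (sphere_reflection y c u) F
      ((c / S x) powr a * (c / S x)\<^sup>2 * - (u (y + (c / S x) *\<^sub>R (x - y)) powr p)) x"
      unfolding S_def a_def
      by (rule has_laplacian_sphere_reflection)
        (use positive_solution_has_laplacian[OF sol op refl_in[OF xc that(2,3)]] q Spos[OF xc] in \<open>auto simp: S_def\<close>)
    then obtain F where F: "has_laplacian (sphere_reflection y c u) F
      ((c / S x) powr a * (c / S x)\<^sup>2 * - (u (y + (c / S x) *\<^sub>R (x - y)) powr p)) x" by blast
    have "(c / S x) powr a * (c / S x)\<^sup>2 = (c / S x) powr (a + 2)"
      using q powr_realpow[OF q(1), of 2] by (simp add: powr_add)
    with has_laplacian_diff[OF F positive_solution_has_laplacian[OF sol op that(1)]]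
    show ?thesis unfolding W_def by auto
  qed
  have q_gt: "(c / S x) powr (a * p) < (c / S x) powr (a + 2)" if "x \<in> closure \<Omega>" "S x < c" for c x
    using that Spos[OF that(1)] p by (intro powr_less_mono) auto
  obtain m where m: "m > 0" "\<And>x. x \<in> closure \<Omega> \<Longrightarrow> u x \<le> m"
    using positive_solution_bounded[OF sol bd] by blast
  \<comment> \<open>the Lipschitz constant of the nonlinearity on the range of \<open>u\<close>\<close>
  define \<Lambda> where "\<Lambda> = p * m powr (p - 1)"
  have \<Lambda>: "\<Lambda> > 0" using p m by (simp add: \<Lambda>_def)
  \<comment> \<open>chosen such that the comparison function \<open>H\<close> below satisfies \<open>- \<Delta>H > \<Lambda> H\<close>, while \<open>1/2 \<le> H \<le> 1\<close>\<close>
  define A where "A = (\<Lambda> + 1) / (8 * c0)"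
  have A: "A > 0" using \<Lambda> c0 by (simp add: A_def)
  define \<sigma> where "\<sigma> = sqrt (1 / (2 * A))"
  have \<sigma>: "\<sigma> > 0" "A * \<sigma>\<^sup>2 = 1 / 2" using A by (simp_all add: \<sigma>_def real_sqrt_pow2)
  have narrow: "\<exists>x \<in> closure \<Omega>. S x \<le> c - \<sigma> \<and> W c x < 0"
    if bad: "\<exists>x \<in> closure \<Omega>. S x \<le> c \<and> W c x < 0" and c: "c0 \<le> c" "c \<le> c1" for c
  proof (rule ccontr)
    assume "\<not> ?thesis"
    then have inner: "W c x \<ge> 0" if "x \<in> closure \<Omega>" "S x \<le> c - \<sigma>" for x using that by force
    define H where "H s = 1 - A * (s - (c - \<sigma>))\<^sup>2" for s
    have H: "1/2 \<le> H s" "H s \<le> 1" if "c - \<sigma> \<le> s" "s \<le> c" for s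
    proof -
      have "(s - (c - \<sigma>))\<^sup>2 \<le> \<sigma>\<^sup>2" using that by (intro power_mono) auto
      then have "A * (s - (c - \<sigma>))\<^sup>2 \<le> 1 / 2" using A \<sigma> by (metis mult_left_mono less_imp_le)
      then show "1/2 \<le> H s" "H s \<le> 1" using A by (auto simp: H_def)
    qed
    define T where "T = {x \<in> closure \<Omega>. c - \<sigma> \<le> S x \<and> S x \<le> c}"
    have cT: "compact T"
    proof -
      have "T = closure \<Omega> \<inter> {x. c - \<sigma> \<le> S x \<and> S x \<le> c}" by (auto simp: T_def)
      moreover have "closed {x. c - \<sigma> \<le> S x \<and> S x \<le> c}"
        unfolding S_def by (intro closed_Collect_conj closed_Collect_le continuous_intros)
      ultimately show ?thesis using bd by (auto intro!: compact_Int_closed)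
    qed
    from bad obtain xb where xb: "xb \<in> closure \<Omega>" "S xb \<le> c" "W c xb < 0" by blast
    with inner have xbT: "xb \<in> T" by (force simp: T_def)
    have "continuous_on T (\<lambda>x. W c x / H (S x))"
    proof (intro continuous_intros ballI)
      show "continuous_on T (W c)" by (rule continuous_on_subset[OF contWc[OF c]]) (auto simp: T_def)
      show "continuous_on T (\<lambda>x. H (S x))" unfolding H_def by (intro continuous_intros contS)
      show "H (S x) \<noteq> 0" if "x \<in> T" for x using H(1)[of "S x"] that by (auto simp: T_def)
    qed
    from continuous_attains_inf[OF cT _ this] xbT obtain x0 where x0: "x0 \<in> T"
        "\<And>x. x \<in> T \<Longrightarrow> W c x0 / H (S x0) \<le> W c x / H (S x)" by blast
    \<comment> \<open>\<open>W c + \<tau> H\<close> is nonnegative in the shell and vanishes at \<open>x0\<close>\<close>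
    define \<tau> where "\<tau> = - (W c x0 / H (S x0))"
    have Hx0: "H (S x0) > 0" "H (S x0) \<le> 1" using H[of "S x0"] x0(1) by (auto simp: T_def)
    have "W c xb / H (S xb) < 0" using H(1)[of "S xb"] xb xbT by (intro divide_neg_pos) (auto simp: T_def)
    with x0(2)[OF xbT] have \<tau>: "\<tau> > 0" by (simp add: \<tau>_def)
    have W0: "W c x0 = - (\<tau> * H (S x0))" using Hx0 by (simp add: \<tau>_def)
    then have neg: "W c x0 < 0" using \<tau> Hx0 by simp
    have x0c: "x0 \<in> closure \<Omega>" "S x0 \<le> c" "c - \<sigma> \<le> S x0" using x0(1) by (auto simp: T_def)
    have lt: "S x0 < c" "c - \<sigma> < S x0"
      using neg W1[of x0 c] inner[of x0] x0c by (force simp: less_le)+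
    have x0\<Omega>: "x0 \<in> \<Omega>" using Wbd[of x0 c] neg x0c lt c by force
    have ge: "W c x + \<tau> * H (S x) \<ge> 0" if "x \<in> T" for x
    proof -
      have "- \<tau> \<le> W c x / H (S x)" using x0(2)[OF that] by (simp add: \<tau>_def)
      then show ?thesis using H(1)[of "S x"] that by (auto simp: T_def pos_le_divide_eq)
    qed
    have "open {x. c - \<sigma> < S x \<and> S x < c}"
      unfolding S_def by (intro open_Collect_conj open_Collect_less continuous_intros)
    then have "\<forall>\<^sub>F x in nhds x0. x \<in> {x. c - \<sigma> < S x \<and> S x < c} \<inter> \<Omega>"
      by (intro eventually_nhds_in_open open_Int op) (use lt x0\<Omega> in auto)
    then have locmin: "\<forall>\<^sub>F x in nhds x0. W c x0 + \<tau> * H (S x0) \<le> W c x + \<tau> * H (S x)"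
    proof eventually_elim
      case (elim x)
      then have "x \<in> T" using closure_subset[of \<Omega>] by (auto simp: T_def)
      from ge[OF this] W0 show ?case by simp
    qed
    obtain F where F: "has_laplacian (W c) F
        (u x0 powr p - (c / S x0) powr (a + 2) * u (y + (c / S x0) *\<^sub>R (x0 - y)) powr p) x0"
      using lapW[OF x0\<Omega> lt(1) c(2)] by blast
    have "has_laplacian (\<lambda>x. H (x \<bullet> x)) (\<lambda>x. (2 * (- 2 * A * (x \<bullet> x - (c - \<sigma>)))) *\<^sub>R x)
       (4 * ((x0 + - y) \<bullet> (x0 + - y)) * (- 2 * A) + 2 * DIM('a) * (- 2 * A * ((x0 + - y) \<bullet> (x0 + - y) - (c - \<sigma>)))) (x0 + - y)"
      unfolding H_def
      by (rule has_laplacian_radial) (auto intro!: derivative_eq_intros always_eventually)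
    from has_laplacian_shift[OF this]
    obtain F2 where F2: "has_laplacian (\<lambda>x. H (S x)) F2
       (4 * S x0 * (- 2 * A) + 2 * DIM('a) * (- 2 * A * (S x0 - (c - \<sigma>)))) x0"
      by (auto simp: S_def)
    from has_laplacian_local_min(1)[OF has_laplacian_add[OF F has_laplacian_cmult[OF F2, of \<tau>]] locmin]
    have L0: "0 \<le> u x0 powr p - (c / S x0) powr (a + 2) * u (y + (c / S x0) *\<^sub>R (x0 - y)) powr p
       + \<tau> * (4 * S x0 * (- 2 * A) + 2 * DIM('a) * (- 2 * A * (S x0 - (c - \<sigma>))))" .
    have b1: "4 * S x0 * (- 2 * A) + 2 * DIM('a) * (- 2 * A * (S x0 - (c - \<sigma>))) \<le> - (\<Lambda> + 1)"
    proof -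
      have "8 * c0 * A \<le> 8 * S x0 * A" using far[OF x0c(1)] A by simp
      moreover have "0 \<le> real DIM('a) * (A * (S x0 - (c - \<sigma>)))" using lt A by simp
      moreover have "8 * c0 * A = \<Lambda> + 1" using c0 by (simp add: A_def)
      ultimately show ?thesis by (simp add: algebra_simps)
    qed
    define v where "v = (c / S x0) powr a * u (y + (c / S x0) *\<^sub>R (x0 - y))"
    have z0: "0 < u (y + (c / S x0) *\<^sub>R (x0 - y))" by (rule solD(7)[OF refl_in]) (use x0c lt c in auto)
    have q0: "c / S x0 > 0" using Spos[OF x0c(1)] lt by auto
    have v0: "v > 0" unfolding v_def using z0 q0 by (intro mult_pos_pos) auto
    have vu: "v = u x0 - \<tau> * H (S x0)" using W0 by (simp add: Wdef v_def)
    have "v powr p = (c / S x0) powr (a * p) * u (y + (c / S x0) *\<^sub>R (x0 - y)) powr p"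
      unfolding v_def using z0 q0 by (simp add: powr_mult powr_powr)
    also have "\<dots> \<le> (c / S x0) powr (a + 2) * u (y + (c / S x0) *\<^sub>R (x0 - y)) powr p"
      using q_gt[OF x0c(1) lt(1)] by (intro mult_right_mono) auto
    finally have b2: "u x0 powr p - (c / S x0) powr (a + 2) * u (y + (c / S x0) *\<^sub>R (x0 - y)) powr p
       \<le> u x0 powr p - v powr p" by simp
    also have "\<dots> \<le> p * u x0 powr (p - 1) * (u x0 - v)"
      by (rule powr_diff_le_tangent[OF v0 _ p(1)]) (use vu \<tau> Hx0 in simp)
    also have "\<dots> \<le> \<Lambda> * (\<tau> * H (S x0))"
    proof -
      have "u x0 powr (p - 1) \<le> m powr (p - 1)"
        using m(2)[OF x0c(1)] solD(7)[OF x0\<Omega>] p by (intro powr_mono2) auto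
      then show ?thesis unfolding \<Lambda>_def vu using p \<tau> Hx0 by (intro mult_mono) auto
    qed
    also have "\<dots> \<le> \<Lambda> * \<tau>" using \<Lambda> \<tau> Hx0 by simp
    finally have "0 \<le> \<Lambda> * \<tau> + \<tau> * (- (\<Lambda> + 1))"
      using L0 mult_left_mono[OF b1, of \<tau>] \<tau> by linarith
    then show False using \<tau> by (simp add: algebra_simps)
  qed
  have nobad: "W c x \<ge> 0" if "x \<in> closure \<Omega>" "S x \<le> c" "c \<le> c1" for c x
  proof (rule ccontr)
    assume neg: "\<not> W c x \<ge> 0"
    have c0c: "c0 \<le> c" using far[OF that(1)] that by simp
    \<comment> \<open>bad pairs \<open>(x, c)\<close>, with \<open>x\<close> kept away from the sphere; \<open>narrow\<close> loses no bad parameter\<close>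
    define B where "B = {k \<in> K. W (snd k) (fst k) \<le> 0} \<inter> {k. S (fst k) \<le> snd k - \<sigma>}"
    have inB: "\<exists>x. (x, c) \<in> B" if "\<exists>x \<in> closure \<Omega>. S x \<le> c \<and> W c x < 0" "c0 \<le> c" "c \<le> c1" for c
      using narrow[OF that] that \<sigma> by (force simp: B_def K_def)
    have ne: "B \<noteq> {}" using inB[of c] neg that c0c by force
    have "closed {k. S (fst k) \<le> snd k - \<sigma>}"
      unfolding S_def by (intro closed_Collect_le continuous_intros)
    moreover have "compact {k \<in> K. W (snd k) (fst k) \<le> 0}"
    proof -
      have "closed (K \<inter> (\<lambda>k. W (snd k) (fst k)) -` {..0})"
        by (rule continuous_closed_preimage[OF contW compact_imp_closed[OF cK]]) simp
      moreover have "{k \<in> K. W (snd k) (fst k) \<le> 0} = K \<inter> (K \<inter> (\<lambda>k. W (snd k) (fst k)) -` {..0})" by auto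
      ultimately show ?thesis using cK by (simp only: compact_Int_closed)
    qed
    ultimately have cB: "compact B" unfolding B_def by (intro compact_Int_closed)
    have "continuous_on B snd" by (intro continuous_intros)
    then obtain k where k: "k \<in> B" "\<And>k'. k' \<in> B \<Longrightarrow> snd k \<le> snd k'"
      using continuous_attains_inf[OF cB ne, of snd] by blast
    obtain x1 d where k_eq: "k = (x1, d)" by (cases k)
    have x1: "x1 \<in> closure \<Omega>" "c0 \<le> d" "d \<le> c1" "W d x1 \<le> 0" "S x1 \<le> d - \<sigma>"
      using k(1) by (auto simp: B_def K_def k_eq)
    have before: "W d' x \<ge> 0" if b: "x \<in> closure \<Omega>" "S x \<le> d'" "d' < d" for d' x
    proof (rule ccontr)
      assume "\<not> W d' x \<ge> 0"
      then obtain x' where "(x', d') \<in> B"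
        using inB[of d'] b far[OF b(1)] x1 by force
      from k(2)[OF this] b show False by (simp add: k_eq)
    qed
    have at_d: "W d x \<ge> 0" if "x \<in> closure \<Omega>" "S x < d" for x
    proof (rule tendsto_lowerbound[of "\<lambda>d'. W d' x" _ "at_left d"])
      have "continuous_on {S x..d} (\<lambda>d'. W (snd (x, d')) (fst (x, d')))"
        by (rule continuous_on_compose2[OF contW])
          (use that x1 far[OF that(1)] in \<open>auto simp: K_def intro!: continuous_intros\<close>)
      then have "((\<lambda>d'. W d' x) \<longlongrightarrow> W d x) (at d within {S x..d})"
        using that by (auto simp: continuous_on_def)
      then show "((\<lambda>d'. W d' x) \<longlongrightarrow> W d x) (at_left d)"
        using that by (simp add: at_within_Icc_at_left)
      show "\<forall>\<^sub>F d' in at_left d. 0 \<le> W d' x"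
        using eventually_at_left_real[OF that(2)] by eventually_elim (use before that in auto)
    qed simp
    have lt: "S x1 < d" using x1 \<sigma> by simp
    have x1\<Omega>: "x1 \<in> \<Omega>" using Wbd[of x1 d] x1 lt by force
    have zero: "W d x1 = 0" using at_d[OF x1(1) lt] x1 by simp
    have "open {x. S x < d}" unfolding S_def by (intro open_Collect_less continuous_intros)
    then have "\<forall>\<^sub>F x in nhds x1. x \<in> {x. S x < d} \<inter> \<Omega>"
      by (intro eventually_nhds_in_open open_Int op) (use lt x1\<Omega> in auto)
    then have locmin: "\<forall>\<^sub>F x in nhds x1. W d x1 \<le> W d x"
      by eventually_elim (use at_d zero closure_subset[of \<Omega>] in auto)
    obtain F where F: "has_laplacian (W d) F
        (u x1 powr p - (d / S x1) powr (a + 2) * u (y + (d / S x1) *\<^sub>R (x1 - y)) powr p) x1"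
      using lapW[OF x1\<Omega> lt x1(3)] by blast
    from has_laplacian_local_min(1)[OF F locmin]
    have L0: "(d / S x1) powr (a + 2) * u (y + (d / S x1) *\<^sub>R (x1 - y)) powr p \<le> u x1 powr p" by simp
    have z: "0 < u (y + (d / S x1) *\<^sub>R (x1 - y))" by (rule solD(7)[OF refl_in]) (use x1 lt in auto)
    have "u x1 = (d / S x1) powr a * u (y + (d / S x1) *\<^sub>R (x1 - y))" using zero by (simp add: Wdef)
    then have "u x1 powr p = (d / S x1) powr (a * p) * u (y + (d / S x1) *\<^sub>R (x1 - y)) powr p"
      using z by (simp add: powr_mult powr_powr)
    also have "\<dots> < (d / S x1) powr (a + 2) * u (y + (d / S x1) *\<^sub>R (x1 - y)) powr p"
      using q_gt[OF x1(1) lt] z by (intro mult_strict_right_mono) auto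
    finally show False using L0 by simp
  qed
  have xc: "x \<in> closure \<Omega>" using x closure_subset by auto
  have "S x \<le> t * S x" using Spos[OF xc] t by simp
  from nobad[OF xc this t(2)] show ?thesis using Spos[OF xc] by (simp add: Wdef)
qed

section \<open>The boundary of a smooth domain\<close>

lemma gradient_mvt:
  fixes f :: "'a::euclidean_space \<Rightarrow> real"
  assumes "\<And>z. z \<in> closed_segment x y \<Longrightarrow> (f has_derivative (\<lambda>h. G z \<bullet> h)) (at z)"
  obtains z where "z \<in> closed_segment x y" "f y - f x = G z \<bullet> (y - x)"
proof -
  have d: "((\<lambda>t. f (x + t *\<^sub>R (y - x))) has_derivative (\<lambda>h. h * (G (x + t *\<^sub>R (y - x)) \<bullet> (y - x)))) (at t within {0..1})"
    if "t \<in> {0..1}" for t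
  proof -
    have "((\<lambda>t. x + t *\<^sub>R (y - x)) has_derivative (\<lambda>h. h *\<^sub>R (y - x))) (at t within {0..1})"
      by (auto intro!: derivative_eq_intros)
    moreover have "x + t *\<^sub>R (y - x) \<in> closed_segment x y"
      using that by (auto simp: closed_segment_def algebra_simps intro!: exI[of _ t])
    ultimately show ?thesis
      using has_derivative_compose[OF _ assms] by fastforce
  qed
  obtain t where t: "t \<in> {0..1}" "f (x + 1 *\<^sub>R (y - x)) - f (x + 0 *\<^sub>R (y - x)) = (1 - 0) * (G (x + t *\<^sub>R (y - x)) \<bullet> (y - x))"
    using mvt_very_simple[of 0 1 "\<lambda>t. f (x + t *\<^sub>R (y - x))", OF _ d] by auto
  show thesis
  proof (rule that)
    show "x + t *\<^sub>R (y - x) \<in> closed_segment x y"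
      using t by (auto simp: closed_segment_def algebra_simps intro!: exI[of _ t])
  qed (use t in auto)
qed

lemma graph_chart_mono: "graph_chart k \<Omega> U e g \<Longrightarrow> j \<le> k \<Longrightarrow> graph_chart j \<Omega> U e g"
  using C_k_on_mono by (auto simp: graph_chart_def)

lemma C1_has_derivative:
  assumes "C_k_on 1 UNIV g"
  shows "(g has_derivative (\<lambda>h. gradient g x \<bullet> h)) (at x)"
  by (rule gradient_has_derivative) (use assms in \<open>auto simp: differentiable_on_def\<close>)

lemma C1_continuous_gradient:
  assumes "C_k_on 1 UNIV g"
  shows "continuous_on UNIV (gradient g)"
  using assms by (auto simp: gradient_def[abs_def] intro!: continuous_intros)

lemma C2_gradient_lipschitz_on_cball:
  fixes g :: "'a::euclidean_space \<Rightarrow> real"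
  assumes "C_k_on 2 UNIV g"
  obtains K where "K \<ge> 0" "\<And>x y. x \<in> cball a r \<Longrightarrow> y \<in> cball a r \<Longrightarrow> norm (gradient g x - gradient g y) \<le> K * norm (x - y)"
proof -
  have "\<exists>K\<ge>0. \<forall>x\<in>cball a r. \<forall>y\<in>cball a r. \<bar>partial_deriv i g x - partial_deriv i g y\<bar> \<le> K * norm (x - y)"
    if "i \<in> Basis" for i
  proof -
    have C: "C_k_on 1 UNIV (partial_deriv i g)" using assms that by (simp add: numeral_2_eq_2)
    have "bounded (gradient (partial_deriv i g) ` cball a r)"
      by (intro compact_imp_bounded compact_continuous_image continuous_on_subset[OF C1_continuous_gradient[OF C]]) auto
    then obtain K where K: "K > 0" "\<forall>z\<in>gradient (partial_deriv i g) ` cball a r. norm z \<le> K"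
      using bounded_pos by blast
    have "\<bar>partial_deriv i g x - partial_deriv i g y\<bar> \<le> K * norm (x - y)" if xy: "x \<in> cball a r" "y \<in> cball a r" for x y
    proof -
      obtain z where z: "z \<in> closed_segment y x" "partial_deriv i g x - partial_deriv i g y = gradient (partial_deriv i g) z \<bullet> (x - y)"
        using gradient_mvt[of y x "partial_deriv i g", OF C1_has_derivative[OF C]] by blast
      then have "z \<in> cball a r" using closed_segment_subset[OF xy(2,1)] by auto
      then have "norm (gradient (partial_deriv i g) z) * norm (x - y) \<le> K * norm (x - y)"
        using K by (intro mult_right_mono) auto
      then show ?thesis using z(2) Cauchy_Schwarz_ineq2[of "gradient (partial_deriv i g) z" "x - y"] by simp
    qed
    then show ?thesis using K by (intro exI[of _ K]) auto
  qed
  then obtain K where K: "\<And>i. i \<in> Basis \<Longrightarrow> K i \<ge> 0"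
    "\<And>i x y. i \<in> Basis \<Longrightarrow> x \<in> cball a r \<Longrightarrow> y \<in> cball a r \<Longrightarrow> \<bar>partial_deriv i g x - partial_deriv i g y\<bar> \<le> K i * norm (x - y)"
    by metis
  show thesis
  proof (rule that)
    show "0 \<le> sum K Basis" using K by (intro sum_nonneg) auto
    fix x y assume xy: "x \<in> cball a r" "y \<in> cball a r"
    have "gradient g x - gradient g y = (\<Sum>i\<in>Basis. (partial_deriv i g x - partial_deriv i g y) *\<^sub>R i)"
      by (simp add: gradient_def sum_subtractf scaleR_diff_left)
    also have "norm \<dots> \<le> (\<Sum>i\<in>Basis. K i * norm (x - y))"
      by (rule sum_norm_le) (use K xy in auto)
    finally show "norm (gradient g x - gradient g y) \<le> sum K Basis * norm (x - y)"
      by (simp add: sum_distrib_right)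
  qed
qed

locale C1_chart =
  fixes \<Omega> U :: "'a::euclidean_space set" and e :: 'a and g :: "'a \<Rightarrow> real"
  assumes chart: "graph_chart 1 \<Omega> U e g" and open_domain: "open \<Omega>"
begin

definition height :: "'a \<Rightarrow> real" where "height y = y \<bullet> e - g y"

definition height_grad :: "'a \<Rightarrow> 'a" where "height_grad y = e - gradient g y"

lemma chartD: "open U" "norm e = 1" "C_k_on 1 UNIV g" "g (y + t *\<^sub>R e) = g y"
  "y \<in> U \<Longrightarrow> y \<in> \<Omega> \<longleftrightarrow> height y < 0"
  using chart by (auto simp: graph_chart_def height_def)

lemma height_has_derivative: "(height has_derivative (\<lambda>h. height_grad x \<bullet> h)) (at x)"
  unfolding height_def height_grad_def
  by (rule has_derivative_eq_rhs, rule derivative_intros, rule derivative_intros, rule derivative_intros,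
      rule C1_has_derivative[OF chartD(3)]) (simp add: fun_eq_iff inner_diff_left inner_commute[of e])

lemma continuous_on_height_grad: "continuous_on A height_grad"
  unfolding height_grad_def
  by (intro continuous_intros continuous_on_subset[OF C1_continuous_gradient[OF chartD(3)]]) auto

lemma gradient_orthogonal: "gradient g x \<bullet> e = 0"
proof -
  have "((\<lambda>t. x + t *\<^sub>R e) has_derivative (\<lambda>h. h *\<^sub>R e)) (at 0)"
    by (auto intro!: derivative_eq_intros)
  moreover have "(g has_derivative (\<lambda>h. gradient g x \<bullet> h)) (at (x + 0 *\<^sub>R e))"
    using C1_has_derivative[OF chartD(3)] by simp
  ultimately have "((\<lambda>t. g (x + t *\<^sub>R e)) has_derivative (\<lambda>h. gradient g x \<bullet> (h *\<^sub>R e))) (at 0)"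
    by (rule has_derivative_compose)
  then have "((\<lambda>t::real. g x) has_derivative (\<lambda>h. gradient g x \<bullet> (h *\<^sub>R e))) (at 0)"
    by (simp add: chartD(4))
  from has_derivative_unique[OF this has_derivative_const] show ?thesis
    by (metis scaleR_one)
qed

lemma norm_height_grad: "norm (height_grad x) = sqrt (1 + (norm (gradient g x))\<^sup>2)"
proof -
  have "(norm (height_grad x))\<^sup>2 = 1 + (norm (gradient g x))\<^sup>2"
    using chartD(2) gradient_orthogonal[of x]
    by (simp add: height_grad_def dot_square_norm[symmetric] inner_diff_left inner_diff_right inner_commute)
      (simp add: dot_square_norm)
  then show ?thesis by (metis norm_ge_zero real_sqrt_unique)
qed

lemma norm_height_grad_ge_1: "norm (height_grad x) \<ge> 1"
  by (simp add: norm_height_grad)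

lemma continuous_on_height: "continuous_on A height"
  using height_has_derivative has_derivative_continuous by (blast intro: continuous_at_imp_continuous_on)

lemma height_closure: assumes "x \<in> closure \<Omega>" "x \<in> U" shows "height x \<le> 0"
proof (rule ccontr)
  assume "\<not> ?thesis"
  then have "x \<in> U \<inter> {y. 0 < height y}" using assms by auto
  moreover have "open (U \<inter> {y. 0 < height y})"
    by (intro open_Int chartD open_Collect_less continuous_on_const continuous_on_height)
  ultimately obtain y where "y \<in> \<Omega>" "y \<in> U \<inter> {y. 0 < height y}"
    using assms(1) by (metis disjoint_iff open_Int_closure_eq_empty)
  then show False using chartD(5) by force
qed

lemma height_frontier: assumes "x \<in> frontier \<Omega>" "x \<in> U" shows "height x = 0"
  using assms height_closure[of x] chartD(5)[of x] open_domain
  by (auto simp: frontier_def interior_open)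

definition chart_normal :: "'a \<Rightarrow> 'a" where
  "chart_normal x = height_grad x /\<^sub>R norm (height_grad x)"

lemma height_grad_nonzero: "height_grad x \<noteq> 0"
  using norm_height_grad_ge_1[of x] by auto

lemma norm_chart_normal: "norm (chart_normal x) = 1"
  using height_grad_nonzero[of x] by (simp add: chart_normal_def)

lemma chart_normal_eq: "chart_normal x = (e - gradient g x) /\<^sub>R sqrt (1 + (norm (gradient g x))\<^sup>2)"
  by (simp add: chart_normal_def norm_height_grad[symmetric]) (simp add: height_grad_def)

lemma height_grad_eq: "height_grad x = norm (height_grad x) *\<^sub>R chart_normal x"
  using height_grad_nonzero[of x] by (simp add: chart_normal_def)

lemma height_line: "((\<lambda>t. height (x + t *\<^sub>R h)) has_real_derivative height_grad x \<bullet> h) (at 0)"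
proof -
  have "((\<lambda>t. x + t *\<^sub>R h) has_derivative (\<lambda>t. t *\<^sub>R h)) (at 0)"
    by (auto intro!: derivative_eq_intros)
  moreover have "(height has_derivative (\<lambda>h. height_grad x \<bullet> h)) (at (x + 0 *\<^sub>R h))"
    using height_has_derivative by simp
  ultimately have "((\<lambda>t. height (x + t *\<^sub>R h)) has_derivative (\<lambda>t. height_grad x \<bullet> (t *\<^sub>R h))) (at 0)"
    by (rule has_derivative_compose)
  then show ?thesis unfolding has_field_derivative_def by (rule has_derivative_eq_rhs) (auto simp: fun_eq_iff)
qed

end

text \<open>Both vectors are normal to the same boundary piece and point out of \<open>\<Omega>\<close>. If they differed, their
difference would be a direction in which one height function decreases, so that one enters
\<open>\<Omega>\<close>, while the other one increases, so that one leaves it.\<close>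

lemma chart_normal_unique:
  assumes "C1_chart \<Omega> U e g" "C1_chart \<Omega> U' e' g'" and x: "x \<in> frontier \<Omega>" "x \<in> U" "x \<in> U'"
  shows "C1_chart.chart_normal e g x = C1_chart.chart_normal e' g' x"
proof (rule ccontr)
  interpret c: C1_chart \<Omega> U e g by fact
  interpret d: C1_chart \<Omega> U' e' g' by fact
  let ?n = "c.chart_normal x" and ?m = "d.chart_normal x"
  assume ne: "?n \<noteq> ?m"
  \<comment> \<open>the direction that separates the two half-spaces\<close>
  define h where "h = ?m - ?n"
  have "?n \<bullet> ?m < 1"
  proof -
    have "0 < (norm (?n - ?m))\<^sup>2" using ne by simp
    also have "\<dots> = 2 - 2 * (?n \<bullet> ?m)"
      using c.norm_chart_normal[of x] d.norm_chart_normal[of x]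
      by (simp add: dot_square_norm[symmetric] inner_diff_left inner_diff_right inner_commute)
        (simp add: dot_square_norm)
    finally show ?thesis by simp
  qed
  then have "?n \<bullet> h < 0" "?m \<bullet> h > 0"
    using c.norm_chart_normal[of x] d.norm_chart_normal[of x]
    by (simp_all add: h_def inner_diff_right dot_square_norm inner_commute)
  then have s: "c.height_grad x \<bullet> h < 0" "d.height_grad x \<bullet> h > 0"
    using c.height_grad_eq[of x] d.height_grad_eq[of x] c.norm_height_grad_ge_1[of x] d.norm_height_grad_ge_1[of x]
    by (smt (verit) inner_scaleR_left mult_pos_neg mult_pos_pos)+
  obtain e1 where e1: "e1 > 0" "\<And>t. 0 < t \<Longrightarrow> t < e1 \<Longrightarrow> c.height (x + t *\<^sub>R h) < 0"
    using DERIV_neg_dec_right[OF c.height_line[of x h] s(1)] c.height_frontier[OF x(1,2)] by auto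
  obtain e2 where e2: "e2 > 0" "\<And>t. 0 < t \<Longrightarrow> t < e2 \<Longrightarrow> d.height (x + t *\<^sub>R h) > 0"
    using DERIV_pos_inc_right[OF d.height_line[of x h] s(2)] d.height_frontier[OF x(1,3)] by auto
  have "((\<lambda>t. x + t *\<^sub>R h) \<longlongrightarrow> x) (at_right 0)"
    by (rule tendsto_eq_intros filterlim_ident refl | simp)+
  then have "\<forall>\<^sub>F t in at_right 0. x + t *\<^sub>R h \<in> U \<inter> U'"
    by (rule topological_tendstoD) (use x c.chartD(1) d.chartD(1) in auto)
  moreover have "\<forall>\<^sub>F t in at_right 0. t \<in> {0<..<min e1 e2}"
    using e1 e2 by (intro eventually_at_right_real) auto
  ultimately have "\<forall>\<^sub>F t in at_right (0::real). False"
  proof eventually_elim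
    case (elim t)
    then show False using e1(2)[of t] e2(2)[of t] c.chartD(5)[of "x + t *\<^sub>R h"] d.chartD(5)[of "x + t *\<^sub>R h"]
      by auto
  qed
  then show False by simp
qed

text \<open>Since all charts give the same vector, the definite description in the definition of the exterior
normal denotes.\<close>

lemma (in C1_chart) exterior_normal_eq:
  assumes "x \<in> frontier \<Omega>" "x \<in> U"
  shows "exterior_normal \<Omega> x = chart_normal x"
  unfolding exterior_normal_def
proof (rule the_equality)
  show "\<exists>U e g. graph_chart 1 \<Omega> U e g \<and> x \<in> U \<and> chart_normal x = (e - gradient g x) /\<^sub>R sqrt (1 + (norm (gradient g x))\<^sup>2)"
    using chart assms chart_normal_eq by blast
  fix n assume "\<exists>U e g. graph_chart 1 \<Omega> U e g \<and> x \<in> U \<and> n = (e - gradient g x) /\<^sub>R sqrt (1 + (norm (gradient g x))\<^sup>2)"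
  then obtain U' e' g' where c: "graph_chart 1 \<Omega> U' e' g'" "x \<in> U'"
    "n = (e' - gradient g' x) /\<^sub>R sqrt (1 + (norm (gradient g' x))\<^sup>2)" by blast
  then have d: "C1_chart \<Omega> U' e' g'" using open_domain by unfold_locales
  from chart_normal_unique[OF this C1_chart_axioms assms(1) c(2) assms(2)]
  show "n = chart_normal x" using c(3) C1_chart.chart_normal_eq[OF d] by simp
qed

text \<open>The interior and exterior ball conditions at \<open>x\<close>, with balls that touch the boundary at \<open>x\<close> only.\<close>

definition two_sided_ball :: "'a::euclidean_space set \<Rightarrow> real \<Rightarrow> 'a \<Rightarrow> bool" where
  "two_sided_ball \<Omega> R x \<longleftrightarrow> norm (exterior_normal \<Omega> x) = 1 \<and>
     cball (x + R *\<^sub>R exterior_normal \<Omega> x) R \<inter> closure \<Omega> \<subseteq> {x} \<and>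
     cball (x - R *\<^sub>R exterior_normal \<Omega> x) R - {x} \<subseteq> \<Omega>"

lemma two_sided_ball_inward:
  assumes "two_sided_ball \<Omega> R x" "0 < t" "t \<le> R"
  shows "x - t *\<^sub>R exterior_normal \<Omega> x \<in> \<Omega>"
proof -
  let ?n = "exterior_normal \<Omega> x"
  have n1: "norm ?n = 1" using assms(1) by (simp add: two_sided_ball_def)
  have "x - R *\<^sub>R ?n - (x - t *\<^sub>R ?n) = (t - R) *\<^sub>R ?n" by (simp add: algebra_simps)
  then have "x - t *\<^sub>R ?n \<in> cball (x - R *\<^sub>R ?n) R" using assms n1 by (simp add: dist_norm)
  moreover have "t *\<^sub>R ?n \<noteq> 0" using assms n1 by auto
  ultimately show ?thesis using assms(1) by (auto simp: two_sided_ball_def)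
qed

lemma two_sided_ball_outward:
  assumes "two_sided_ball \<Omega> R x" "0 \<le> R" "w \<in> closure \<Omega>"
  shows "R \<le> dist w (x + R *\<^sub>R exterior_normal \<Omega> x)"
proof (cases "w = x")
  case True
  then show ?thesis using assms by (simp add: two_sided_ball_def dist_norm)
next
  case False
  then have "w \<notin> cball (x + R *\<^sub>R exterior_normal \<Omega> x) R"
    using assms by (auto simp: two_sided_ball_def)
  then show ?thesis by (simp add: dist_commute)
qed

text \<open>Membership in a touching ball becomes an inequality between a quadratic and a linear term, which
can be compared with the second-order Taylor estimate of a chart.\<close>

lemma cball_normal_iff:
  assumes "norm n = 1"
  shows "y \<in> cball (x + R *\<^sub>R n) R \<longleftrightarrow> R \<ge> 0 \<and> (norm (y - x))\<^sup>2 \<le> 2 * R * (n \<bullet> (y - x))"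
proof -
  have "(dist (x + R *\<^sub>R n) y)\<^sup>2 = (norm (y - x))\<^sup>2 - 2 * R * (n \<bullet> (y - x)) + R\<^sup>2"
  proof -
    have "(dist (x + R *\<^sub>R n) y)\<^sup>2 = (norm ((y - x) - R *\<^sub>R n))\<^sup>2"
      by (simp add: dist_norm norm_minus_commute algebra_simps)
    also have "\<dots> = (norm (y - x))\<^sup>2 - 2 * R * (n \<bullet> (y - x)) + R\<^sup>2"
      using assms unfolding dot_square_norm[symmetric]
      by (simp add: inner_diff_left inner_diff_right inner_commute algebra_simps power2_eq_square)
        (simp add: dot_square_norm)
    finally show ?thesis .
  qed
  moreover have "y \<in> cball (x + R *\<^sub>R n) R \<longleftrightarrow> R \<ge> 0 \<and> (dist (x + R *\<^sub>R n) y)\<^sup>2 \<le> R\<^sup>2"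
    using abs_le_square_iff[of "dist (x + R *\<^sub>R n) y" R] zero_le_dist[of "x + R *\<^sub>R n" y]
    by (cases "R \<ge> 0") (simp_all add: not_le del: zero_le_dist)
  ultimately show ?thesis by auto
qed

lemma two_sided_ball_mono:
  assumes "two_sided_ball \<Omega> R x" "0 < R'" "R' \<le> R"
  shows "two_sided_ball \<Omega> R' x"
proof -
  have "cball (x + R' *\<^sub>R n) R' \<subseteq> cball (x + R *\<^sub>R n) R" if "norm n = 1" for n :: 'a
  proof
    fix y assume "y \<in> cball (x + R' *\<^sub>R n) R'"
    then have 1: "(norm (y - x))\<^sup>2 \<le> 2 * R' * (n \<bullet> (y - x))" by (simp only: cball_normal_iff[OF that])
    then have "0 \<le> 2 * R' * (n \<bullet> (y - x))" by (rule order_trans[rotated]) simp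
    then have "0 \<le> n \<bullet> (y - x)" using assms by (simp add: zero_le_mult_iff)
    then have "2 * R' * (n \<bullet> (y - x)) \<le> 2 * R * (n \<bullet> (y - x))" using assms by (intro mult_right_mono) auto
    then show "y \<in> cball (x + R *\<^sub>R n) R" using 1 assms by (simp only: cball_normal_iff[OF that]) simp
  qed
  from this[of "exterior_normal \<Omega> x"] this[of "- exterior_normal \<Omega> x"] assms(1)
  show ?thesis unfolding two_sided_ball_def by auto
qed

text \<open>The gradient of the chart is Lipschitz, so the height function differs from its linear part by at
most \<open>K |y - x|\<^sup>2\<close>. In a ball of radius \<open>R < 1/(2K)\<close> that touches the tangent plane the linear part
wins, as the gradient of the height function has norm at least 1.\<close>

lemma local_two_sided_ball:
  assumes ch: "graph_chart 2 \<Omega> U e g" and op: "open \<Omega>" and x0: "x0 \<in> U"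
  obtains V R where "open V" "x0 \<in> V" "R > 0" "\<And>x. x \<in> V \<inter> frontier \<Omega> \<Longrightarrow> two_sided_ball \<Omega> R x"
proof -
  interpret C1_chart \<Omega> U e g
    using graph_chart_mono[OF ch, of 1] op by unfold_locales auto
  obtain \<tau> where \<tau>: "\<tau> > 0" "cball x0 (2 * \<tau>) \<subseteq> U"
  proof -
    obtain r where "r > 0" "cball x0 r \<subseteq> U" using chartD(1) x0 open_contains_cball by blast
    then show thesis by (intro that[of "r / 2"]) auto
  qed
  have "C_k_on 2 UNIV g" using ch unfolding graph_chart_def by blast
  from C2_gradient_lipschitz_on_cball[OF this, of x0 "2 * \<tau>"]
  obtain K where K: "K \<ge> 0" "\<And>x y. x \<in> cball x0 (2 * \<tau>) \<Longrightarrow> y \<in> cball x0 (2 * \<tau>) \<Longrightarrow>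
     norm (gradient g x - gradient g y) \<le> K * norm (x - y)" by blast
  have taylor: "\<bar>height y - height x - height_grad x \<bullet> (y - x)\<bar> \<le> K * (norm (y - x))\<^sup>2"
    if xy: "x \<in> cball x0 (2 * \<tau>)" "y \<in> cball x0 (2 * \<tau>)" for x y
  proof -
    obtain z where z: "z \<in> closed_segment x y" "height y - height x = height_grad z \<bullet> (y - x)"
      using gradient_mvt[OF height_has_derivative] by blast
    have zc: "z \<in> cball x0 (2 * \<tau>)" using closed_segment_subset[OF xy] z(1) by auto
    have "norm (height_grad z - height_grad x) \<le> K * norm (z - x)"
      using K(2)[OF xy(1) zc] by (simp add: height_grad_def norm_minus_commute)
    also have "\<dots> \<le> K * norm (y - x)"
      using segment_bound(1)[OF z(1)] K(1) by (intro mult_left_mono) auto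
    finally have "norm (height_grad z - height_grad x) * norm (y - x) \<le> K * norm (y - x) * norm (y - x)"
      by (intro mult_right_mono) auto
    moreover have "height y - height x - height_grad x \<bullet> (y - x) = (height_grad z - height_grad x) \<bullet> (y - x)"
      using z by (simp add: inner_diff_left)
    ultimately show ?thesis
      using Cauchy_Schwarz_ineq2[of "height_grad z - height_grad x" "y - x"] by (simp add: power2_eq_square)
  qed
  define R where "R = min (\<tau> / 2) (1 / (2 * (K + 1)))"
  have R: "R > 0" "R \<le> \<tau> / 2" "K < 1 / (2 * R)"
  proof -
    show R: "R > 0" "R \<le> \<tau> / 2" using \<tau> K by (auto simp: R_def)
    have "R * (2 * (K + 1)) \<le> 1 / (2 * (K + 1)) * (2 * (K + 1))"
      using K by (intro mult_right_mono) (auto simp: R_def)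
    also have "\<dots> = 1" using K by simp
    finally have "K * (2 * R) < 1" using R by (simp add: algebra_simps)
    then show "K < 1 / (2 * R)" using R by (simp add: pos_less_divide_eq)
  qed
  show thesis
  proof (rule that[of "ball x0 \<tau>" R])
    fix x assume x: "x \<in> ball x0 \<tau> \<inter> frontier \<Omega>"
    then have xU: "x \<in> U" "x \<in> cball x0 (2 * \<tau>)" using \<tau> by auto
    have n: "exterior_normal \<Omega> x = chart_normal x" using exterior_normal_eq x xU by auto
    have key: "height_grad x \<bullet> (s *\<^sub>R (y - x)) > K * (norm (y - x))\<^sup>2 \<and> y \<in> cball x0 (2 * \<tau>)"
      if y: "y \<in> cball (x + R *\<^sub>R (s *\<^sub>R chart_normal x)) R" "y \<noteq> x" and s: "\<bar>s\<bar> = 1" for y s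
    proof
      have n1: "norm (s *\<^sub>R chart_normal x) = 1" using norm_chart_normal s by simp
      from y(1) have le: "(norm (y - x))\<^sup>2 \<le> 2 * R * (s *\<^sub>R chart_normal x \<bullet> (y - x))"
        by (simp only: cball_normal_iff[OF n1])
      have pos: "0 < (norm (y - x))\<^sup>2" using y by simp
      have "K * (norm (y - x))\<^sup>2 < 1 / (2 * R) * (norm (y - x))\<^sup>2"
        using R pos by (intro mult_strict_right_mono) auto
      also have le2: "\<dots> \<le> s *\<^sub>R chart_normal x \<bullet> (y - x)"
        using le R by (simp add: pos_divide_le_eq mult.commute)
      also have "\<dots> \<le> norm (height_grad x) * (s *\<^sub>R chart_normal x \<bullet> (y - x))"
      proof -
        have "0 \<le> s *\<^sub>R chart_normal x \<bullet> (y - x)"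
          using le2 by (rule order_trans[rotated]) (use R in auto)
        then show ?thesis using norm_height_grad_ge_1[of x] by (simp add: mult_le_cancel_right1)
      qed
      also have "\<dots> = height_grad x \<bullet> (s *\<^sub>R (y - x))"
        by (subst (2) height_grad_eq) simp
      finally show "height_grad x \<bullet> (s *\<^sub>R (y - x)) > K * (norm (y - x))\<^sup>2" .
      have "dist x0 y \<le> dist x0 x + dist x (x + R *\<^sub>R (s *\<^sub>R chart_normal x)) + dist (x + R *\<^sub>R (s *\<^sub>R chart_normal x)) y"
        using dist_triangle[of x0 y x] dist_triangle[of x y "x + R *\<^sub>R (s *\<^sub>R chart_normal x)"] by linarith
      also have "dist x (x + R *\<^sub>R (s *\<^sub>R chart_normal x)) = R"
        using n1 R by (simp add: dist_norm norm_chart_normal s abs_mult)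
      finally show "y \<in> cball x0 (2 * \<tau>)" using x y R by (auto simp: dist_commute)
    qed
    have h0: "height x = 0" using height_frontier x xU by auto
    show "two_sided_ball \<Omega> R x"
      unfolding two_sided_ball_def n
    proof (intro conjI subsetI)
      show "norm (chart_normal x) = 1" by (rule norm_chart_normal)
      fix y assume y: "y \<in> cball (x + R *\<^sub>R chart_normal x) R \<inter> closure \<Omega>"
      show "y \<in> {x}"
      proof (rule ccontr)
        assume "y \<notin> {x}"
        then have k: "height_grad x \<bullet> (y - x) > K * (norm (y - x))\<^sup>2" "y \<in> cball x0 (2 * \<tau>)"
          using key[of y 1] y by auto
        then have "height y \<le> 0" using height_closure[of y] y \<tau> by auto
        then show False using taylor[OF xU(2) k(2)] k h0 by auto
      qed
    next
      fix y assume y: "y \<in> cball (x - R *\<^sub>R chart_normal x) R - {x}"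
      then have k: "height_grad x \<bullet> (- (y - x)) > K * (norm (y - x))\<^sup>2" "y \<in> cball x0 (2 * \<tau>)"
        using key[of y "-1"] by auto
      have "height_grad x \<bullet> (y - x) < - (K * (norm (y - x))\<^sup>2)" using k(1) unfolding inner_minus_right by linarith
      then have "height y < 0" using taylor[OF xU(2) k(2)] h0 by auto
      then show "y \<in> \<Omega>" using chartD(5)[of y] k(2) \<tau> by auto
    qed
  qed (use \<tau> R in auto)
qed

lemma frontier_point_before_exit:
  assumes "x \<in> \<Omega>" "w \<notin> \<Omega>"
  obtains x0 where "x0 \<in> frontier \<Omega>" "dist x x0 \<le> dist x (w :: 'a::euclidean_space)"
proof -
  have "closed_segment x w \<inter> frontier \<Omega> \<noteq> {}"
    by (rule connected_Int_frontier) (use assms in auto)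
  then obtain x0 where x0: "x0 \<in> closed_segment x w" "x0 \<in> frontier \<Omega>" by blast
  have "dist x x0 \<le> dist x w" using segment_bound(1)[OF x0(1)] by (simp add: dist_norm norm_minus_commute)
  then show thesis using x0(2) by (rule that[rotated])
qed

text \<open>The closed set of points at distance at least \<open>\<eta>\<close> from the boundary. The bounds of
\<open>boundary_bound\<close> apply to the rest of \<open>\<Omega>\<close>.\<close>

definition inner_part :: "'a::euclidean_space set \<Rightarrow> real \<Rightarrow> 'a set" where
  "inner_part \<Omega> \<eta> = {x \<in> closure \<Omega>. \<forall>x0\<in>frontier \<Omega>. \<eta> \<le> dist x x0}"

lemma compact_inner_part:
  assumes "bounded \<Omega>"
  shows "compact (inner_part \<Omega> \<eta>)"
proof -
  have "inner_part \<Omega> \<eta> = closure \<Omega> \<inter> (\<Inter>x0\<in>frontier \<Omega>. {x. \<eta> \<le> dist x x0})"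
    by (auto simp: inner_part_def)
  also have "compact \<dots>" using assms
    by (intro compact_Int_closed closed_INT ballI closed_Collect_le continuous_intros) auto
  finally show ?thesis .
qed

lemma inner_part_subset:
  assumes "open \<Omega>" "\<eta> > 0"
  shows "inner_part \<Omega> \<eta> \<subseteq> \<Omega>"
  using assms by (force simp: inner_part_def frontier_def interior_open)

text \<open>The radius of touching balls and the width of a boundary strip are both parameters that may be
decreased, so a finite subcover needs only the smallest of finitely many values.\<close>

lemma compact_local_to_uniform:
  fixes K :: "'a::topological_space set" and P :: "'a \<Rightarrow> real \<Rightarrow> bool"
  assumes K: "compact K"
    and loc: "\<And>x. x \<in> K \<Longrightarrow> \<exists>V. open V \<and> x \<in> V \<and> (\<exists>R>0. \<forall>z\<in>V \<inter> K. P z R)"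
    and mono: "\<And>z R R'. P z R \<Longrightarrow> 0 < R' \<Longrightarrow> R' \<le> R \<Longrightarrow> P z R'"
  obtains R where "R > 0" "\<And>z. z \<in> K \<Longrightarrow> P z R"
proof -
  define \<V> where "\<V> = {V. open V \<and> (\<exists>R>0. \<forall>z\<in>V \<inter> K. P z R)}"
  have "K \<subseteq> \<Union>\<V>" using loc unfolding \<V>_def by blast
  then obtain \<D> where D: "\<D> \<subseteq> \<V>" "finite \<D>" "K \<subseteq> \<Union>\<D>"
    using compactE[OF K, of \<V>] unfolding \<V>_def by blast
  have "\<exists>R>0. \<forall>V\<in>\<D>. \<forall>z\<in>V \<inter> K. P z R"
    using D(2,1)
  proof (induction rule: finite_induct)
    case empty
    show ?case by (intro exI[of _ 1]) auto
  next
    case (insert V F)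
    then obtain R where R: "R > 0" "\<forall>V\<in>F. \<forall>z\<in>V \<inter> K. P z R" by blast
    from insert.prems obtain R' where R': "R' > 0" "\<forall>z\<in>V \<inter> K. P z R'" unfolding \<V>_def by blast
    have "P z (min R R')" if "W \<in> insert V F" "z \<in> W \<inter> K" for W z
    proof (cases "W = V")
      case True
      then have "P z R'" using R' that by blast
      then show ?thesis by (rule mono) (use R R' in auto)
    next
      case False
      then have "P z R" using R that by blast
      then show ?thesis by (rule mono) (use R R' in auto)
    qed
    then show ?case using R(1) R'(1) by (intro exI[of _ "min R R'"]) simp
  qed
  then obtain R where "R > 0" "\<forall>V\<in>\<D>. \<forall>z\<in>V \<inter> K. P z R" by blast
  then show thesis using D(3) by (intro that[of R]) blast+
qed

lemma uniform_two_sided_ball: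
  assumes "bounded_domain_of_class k \<Omega>" "2 \<le> k"
  obtains R where "R > 0" "\<And>x. x \<in> frontier \<Omega> \<Longrightarrow> two_sided_ball \<Omega> R x"
proof (rule compact_local_to_uniform[of "frontier \<Omega>" "\<lambda>x R. two_sided_ball \<Omega> R x"])
  have op: "open \<Omega>" and bd: "bounded \<Omega>" using assms(1) by (simp_all add: bounded_domain_of_class_def)
  show "compact (frontier \<Omega>)" using bd by (rule compact_frontier_bounded)
  fix x0 assume x0: "x0 \<in> frontier \<Omega>"
  then have "\<exists>U e g. x0 \<in> U \<and> graph_chart k \<Omega> U e g"
    using assms(1) by (simp add: bounded_domain_of_class_def)
  then obtain U e g where c: "x0 \<in> U" "graph_chart k \<Omega> U e g" by (elim exE conjE)
  show "\<exists>V. open V \<and> x0 \<in> V \<and> (\<exists>R>0. \<forall>z\<in>V \<inter> frontier \<Omega>. two_sided_ball \<Omega> R z)"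
    by (rule local_two_sided_ball[OF graph_chart_mono[OF c(2) assms(2)] op c(1)]) blast
qed (use two_sided_ball_mono that in blast)+

section \<open>Positive solutions are bounded near the boundary\<close>

text \<open>Close to \<open>x0\<close> the height function decreases in all directions close to the inner normal. A point
of the closure of \<open>\<Omega>\<close> at distance less than \<open>R + \<epsilon>\<close> from a centre \<open>y\<close> near \<open>y0\<close> must be
close to \<open>x0\<close>, since \<open>\<Omega>\<close> stays away from the closed ball about \<open>y0\<close> elsewhere; and the ray
from \<open>y\<close> through it has such a direction. The range of \<open>t\<close> is what the reflections in
spheres of radius between \<open>R - \<epsilon>\<close> and \<open>R + \<epsilon>\<close> can reach.\<close>

lemma rays_enter_domain:
  fixes \<Omega> :: "'a::euclidean_space set"
  assumes chart: "graph_chart 1 \<Omega> U e g" and op: "open \<Omega>" and bd: "bounded \<Omega>"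
    and x0: "x0 \<in> frontier \<Omega>" "x0 \<in> U" and R: "R > 0" and ball: "two_sided_ball \<Omega> R x0"
  defines "y0 \<equiv> x0 + R *\<^sub>R exterior_normal \<Omega> x0"
  obtains \<epsilon> where "\<epsilon> > 0" "\<epsilon> \<le> R / 2"
    "\<And>x y t. x \<in> closure \<Omega> \<Longrightarrow> dist y y0 < \<epsilon> \<Longrightarrow> dist x y < R + \<epsilon> \<Longrightarrow> 1 < t \<Longrightarrow> t \<le> ((R + \<epsilon>) / (R - \<epsilon>))\<^sup>2
      \<Longrightarrow> y + t *\<^sub>R (x - y) \<in> \<Omega>"
proof -
  interpret C1_chart \<Omega> U e g using assms by unfold_locales
  define S where "S = {w. height_grad (fst w) \<bullet> snd w < 0}"
  have "continuous_on UNIV (\<lambda>w. height_grad (fst w) \<bullet> (snd w :: 'a))"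
    by (intro continuous_intros continuous_on_compose2[OF continuous_on_height_grad[of UNIV], of _ fst]) auto
  then have "open S" unfolding S_def by (intro open_Collect_less) auto
  have n: "exterior_normal \<Omega> x0 = chart_normal x0" using exterior_normal_eq x0 by simp
  have d0: "dist x0 y0 = R" using R norm_chart_normal[of x0] by (simp add: y0_def n dist_norm)
  have "height_grad x0 \<bullet> (x0 - y0) = - R * norm (height_grad x0)"
    unfolding y0_def n by (subst height_grad_eq) (simp add: dot_square_norm norm_chart_normal)
  then have "(x0, x0 - y0) \<in> S" using R height_grad_nonzero[of x0] by (simp add: S_def)
  with \<open>open S\<close> obtain A B where AB: "open A" "open B" "x0 \<in> A" "x0 - y0 \<in> B" "A \<times> B \<subseteq> S"
    by (metis open_prod_elim mem_Times_iff fst_conv snd_conv)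
  have "open (A \<inter> U)" "x0 \<in> A \<inter> U" using AB chartD(1) x0 by auto
  then obtain r1 where r1: "r1 > 0" "ball x0 r1 \<subseteq> A \<inter> U" by (metis open_contains_ball)
  obtain r2 where r2: "r2 > 0" "ball (x0 - y0) r2 \<subseteq> B" using AB(2,4) by (metis open_contains_ball)
  define r where "r = min r1 r2"
  have r: "r > 0" "ball x0 r \<subseteq> A" "ball x0 r \<subseteq> U" "ball (x0 - y0) r \<subseteq> B"
    using r1 r2 by (auto simp: r_def)
  \<comment> \<open>away from \<open>x0\<close> the closed domain has positive distance from the closed exterior ball\<close>
  define C where "C = closure \<Omega> - ball x0 (r / 2)"
  have "\<exists>\<mu>>0. \<forall>x\<in>C. R + \<mu> \<le> dist x y0"
  proof (cases "C = {}")
    case True then show ?thesis by (intro exI[of _ 1]) auto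
  next
    case False
    have "compact C" unfolding C_def using bd by (intro compact_diff) auto
    moreover have "continuous_on C (\<lambda>x. dist x y0)" by (intro continuous_intros)
    ultimately obtain x where x: "x \<in> C" "\<And>x'. x' \<in> C \<Longrightarrow> dist x y0 \<le> dist x' y0"
      using continuous_attains_inf[OF _ False] by blast
    have "x \<noteq> x0" "x \<in> closure \<Omega>" using x(1) r by (auto simp: C_def)
    then have "x \<notin> cball y0 R" using ball by (auto simp: two_sided_ball_def y0_def)
    then show ?thesis using x(2) by (intro exI[of _ "dist x y0 - R"]) (auto simp: dist_commute)
  qed
  then obtain \<mu> where \<mu>: "\<mu> > 0" "\<And>x. x \<in> C \<Longrightarrow> R + \<mu> \<le> dist x y0" by auto
  define \<epsilon> where "\<epsilon> = min (\<mu> / 2) (min (r / 50) (R / 2))"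
  have \<epsilon>: "\<epsilon> > 0" "2 * \<epsilon> \<le> \<mu>" "50 * \<epsilon> \<le> r" "2 * \<epsilon> \<le> R" using \<mu> r R by (auto simp: \<epsilon>_def)
  show thesis
  proof (rule that[of \<epsilon>])
    fix x y t assume x: "x \<in> closure \<Omega>" and y: "dist y y0 < \<epsilon>" and xy: "dist x y < R + \<epsilon>"
      and t: "1 < t" "t \<le> ((R + \<epsilon>) / (R - \<epsilon>))\<^sup>2"
    have "dist x y0 < R + \<mu>" using dist_triangle[of x y0 y] y xy \<epsilon> by linarith
    then have xr: "dist x0 x < r / 2" using \<mu>(2)[of x] x by (force simp: C_def)
    have t1: "t - 1 \<le> 16 * \<epsilon> / R"
    proof -
      have "((R + \<epsilon>) / (R - \<epsilon>))\<^sup>2 - 1 = (4 * R * \<epsilon>) / (R - \<epsilon>)\<^sup>2"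
        using \<epsilon> R by (simp add: power_divide divide_simps) (simp add: power2_eq_square algebra_simps)
      also have "\<dots> \<le> (4 * R * \<epsilon>) / (R / 2)\<^sup>2"
        using \<epsilon> R by (intro divide_left_mono power_mono mult_pos_pos zero_less_power) auto
      also have "\<dots> = 16 * \<epsilon> / R" using R by (simp add: power2_eq_square field_simps)
      finally show ?thesis using t by simp
    qed
    have len: "(t - 1) * dist x y < r / 2"
    proof -
      have "(t - 1) * dist x y \<le> (16 * \<epsilon> / R) * (3 / 2 * R)"
        using t t1 xy \<epsilon> R by (intro mult_mono) auto
      also have "\<dots> = 24 * \<epsilon>" using R by simp
      finally show ?thesis using \<epsilon> r by linarith
    qed
    define w where "w = y + t *\<^sub>R (x - y)"
    have wx: "w - x = (t - 1) *\<^sub>R (x - y)" by (simp add: w_def algebra_simps)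
    obtain z where z: "z \<in> closed_segment x w" "height w - height x = height_grad z \<bullet> (w - x)"
      using gradient_mvt[OF height_has_derivative] by blast
    have nwx: "norm (w - x) = (t - 1) * dist x y" using t by (simp add: wx dist_norm)
    have "dist x z \<le> norm (w - x)" using segment_bound(1)[OF z(1)] by (simp add: dist_norm norm_minus_commute)
    then have zr: "z \<in> ball x0 r" using dist_triangle[of x0 z x] xr len nwx by simp
    have wr: "w \<in> ball x0 r" using dist_triangle[of x0 w x] xr len nwx by (simp add: dist_norm norm_minus_commute)
    have "dist (x0 - y0) (x - y) \<le> dist x0 x + dist y0 y"
      using norm_triangle_ineq4[of "x0 - x" "y0 - y"] by (simp add: dist_norm algebra_simps)
    then have "x - y \<in> ball (x0 - y0) r" using xr y \<epsilon> r by (simp add: dist_commute)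
    then have "(z, x - y) \<in> S" using zr r AB(5) by blast
    then have "height_grad z \<bullet> (x - y) < 0" by (simp add: S_def)
    then have "height w - height x < 0" unfolding z(2) wx using t by (simp add: mult_pos_neg)
    moreover have "height x \<le> 0" by (rule height_closure[OF x]) (use xr r in auto)
    ultimately have "height w < 0" by simp
    then show "y + t *\<^sub>R (x - y) \<in> \<Omega>" using chartD(5)[of w] wr r(3) by (auto simp: w_def)
  qed (use \<epsilon> in auto)
qed

text \<open>On the ball, \<open>u\<close> satisfies \<open>- \<Delta>u \<ge> m\<^bsup>p-1\<^esup> u\<close>, so \<open>m\<^bsup>p-1\<^esup>\<close> is at most the first
Dirichlet eigenvalue. Instead of the eigenfunction the explicit function
\<open>\<phi> = (\<rho>\<^sup>2 - |x - z0|\<^sup>2)\<^sup>2\<close> is used; it satisfies \<open>- \<Delta>\<phi> \<le> (N + 2)\<^sup>2 / (2 \<rho>\<^sup>2) \<phi>\<close>, and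
the two inequalities are compared at the maximum of \<open>\<phi>/u\<close>.\<close>

lemma positive_solution_minimum_bound:
  fixes \<Omega> :: "'a::euclidean_space set"
  assumes sol: "positive_solution \<Omega> p \<gamma> u" and op: "open \<Omega>" and cb: "cball z0 \<rho> \<subseteq> \<Omega>"
    and \<rho>: "\<rho> > 0" and p: "1 < p" and m: "0 \<le> m" "\<And>z. z \<in> cball z0 \<rho> \<Longrightarrow> m \<le> u z"
  shows "m powr (p - 1) \<le> (real DIM('a) + 2)\<^sup>2 / (2 * \<rho>\<^sup>2)"
proof -
  note solD = positive_solutionD[OF sol]
  define N where "N = real DIM('a)"
  define \<phi> where "\<phi> x = (\<rho>\<^sup>2 - (x + - z0) \<bullet> (x + - z0))\<^sup>2" for x
  have upos: "u x > 0" if "x \<in> cball z0 \<rho>" for x using that cb solD(7) by auto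
  have "continuous_on (cball z0 \<rho>) u"
    by (rule continuous_on_subset[OF solD(2)]) (use cb closure_subset in blast)
  then have "continuous_on (cball z0 \<rho>) (\<lambda>x. \<phi> x / u x)"
    unfolding \<phi>_def using upos by (intro continuous_intros) force+
  from continuous_attains_sup[OF compact_cball _ this] \<rho>
  obtain x1 where x1: "x1 \<in> cball z0 \<rho>" "\<And>x. x \<in> cball z0 \<rho> \<Longrightarrow> \<phi> x / u x \<le> \<phi> x1 / u x1" by auto
  define T where "T = \<phi> x1 / u x1"
  have "0 < \<phi> z0 / u z0" using \<rho> upos[of z0] by (simp add: \<phi>_def)
  also have "\<dots> \<le> T" unfolding T_def by (rule x1(2)) (use \<rho> in auto)
  finally have T: "T > 0" .
  have eq1: "\<phi> x1 = T * u x1" using upos[OF x1(1)] by (simp add: T_def)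
  have ge: "\<phi> x \<le> T * u x" if "x \<in> cball z0 \<rho>" for x
    using x1(2)[OF that] upos[OF that] by (simp add: T_def[symmetric] pos_divide_le_eq)
  define s where "s = \<rho>\<^sup>2 - (x1 + - z0) \<bullet> (x1 + - z0)"
  have \<phi>s: "\<phi> x1 = s\<^sup>2" by (simp add: \<phi>_def s_def)
  have "dist z0 x1 \<noteq> \<rho>"
  proof
    assume "dist z0 x1 = \<rho>"
    then have "s = 0" by (simp add: s_def dot_square_norm dist_norm norm_minus_commute)
    then show False using eq1 T upos[OF x1(1)] \<phi>s by simp
  qed
  with x1(1) have x1b: "x1 \<in> ball z0 \<rho>" by simp
  then have x1\<Omega>: "x1 \<in> \<Omega>" using cb by auto
  have H: "has_laplacian (\<lambda>x. (\<rho>\<^sup>2 - x \<bullet> x)\<^sup>2) (\<lambda>x. (2 * (- 2 * (\<rho>\<^sup>2 - x \<bullet> x))) *\<^sub>R x)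
     (4 * ((x1 + - z0) \<bullet> (x1 + - z0)) * 2 + 2 * DIM('a) * (- 2 * s)) (x1 + - z0)"
    unfolding s_def by (rule has_laplacian_radial) (auto intro!: derivative_eq_intros always_eventually)
  obtain F where F: "has_laplacian \<phi> F (8 * (\<rho>\<^sup>2 - s) - 4 * N * s) x1"
    using has_laplacian_shift[OF H] by (auto simp: \<phi>_def[abs_def] s_def N_def algebra_simps)
  have "\<forall>\<^sub>F x in nhds x1. x \<in> ball z0 \<rho>"
    using x1b by (intro eventually_nhds_in_open) auto
  then have "\<forall>\<^sub>F x in nhds x1. T * u x1 - \<phi> x1 \<le> T * u x - \<phi> x"
    by eventually_elim (use ge eq1 in auto)
  from has_laplacian_local_min(1)[OF has_laplacian_diff[OF has_laplacian_cmult[OF positive_solution_has_laplacian[OF sol op x1\<Omega>], of T] F] this]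
  have "T * u x1 powr p \<le> (4 * N + 8) * s - 8 * \<rho>\<^sup>2" by (simp add: algebra_simps)
  also have "\<dots> \<le> (N + 2)\<^sup>2 / (2 * \<rho>\<^sup>2) * s\<^sup>2"
  proof -
    have "0 \<le> ((N + 2) * s - 4 * \<rho>\<^sup>2)\<^sup>2 / (2 * \<rho>\<^sup>2)" by simp
    also have "\<dots> = (N + 2)\<^sup>2 / (2 * \<rho>\<^sup>2) * s\<^sup>2 - ((4 * N + 8) * s - 8 * \<rho>\<^sup>2)"
      using \<rho> by (simp add: divide_simps) (simp add: power2_eq_square algebra_simps)
    finally show ?thesis by simp
  qed
  also have "\<dots> = T * ((N + 2)\<^sup>2 / (2 * \<rho>\<^sup>2) * u x1)" using eq1 \<phi>s by simp
  finally have "u x1 powr p \<le> (N + 2)\<^sup>2 / (2 * \<rho>\<^sup>2) * u x1" by (simp only: mult_le_cancel_left_pos[OF T])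
  moreover have "u x1 powr p = u x1 powr (p - 1) * u x1"
    using upos[OF x1(1)] by (simp add: powr_diff)
  ultimately have "u x1 powr (p - 1) * u x1 \<le> (N + 2)\<^sup>2 / (2 * \<rho>\<^sup>2) * u x1" by (simp only:)
  then have "u x1 powr (p - 1) \<le> (N + 2)\<^sup>2 / (2 * \<rho>\<^sup>2)"
    by (simp only: mult_le_cancel_right_pos[OF upos[OF x1(1)]])
  moreover have "m powr (p - 1) \<le> u x1 powr (p - 1)" using m x1(1) p by (intro powr_mono2) auto
  ultimately show ?thesis by (simp add: N_def)
qed

text \<open>The centre of the spheres varies in a ball about \<open>y0\<close> while the factor \<open>t\<close> is fixed. For given
\<open>x\<close>, the map \<open>y \<mapsto> y + t (x - y)\<close> sends this ball onto a ball in \<open>\<Omega>\<close> whose radius does not depend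
on \<open>x\<close> and \<open>u\<close>.\<close>

lemma local_boundary_bound:
  fixes \<Omega> :: "'a::euclidean_space set" and p :: real
  assumes chart: "graph_chart 1 \<Omega> U e g" and op: "open \<Omega>" and bd: "bounded \<Omega>"
    and x0: "x0 \<in> frontier \<Omega>" "x0 \<in> U" and R: "R > 0" and ball: "two_sided_ball \<Omega> R x0"
    and dim: "DIM('a) \<ge> 2" and p: "1 < p" "(DIM('a) / 2 - 1) * p < DIM('a) / 2 + 1"
  obtains \<delta> where "\<delta> > 0"
    "\<And>x \<gamma> u. x \<in> \<Omega> \<Longrightarrow> dist x x0 < \<delta> \<Longrightarrow> positive_solution \<Omega> p \<gamma> u \<Longrightarrow> u x \<le> 1 / \<delta>"
proof -
  define y0 where "y0 = x0 + R *\<^sub>R exterior_normal \<Omega> x0"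
  define a where "a = DIM('a) / 2 - 1"
  obtain \<epsilon> where \<epsilon>: "\<epsilon> > 0" "\<epsilon> \<le> R / 2" and
    ray: "\<And>x y t. x \<in> closure \<Omega> \<Longrightarrow> dist y y0 < \<epsilon> \<Longrightarrow> dist x y < R + \<epsilon> \<Longrightarrow> 1 < t \<Longrightarrow> t \<le> ((R + \<epsilon>) / (R - \<epsilon>))\<^sup>2
      \<Longrightarrow> y + t *\<^sub>R (x - y) \<in> \<Omega>"
    using rays_enter_domain[OF chart op bd x0 R ball] unfolding y0_def by blast
  have n1: "norm (exterior_normal \<Omega> x0) = 1" using ball by (simp add: two_sided_ball_def)
  then have d0: "dist x0 y0 = R" using R by (simp add: y0_def dist_norm)
  have far0: "R \<le> dist x y0" if "x \<in> closure \<Omega>" for x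
    unfolding y0_def by (rule two_sided_ball_outward[OF ball _ that]) (use R in simp)
  \<comment> \<open>for centres \<open>y\<close> near \<open>y0\<close> and \<open>x\<close> near \<open>x0\<close>, the reflection sphere between \<open>x\<close> and \<open>y + t (x - y)\<close> has radius below \<open>R + \<epsilon>\<close>\<close>
  define t where "t = ((R + \<epsilon>) / (R + \<epsilon> / 2))\<^sup>2"
  have t1: "t > 1" unfolding t_def using R \<epsilon> by (intro one_less_power) auto
  define \<rho> where "\<rho> = (t - 1) * \<epsilon> / 8"
  have \<rho>: "\<rho> > 0" using t1 \<epsilon> by (simp add: \<rho>_def)
  define M where "M = t powr a * ((real DIM('a) + 2)\<^sup>2 / (2 * \<rho>\<^sup>2)) powr (1 / (p - 1))"
  have M: "M > 0" 
  proof -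
    have "(real DIM('a) + 2)\<^sup>2 / (2 * \<rho>\<^sup>2) > 0" using \<rho> by (intro divide_pos_pos) auto
    then show ?thesis unfolding M_def using t1 by (intro mult_pos_pos) auto
  qed
  have bound: "u x \<le> M" if x: "x \<in> \<Omega>" "dist x x0 < \<epsilon> / 4" and sol: "positive_solution \<Omega> p \<gamma> u" for x \<gamma> u
  proof -
    have xc: "x \<in> closure \<Omega>" using x closure_subset by auto
    have upos: "u x > 0" using positive_solutionD(7)[OF sol x(1)] .
    define z0 where "z0 = x + (t - 1) *\<^sub>R (x - y0)"
    have p2: "(DIM('a) / 2 - 1) * p < (DIM('a) / 2 - 1) + 2" using p(2) by linarith
    have c0: "0 < (R - \<epsilon>)\<^sup>2" using R \<epsilon> by simp
    have z: "z \<in> \<Omega> \<and> u x \<le> t powr a * u z" if "z \<in> cball z0 \<rho>" for z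
    proof -
      \<comment> \<open>the centre from which \<open>x\<close> is carried to \<open>z\<close>\<close>
      define y where "y = x - (z - x) /\<^sub>R (t - 1)"
      have "(z - x) = (t - 1) *\<^sub>R (x - y)" using t1 by (simp add: y_def)
      then have zy: "z = y + t *\<^sub>R (x - y)" by (simp add: algebra_simps)
      have "z0 - z = (t - 1) *\<^sub>R (y - y0)"
        unfolding z0_def zy by (simp add: algebra_simps)
      then have "dist z0 z = (t - 1) * dist y y0" using t1 by (simp add: dist_norm)
      with that have "(t - 1) * dist y y0 \<le> (t - 1) * (\<epsilon> / 8)" by (simp add: \<rho>_def)
      then have yy: "dist y y0 \<le> \<epsilon> / 8" using t1 by simp
      have far: "(R - \<epsilon>)\<^sup>2 \<le> (x' - y) \<bullet> (x' - y)" if "x' \<in> closure \<Omega>" for x'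
      proof -
        have "R - \<epsilon> \<le> dist x' y" using far0[OF that] dist_triangle[of x' y0 y] yy \<epsilon> by linarith
        then show ?thesis unfolding dot_square_norm dist_norm using R \<epsilon> by (intro power_mono) auto
      qed
      have "dist x y < R + \<epsilon> / 2"
        using dist_triangle[of x y x0] dist_triangle[of x0 y y0] d0 yy x(2) \<epsilon> dist_commute[of y y0] by linarith
      then have "(x - y) \<bullet> (x - y) \<le> (R + \<epsilon> / 2)\<^sup>2"
        unfolding dot_square_norm dist_norm by (intro power_mono) auto
      then have tS: "t * ((x - y) \<bullet> (x - y)) \<le> t * (R + \<epsilon> / 2)\<^sup>2" using t1 by simp
      also have "\<dots> = ((R + \<epsilon>) / (R + \<epsilon> / 2) * (R + \<epsilon> / 2))\<^sup>2" unfolding t_def by (rule power_mult_distrib[symmetric])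
      also have "(R + \<epsilon>) / (R + \<epsilon> / 2) * (R + \<epsilon> / 2) = R + \<epsilon>" by (rule nonzero_eq_divide_eq[THEN iffD1, OF _ refl]) (use R \<epsilon> in linarith)
      finally have tS: "t * ((x - y) \<bullet> (x - y)) \<le> (R + \<epsilon>)\<^sup>2" .
      have ray': "y + t' *\<^sub>R (x' - y) \<in> \<Omega>"
        if "x' \<in> closure \<Omega>" "(x' - y) \<bullet> (x' - y) < (R + \<epsilon>)\<^sup>2" "1 < t'" "t' \<le> (R + \<epsilon>)\<^sup>2 / (R - \<epsilon>)\<^sup>2" for x' t'
      proof (rule ray[OF that(1)])
        show "dist x' y < R + \<epsilon>"
          using that(2) unfolding dot_square_norm dist_norm
          by (rule power2_less_imp_less) (use R \<epsilon> in linarith)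
      qed (use yy \<epsilon> that in \<open>auto simp: power_divide\<close>)
      have "u x \<le> t powr a * u (y + t *\<^sub>R (x - y))"
        unfolding a_def
        by (rule moving_spheres[OF sol op bd dim p(1) p2 c0 far ray' x(1) t1 tS])
      moreover have "y + t *\<^sub>R (x - y) \<in> \<Omega>"
      proof (rule ray'[OF xc _ t1])
        have Spos: "0 < (x - y) \<bullet> (x - y)" using far[OF xc] c0 by linarith
        then have "1 * ((x - y) \<bullet> (x - y)) < t * ((x - y) \<bullet> (x - y))" using t1 by (intro mult_strict_right_mono) auto
        then show "(x - y) \<bullet> (x - y) < (R + \<epsilon>)\<^sup>2" using tS by linarith
        have "t * (R - \<epsilon>)\<^sup>2 \<le> (R + \<epsilon>)\<^sup>2" 
        proof -
          have "t * (R - \<epsilon>)\<^sup>2 \<le> t * ((x - y) \<bullet> (x - y))" using far[OF xc] t1 by (intro mult_left_mono) auto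
          then show ?thesis using tS by linarith
        qed
        then show "t \<le> (R + \<epsilon>)\<^sup>2 / (R - \<epsilon>)\<^sup>2" using R \<epsilon> by (simp add: pos_le_divide_eq)
      qed
      ultimately show ?thesis by (simp add: zy)
    qed
    define m where "m = u x / t powr a"
    have tp: "t powr a > 0" using t1 by simp
    have "m powr (p - 1) \<le> (real DIM('a) + 2)\<^sup>2 / (2 * \<rho>\<^sup>2)"
    proof (rule positive_solution_minimum_bound[OF sol op _ \<rho> p(1)])
      show "cball z0 \<rho> \<subseteq> \<Omega>" using z by blast
      show "0 \<le> m" using upos tp by (simp add: m_def)
      show "m \<le> u z" if "z \<in> cball z0 \<rho>" for z
        using z[OF that] tp by (simp add: m_def pos_divide_le_eq mult.commute)
    qed
    then have "(m powr (p - 1)) powr (1 / (p - 1)) \<le> ((real DIM('a) + 2)\<^sup>2 / (2 * \<rho>\<^sup>2)) powr (1 / (p - 1))"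
      using p by (intro powr_mono2) auto
    moreover have "(m powr (p - 1)) powr (1 / (p - 1)) = m"
      using p upos tp by (simp add: powr_powr m_def)
    ultimately have "t powr a * m \<le> M" unfolding M_def using tp by simp
    then show ?thesis using tp t1 by (simp add: m_def)
  qed
  define \<delta> where "\<delta> = min (\<epsilon> / 4) (1 / M)"
  have \<delta>: "\<delta> > 0" "\<delta> \<le> \<epsilon> / 4" "\<delta> \<le> 1 / M" using \<epsilon> M by (simp_all add: \<delta>_def)
  have "\<delta> * M \<le> 1" using \<delta>(3) M by (simp add: pos_le_divide_eq)
  then have M\<delta>: "M \<le> 1 / \<delta>" using \<delta>(1) by (simp add: pos_le_divide_eq mult.commute)
  show thesis
  proof (rule that[OF \<delta>(1)])
    fix x \<gamma> u assume x: "x \<in> \<Omega>" "dist x x0 < \<delta>" "positive_solution \<Omega> p \<gamma> u"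
    have "u x \<le> M" by (rule bound[OF x(1) _ x(3)]) (use x(2) \<delta>(2) in linarith)
    then show "u x \<le> 1 / \<delta>" using M\<delta> by linarith
  qed
qed

text \<open>One number \<open>\<delta>\<close> serves as width of the strip and, through \<open>1/\<delta>\<close>, as bound, so that shrinking
it weakens the assertion and \<open>compact_local_to_uniform\<close> applies.\<close>

lemma boundary_bound:
  fixes \<Omega> :: "'a::euclidean_space set" and p :: real
  assumes dom: "bounded_domain_of_class k \<Omega>" "2 \<le> k"
    and dim: "DIM('a) \<ge> 2" and p: "1 < p" "(DIM('a) / 2 - 1) * p < DIM('a) / 2 + 1"
  obtains \<delta> where "\<delta> > 0"
    "\<And>x x0 \<gamma> u. x \<in> \<Omega> \<Longrightarrow> x0 \<in> frontier \<Omega> \<Longrightarrow> dist x x0 < \<delta> \<Longrightarrow> positive_solution \<Omega> p \<gamma> u \<Longrightarrow> u x \<le> 1 / \<delta>"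
proof -
  have op: "open \<Omega>" and bd: "bounded \<Omega>" using dom(1) by (simp_all add: bounded_domain_of_class_def)
  obtain R where R: "R > 0" "\<And>x. x \<in> frontier \<Omega> \<Longrightarrow> two_sided_ball \<Omega> R x"
    using uniform_two_sided_ball[OF dom] by blast
  define P where "P x0 \<delta> \<longleftrightarrow> (\<forall>x \<gamma> u. x \<in> \<Omega> \<longrightarrow> dist x x0 < \<delta> \<longrightarrow> positive_solution \<Omega> p \<gamma> u \<longrightarrow> u x \<le> 1 / \<delta>)"
    for x0 \<delta>
  have mono: "P z R'" if P: "P z R" and "0 < R'" "R' \<le> R" for z R R'
    unfolding P_def
  proof (intro allI impI)
    fix x \<gamma> u assume "x \<in> \<Omega>" "dist x z < R'" "positive_solution \<Omega> p \<gamma> u"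
    then have "u x \<le> 1 / R" using P that unfolding P_def by (meson order_less_le_trans)
    also have "\<dots> \<le> 1 / R'" using that by (intro divide_left_mono) auto
    finally show "u x \<le> 1 / R'" .
  qed
  have "\<exists>V. open V \<and> x0 \<in> V \<and> (\<exists>\<delta>>0. \<forall>z\<in>V \<inter> frontier \<Omega>. P z \<delta>)" if x0: "x0 \<in> frontier \<Omega>" for x0
  proof -
    have "\<exists>U e g. x0 \<in> U \<and> graph_chart k \<Omega> U e g"
      using dom(1) x0 by (simp add: bounded_domain_of_class_def)
    then obtain U e g where c: "x0 \<in> U" "graph_chart k \<Omega> U e g" by (elim exE conjE)
    have "graph_chart 1 \<Omega> U e g" by (rule graph_chart_mono[OF c(2)]) (use dom(2) in simp)
    from local_boundary_bound[OF this op bd x0 c(1) R(1) R(2)[OF x0] dim p]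
    obtain \<delta> where \<delta>: "\<delta> > 0" "P x0 \<delta>" unfolding P_def by blast
    have "P z (\<delta> / 2)" if "z \<in> ball x0 (\<delta> / 2)" for z
      unfolding P_def
    proof (intro allI impI)
      fix x \<gamma> u assume *: "x \<in> \<Omega>" "dist x z < \<delta> / 2" "positive_solution \<Omega> p \<gamma> u"
      have "dist x x0 < \<delta>" using *(2) that dist_triangle[of x x0 z] by (simp add: dist_commute)
      then have "u x \<le> 1 / \<delta>" using \<delta>(2) * unfolding P_def by blast
      also have "\<dots> \<le> 1 / (\<delta> / 2)" using \<delta>(1) by (intro divide_left_mono) auto
      finally show "u x \<le> 1 / (\<delta> / 2)" .
    qed
    then show ?thesis using \<delta>(1) by (intro exI[of _ "ball x0 (\<delta> / 2)"] conjI exI[of _ "\<delta> / 2"]) auto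
  qed
  then have loc: "\<And>x0. x0 \<in> frontier \<Omega> \<Longrightarrow> \<exists>V. open V \<and> x0 \<in> V \<and> (\<exists>\<delta>>0. \<forall>z\<in>V \<inter> frontier \<Omega>. P z \<delta>)" .
  obtain \<delta> where \<delta>: "\<delta> > 0" "\<And>z. z \<in> frontier \<Omega> \<Longrightarrow> P z \<delta>"
  proof (rule compact_local_to_uniform[of "frontier \<Omega>" P])
    show "compact (frontier \<Omega>)" using bd by (rule compact_frontier_bounded)
    show "\<exists>V. open V \<and> x0 \<in> V \<and> (\<exists>\<delta>>0. \<forall>z\<in>V \<inter> frontier \<Omega>. P z \<delta>)" if "x0 \<in> frontier \<Omega>" for x0
      using that by (rule loc)
    show "P z R'" if "P z R" "0 < R'" "R' \<le> R" for z R R' using that by (rule mono)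
  qed blast
  show thesis
    by (rule that[OF \<delta>(1)]) (use \<delta>(2) in \<open>simp add: P_def\<close>)
qed

section \<open>Minimum principles\<close>

text \<open>The normal derivative is defined through the limit of the gradient at the boundary; by the mean value
theorem it is also the limit of the difference quotients, which barriers control.\<close>

lemma normal_difference_quotient_tendsto:
  fixes \<Omega> :: "'a::euclidean_space set"
  assumes C2: "C2_hoelder r \<Omega> v" and op: "open \<Omega>" and x: "x \<in> frontier \<Omega>"
    and R: "R > 0" and ball: "two_sided_ball \<Omega> R x"
  shows "((\<lambda>t. (v (x - t *\<^sub>R exterior_normal \<Omega> x) - v x) / t) \<longlongrightarrow> - normal_deriv \<Omega> v x) (at_right 0)"
proof -
  define n where "n = exterior_normal \<Omega> x"
  have inside: "x - t *\<^sub>R n \<in> \<Omega>" if "0 < t" "t \<le> R" for t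
    unfolding n_def by (rule two_sided_ball_inward[OF ball that])
  have cont: "continuous_on (closure \<Omega>) v" and C: "C_k_on 2 \<Omega> v"
    using C2 by (auto simp: C2_hoelder_def)
  have "\<exists>h. \<forall>i\<in>Basis. continuous_on (closure \<Omega>) (h i) \<and> (\<forall>x\<in>\<Omega>. h i x = partial_deriv i v x)"
    using C2 unfolding C2_hoelder_def extends_continuously_def by (intro bchoice) blast
  then obtain h where h: "\<And>i. i \<in> Basis \<Longrightarrow> continuous_on (closure \<Omega>) (h i)"
    "\<And>i x. i \<in> Basis \<Longrightarrow> x \<in> \<Omega> \<Longrightarrow> h i x = partial_deriv i v x" by blast
  define G where "G = (\<Sum>i\<in>Basis. h i x *\<^sub>R i)"
  have xc: "x \<in> closure \<Omega>" "x \<notin> \<Omega>" using x op by (auto simp: frontier_def interior_open)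
  have "((\<lambda>y. \<Sum>i\<in>Basis. h i y *\<^sub>R i) \<longlongrightarrow> G) (at x within \<Omega>)"
    unfolding G_def
  proof (intro tendsto_intros)
    fix i :: 'a assume "i \<in> Basis"
    then have "(h i \<longlongrightarrow> h i x) (at x within closure \<Omega>)" using h(1) xc by (auto simp: continuous_on_def)
    then show "(h i \<longlongrightarrow> h i x) (at x within \<Omega>)" by (rule tendsto_within_subset) (rule closure_subset)
  qed
  then have lim: "(gradient v \<longlongrightarrow> G) (at x within \<Omega>)"
    by (rule Lim_transform_eventually) (auto simp: gradient_def h(2) eventually_at_filter)
  have "at x within \<Omega> \<noteq> bot"
    using xc by (simp add: trivial_limit_within islimpt_in_closure)
  from tendsto_Lim[OF this lim] have nd: "normal_deriv \<Omega> v x = G \<bullet> n"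
    by (simp add: normal_deriv_def n_def)
  have "\<exists>\<xi>. 0 < \<xi> \<and> \<xi> < t \<and> (v (x - t *\<^sub>R n) - v x) / t = - (gradient v (x - \<xi> *\<^sub>R n) \<bullet> n)"
    if t: "0 < t" "t \<le> R" for t
  proof -
    have d: "((\<lambda>s. v (x - s *\<^sub>R n)) has_real_derivative - (gradient v (x - s *\<^sub>R n) \<bullet> n)) (at s)"
      if "0 < s" "s < t" for s
    proof -
      have "((\<lambda>s. x - s *\<^sub>R n) has_derivative (\<lambda>h. - (h *\<^sub>R n))) (at s)"
        by (auto intro!: derivative_eq_intros)
      moreover have "(v has_derivative (\<lambda>h. gradient v (x - s *\<^sub>R n) \<bullet> h)) (at (x - s *\<^sub>R n))"
        using C2_has_laplacian[OF C op inside[of s]] that t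
        by (auto simp: has_laplacian_def dest: eventually_nhds_x_imp_x)
      ultimately have "((\<lambda>s. v (x - s *\<^sub>R n)) has_derivative (\<lambda>h. gradient v (x - s *\<^sub>R n) \<bullet> - (h *\<^sub>R n))) (at s)"
        by (rule has_derivative_compose)
      then show ?thesis unfolding has_field_derivative_def by (rule has_derivative_eq_rhs) (simp add: fun_eq_iff)
    qed
    have "continuous_on {0..t} (\<lambda>s. v (x - s *\<^sub>R n))"
    proof (rule continuous_on_compose2[OF cont])
      show "(\<lambda>s. x - s *\<^sub>R n) ` {0..t} \<subseteq> closure \<Omega>"
      proof safe
        fix s assume "s \<in> {0..t}"
        then show "x - s *\<^sub>R n \<in> closure \<Omega>"
          using inside[of s] t xc closure_subset[of \<Omega>] by (cases "s = 0") auto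
      qed
    qed (intro continuous_intros)
    from MVT[OF t(1) this] obtain l \<xi> where
      "0 < \<xi>" "\<xi> < t" and l: "((\<lambda>s. v (x - s *\<^sub>R n)) has_real_derivative l) (at \<xi>)" "v (x - t *\<^sub>R n) - v (x - 0 *\<^sub>R n) = (t - 0) * l"
      using d by (metis real_differentiable_def)
    moreover have "l = - (gradient v (x - \<xi> *\<^sub>R n) \<bullet> n)"
      using DERIV_unique[OF l(1) d] \<open>0 < \<xi>\<close> \<open>\<xi> < t\<close> by simp
    ultimately show ?thesis using t by (intro exI[of _ \<xi>]) simp
  qed
  then have "\<forall>t\<in>{0<..R}. \<exists>\<xi>. 0 < \<xi> \<and> \<xi> < t \<and> (v (x - t *\<^sub>R n) - v x) / t = - (gradient v (x - \<xi> *\<^sub>R n) \<bullet> n)"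
    by auto
  from bchoice[OF this] obtain \<xi> where "\<forall>t\<in>{0<..R}. 0 < \<xi> t \<and> \<xi> t < t \<and>
     (v (x - t *\<^sub>R n) - v x) / t = - (gradient v (x - \<xi> t *\<^sub>R n) \<bullet> n)" by blast
  then have \<xi>: "0 < \<xi> t \<and> \<xi> t < t \<and> (v (x - t *\<^sub>R n) - v x) / t = - (gradient v (x - \<xi> t *\<^sub>R n) \<bullet> n)"
    if "0 < t" "t \<le> R" for t using that by simp
  have ev: "\<forall>\<^sub>F t in at_right 0. 0 < t \<and> t \<le> R"
    using eventually_at_right_real[OF R] by eventually_elim auto
  have "(\<xi> \<longlongrightarrow> 0) (at_right 0)"
    by (rule tendsto_sandwich[of "\<lambda>_. 0" _ _ "\<lambda>t. t"])
      (use ev \<xi> in \<open>auto elim!: eventually_mono intro: less_imp_le tendsto_ident_at\<close>)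
  then have "((\<lambda>t. x - \<xi> t *\<^sub>R n) \<longlongrightarrow> x - 0 *\<^sub>R n) (at_right 0)" by (intro tendsto_intros)
  moreover have "\<forall>\<^sub>F t in at_right 0. x - \<xi> t *\<^sub>R n \<in> \<Omega> \<and> x - \<xi> t *\<^sub>R n \<noteq> x"
    using ev
  proof eventually_elim
    case (elim t)
    then have "x - \<xi> t *\<^sub>R n \<in> \<Omega>" using inside[of "\<xi> t"] \<xi>[of t] by auto
    then show ?case using xc by metis
  qed
  ultimately have "filterlim (\<lambda>t. x - \<xi> t *\<^sub>R n) (at x within \<Omega>) (at_right 0)"
    by (simp add: filterlim_at)
  from filterlim_compose[OF lim this]
  have "((\<lambda>t. - (gradient v (x - \<xi> t *\<^sub>R n) \<bullet> n)) \<longlongrightarrow> - (G \<bullet> n)) (at_right 0)"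
    by (intro tendsto_intros)
  then show ?thesis unfolding nd n_def[symmetric]
    by (rule Lim_transform_eventually) (use ev \<xi> in \<open>auto elim!: eventually_mono\<close>)
qed

text \<open>The quantitative core of the Hopf lemma. With \<open>s = R\<^sup>2 - |x - z|\<^sup>2\<close>, the function
\<open>s + N s\<^sup>2/R\<^sup>2\<close> is subharmonic for \<open>s \<le> \<sigma>\<close>, at most \<open>2 \<sigma>\<close> there, and at least \<open>s\<close>; a multiple of
it lies below \<open>v - \<kappa>\<close> on both boundary spheres of the shell.\<close>

lemma hopf_lower_bound:
  fixes v :: "'a::euclidean_space \<Rightarrow> real" and z :: 'a and R m \<kappa> :: real
  defines "\<sigma> \<equiv> R\<^sup>2 / (real DIM('a) + 2)"
  assumes R: "R > 0" and cont: "continuous_on (cball z R) v"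
    and sup: "\<And>x. x \<in> ball z R \<Longrightarrow> \<exists>G L. has_laplacian v G L x \<and> L \<le> 0"
    and ge: "\<And>x. x \<in> cball z R \<Longrightarrow> \<kappa> \<le> v x"
    and inner: "\<And>x. (dist z x)\<^sup>2 \<le> R\<^sup>2 - \<sigma> \<Longrightarrow> \<kappa> + m \<le> v x"
    and m: "m > 0" and x: "R\<^sup>2 - \<sigma> \<le> (dist z x)\<^sup>2" "x \<in> cball z R"
  shows "\<kappa> + m / (2 * \<sigma>) * (R\<^sup>2 - (dist z x)\<^sup>2) \<le> v x"
proof (rule ccontr)
  define N where "N = real DIM('a)"
  have N: "N > 0" by (simp add: N_def)
  have \<sigma>: "\<sigma> > 0" "N * \<sigma> \<le> R\<^sup>2" "(8 + 4 * N) * \<sigma> = 4 * R\<^sup>2"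
    using R N unfolding \<sigma>_def N_def[symmetric] by (auto simp: field_simps)
  define c where "c = m / (2 * \<sigma>)"
  have c: "c > 0" using m \<sigma> by (simp add: c_def)
  define s where "s x = R\<^sup>2 - (x + - z) \<bullet> (x + - z)" for x
  have sd: "s x = R\<^sup>2 - (dist z x)\<^sup>2" for x
    by (simp add: s_def dot_square_norm dist_norm norm_minus_commute)
  define b where "b x = c * (s x + N / R\<^sup>2 * (s x)\<^sup>2)" for x
  define T where "T = {x \<in> cball z R. s x \<le> \<sigma>}"
  assume neg: "\<not> \<kappa> + m / (2 * \<sigma>) * (R\<^sup>2 - (dist z x)\<^sup>2) \<le> v x"
  have xT: "x \<in> T" using x by (simp add: T_def sd)
  have s0: "0 \<le> s x" if "x \<in> T" for x
  proof -
    have "(dist z x)\<^sup>2 \<le> R\<^sup>2" using that by (intro power_mono) (auto simp: T_def)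
    then show ?thesis by (simp add: sd)
  qed
  have contb: "continuous_on A b" for A unfolding b_def s_def by (intro continuous_intros)
  have "compact T"
  proof -
    have "T = cball z R \<inter> {x. s x \<le> \<sigma>}" by (auto simp: T_def)
    moreover have "closed {x. s x \<le> \<sigma>}" unfolding s_def by (intro closed_Collect_le continuous_intros)
    ultimately show ?thesis by (auto intro: compact_Int_closed)
  qed
  moreover have "continuous_on T (\<lambda>x. v x - b x)"
    by (intro continuous_intros contb continuous_on_subset[OF cont]) (auto simp: T_def)
  ultimately obtain x1 where x1: "x1 \<in> T" "\<And>x. x \<in> T \<Longrightarrow> v x1 - b x1 \<le> v x - b x"
    using continuous_attains_inf[of T "\<lambda>x. v x - b x"] xT by blast
  have "c * s x \<le> b x" using s0[OF xT] c N R unfolding b_def by (intro mult_left_mono) auto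
  then have "v x - b x < \<kappa>" using neg by (simp add: c_def sd)
  then have lt: "v x1 - b x1 < \<kappa>" using x1(2)[OF xT] by simp
  have sx1: "0 \<le> s x1" "s x1 \<le> \<sigma>" using s0[OF x1(1)] x1(1) by (auto simp: T_def)
  have "s x1 \<noteq> 0"
  proof
    assume "s x1 = 0"
    then have "b x1 = 0" by (simp add: b_def)
    then show False using lt ge[of x1] x1(1) by (simp add: T_def)
  qed
  moreover have "s x1 \<noteq> \<sigma>"
  proof
    assume e: "s x1 = \<sigma>"
    then have "\<kappa> + m \<le> v x1" by (intro inner) (simp add: sd)
    moreover have "b x1 \<le> m"
    proof -
      have "N / R\<^sup>2 * \<sigma>\<^sup>2 = N * \<sigma> / R\<^sup>2 * \<sigma>" by (simp add: power2_eq_square)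
      also have "\<dots> \<le> 1 * \<sigma>" using \<sigma> R by (intro mult_right_mono) (auto simp: pos_divide_le_eq)
      finally have "c * (\<sigma> + N / R\<^sup>2 * \<sigma>\<^sup>2) \<le> c * (2 * \<sigma>)" using c by (intro mult_left_mono) auto
      also have "\<dots> = m" using \<sigma> by (simp add: c_def)
      finally show ?thesis by (simp add: b_def e)
    qed
    ultimately show False using lt by simp
  qed
  ultimately have sx1': "0 < s x1" "s x1 < \<sigma>" using sx1 by auto
  have "(dist z x1)\<^sup>2 < R\<^sup>2" using sx1'(1) by (simp add: sd)
  then have x1b: "x1 \<in> ball z R" using R by (auto intro: power2_less_imp_less)
  from sup[OF x1b] obtain G L where GL: "has_laplacian v G L x1" "L \<le> 0" by blast
  define k where "k = N / R\<^sup>2"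
  have "has_laplacian (\<lambda>x. c * ((R\<^sup>2 - x \<bullet> x) + k * (R\<^sup>2 - x \<bullet> x)\<^sup>2))
     (\<lambda>x. (2 * (c * (- 1 + k * (- 2 * (R\<^sup>2 - x \<bullet> x))))) *\<^sub>R x)
     (4 * ((x1 + - z) \<bullet> (x1 + - z)) * (c * (k * 2)) + 2 * DIM('a) * (c * (- 1 + k * (- 2 * (R\<^sup>2 - (x1 + - z) \<bullet> (x1 + - z)))))) (x1 + - z)"
    by (rule has_laplacian_radial) (auto intro!: derivative_eq_intros always_eventually)
  from has_laplacian_shift[OF this] obtain F where F: "has_laplacian b F
     (4 * (R\<^sup>2 - s x1) * (c * (N / R\<^sup>2 * 2)) + 2 * N * (c * (- 1 + N / R\<^sup>2 * (- 2 * s x1)))) x1"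
    by (auto simp: b_def[abs_def] s_def k_def N_def)
  have "open {x. s x < \<sigma>}" unfolding s_def by (intro open_Collect_less continuous_intros)
  then have "\<forall>\<^sub>F x in nhds x1. x \<in> ball z R \<inter> {x. s x < \<sigma>}"
    using x1b sx1' by (intro eventually_nhds_in_open) auto
  then have "\<forall>\<^sub>F x in nhds x1. v x1 - b x1 \<le> v x - b x"
    by eventually_elim (rule x1(2), auto simp: T_def)
  from has_laplacian_local_min(1)[OF has_laplacian_diff[OF GL(1) F] this]
  have "0 \<le> L - (4 * (R\<^sup>2 - s x1) * (c * (N / R\<^sup>2 * 2)) + 2 * N * (c * (- 1 + N / R\<^sup>2 * (- 2 * s x1))))" .
  also have "4 * (R\<^sup>2 - s x1) * (c * (N / R\<^sup>2 * 2)) + 2 * N * (c * (- 1 + N / R\<^sup>2 * (- 2 * s x1)))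
    = c * N / R\<^sup>2 * (6 * R\<^sup>2 - (8 + 4 * N) * s x1)"
    using R by (simp add: divide_simps) (simp add: algebra_simps)
  finally have "c * N / R\<^sup>2 * (6 * R\<^sup>2 - (8 + 4 * N) * s x1) \<le> 0" using GL(2) by simp
  moreover have "(8 + 4 * N) * s x1 \<le> 4 * R\<^sup>2"
    using \<sigma>(3) sx1 N by (metis mult_left_mono add_nonneg_nonneg less_imp_le zero_le_mult_iff zero_le_numeral)
  then have "0 < 6 * R\<^sup>2 - (8 + 4 * N) * s x1" using R by (simp add: algebra_simps) 
     (smt (verit) zero_less_power)
  then have "0 < c * N / R\<^sup>2 * (6 * R\<^sup>2 - (8 + 4 * N) * s x1)"
    using c N R by (intro mult_pos_pos divide_pos_pos) auto
  ultimately show False by simp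
qed

text \<open>The set where the minimum is attained is closed; it is also open: otherwise some ball on which \<open>v > \<kappa>\<close>
touches it at a point \<open>x3\<close>, where the gradient of \<open>v\<close> vanishes as at any interior minimum, whereas
the Hopf bound forces linear growth from \<open>x3\<close> into the ball.\<close>

lemma strong_minimum_principle:
  fixes v :: "'a::euclidean_space \<Rightarrow> real"
  assumes op: "open \<Omega>" and con: "connected \<Omega>"
    and sup: "\<And>x. x \<in> \<Omega> \<Longrightarrow> \<exists>G L. has_laplacian v G L x \<and> L \<le> 0"
    and ge: "\<And>x. x \<in> \<Omega> \<Longrightarrow> \<kappa> \<le> v x"
    and x0: "x0 \<in> \<Omega>" "v x0 = \<kappa>" and x: "x \<in> \<Omega>"
  shows "v x = \<kappa>"
proof -
  have cont: "continuous_on \<Omega> v"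
  proof (rule continuous_at_imp_continuous_on, rule ballI)
    fix x assume "x \<in> \<Omega>"
    then obtain G L where "has_laplacian v G L x" using sup by blast
    then have "(v has_derivative (\<lambda>h. G x \<bullet> h)) (at x)"
      by (auto simp: has_laplacian_def dest: eventually_nhds_x_imp_x)
    then show "isCont v x" by (rule has_derivative_continuous)
  qed
  define Z where "Z = {x \<in> \<Omega>. v x = \<kappa>}"
  have "closedin (top_of_set \<Omega>) Z"
    unfolding Z_def by (rule continuous_closedin_preimage_constant[OF cont])
  moreover have "openin (top_of_set \<Omega>) Z"
    unfolding openin_open_eq[OF op]
  proof
    show "open Z"
      unfolding open_contains_ball
    proof
      fix x2 assume "x2 \<in> Z"
      then have x2: "x2 \<in> \<Omega>" "v x2 = \<kappa>" by (auto simp: Z_def)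
      obtain r where r: "r > 0" "ball x2 (2 * r) \<subseteq> \<Omega>"
      proof -
        obtain r where "r > 0" "ball x2 r \<subseteq> \<Omega>" using op x2 by (metis open_contains_ball)
        then show thesis by (intro that[of "r / 2"]) auto
      qed
      have "ball x2 r \<subseteq> Z"
      proof
        fix x1 assume x1: "x1 \<in> ball x2 r"
        show "x1 \<in> Z"
        proof (rule ccontr)
          assume x1Z: "x1 \<notin> Z"
          have sub: "cball x1 (dist x1 x2) \<subseteq> \<Omega>"
          proof
            fix w assume "w \<in> cball x1 (dist x1 x2)"
            then have "dist x2 w < 2 * r" using x1 dist_triangle[of x2 w x1] by (simp add: dist_commute)
            then show "w \<in> \<Omega>" using r by auto
          qed
          define Y where "Y = cball x1 (dist x1 x2) \<inter> Z"
          have "closed (cball x1 (dist x1 x2) \<inter> v -` {\<kappa>})"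
            by (rule continuous_closed_preimage[OF continuous_on_subset[OF cont sub]]) auto
          moreover have "Y = cball x1 (dist x1 x2) \<inter> (cball x1 (dist x1 x2) \<inter> v -` {\<kappa>})"
            using sub by (auto simp: Y_def Z_def)
          ultimately have "compact Y" by (simp only: compact_Int_closed compact_cball)
          moreover have "Y \<noteq> {}" using \<open>x2 \<in> Z\<close> by (auto simp: Y_def)
          moreover have "continuous_on Y (dist x1)" by (intro continuous_intros)
          ultimately obtain x3 where x3: "x3 \<in> Y" "\<And>w. w \<in> Y \<Longrightarrow> dist x1 x3 \<le> dist x1 w"
            using continuous_attains_inf[of Y "dist x1"] by blast
          define d where "d = dist x1 x3"
          have d: "d > 0" "d \<le> dist x1 x2" using x3 x1Z \<open>x2 \<in> Z\<close> by (auto simp: d_def Y_def)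
          have pos: "v w > \<kappa>" if "w \<in> ball x1 d" for w
          proof -
            have w: "w \<in> cball x1 (dist x1 x2)" using that d by auto
            then have "w \<notin> Z" using x3(2)[of w] that by (auto simp: Y_def d_def)
            moreover have "w \<in> \<Omega>" using sub w by blast
            ultimately show ?thesis using ge[of w] by (auto simp: Z_def)
          qed
          have x3\<Omega>: "x3 \<in> \<Omega>" "v x3 = \<kappa>" using x3(1) by (auto simp: Y_def Z_def)
          have subd: "cball x1 d \<subseteq> \<Omega>" using sub d by auto
          define \<sigma> where "\<sigma> = d\<^sup>2 / (real DIM('a) + 2)"
          have \<sigma>: "\<sigma> > 0" "\<sigma> < d\<^sup>2"
            using d by (auto simp: \<sigma>_def divide_less_eq mult_less_cancel_left1)
          define I where "I = cball x1 (sqrt (d\<^sup>2 - \<sigma>))"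
          have Iiff: "w \<in> I \<longleftrightarrow> (dist x1 w)\<^sup>2 \<le> d\<^sup>2 - \<sigma>" for w
            using \<sigma> by (auto simp: I_def real_le_rsqrt) (metis real_sqrt_le_iff real_sqrt_abs abs_of_nonneg zero_le_dist)
          have Isub: "I \<subseteq> ball x1 d"
          proof
            fix w assume "w \<in> I"
            then have "(dist x1 w)\<^sup>2 < d\<^sup>2" using Iiff \<sigma> by force
            then show "w \<in> ball x1 d" using d by (auto intro: power2_less_imp_less)
          qed
          have "continuous_on I v"
            using Isub subd ball_subset_cball[of x1 d] by (intro continuous_on_subset[OF cont]) blast
          moreover have "I \<noteq> {}" "compact I" using \<sigma> by (auto simp: I_def)
          ultimately obtain w0 where w0: "w0 \<in> I" "\<And>w. w \<in> I \<Longrightarrow> v w0 \<le> v w"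
            using continuous_attains_inf[of I v] by blast
          define m where "m = v w0 - \<kappa>"
          have m: "m > 0" using pos[of w0] w0(1) Isub by (auto simp: m_def)
          define c where "c = m / (2 * \<sigma>)"
          have c: "c > 0" using m \<sigma> by (simp add: c_def)
          have hopf: "\<kappa> + c * (d\<^sup>2 - (dist x1 w)\<^sup>2) \<le> v w" if "d\<^sup>2 - \<sigma> \<le> (dist x1 w)\<^sup>2" "w \<in> cball x1 d" for w
            unfolding c_def \<sigma>_def
          proof (rule hopf_lower_bound[OF d(1) continuous_on_subset[OF cont subd] _ _ _ m])
            show "\<exists>G L. has_laplacian v G L w \<and> L \<le> 0" if "w \<in> ball x1 d" for w
              by (rule sup) (use that subd in auto)
            show "\<kappa> \<le> v w" if "w \<in> cball x1 d" for w by (rule ge) (use that subd in auto)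
            show "\<kappa> + m \<le> v w" if "(dist x1 w)\<^sup>2 \<le> d\<^sup>2 - d\<^sup>2 / (real DIM('a) + 2)" for w
              using w0(2)[of w] that by (simp add: m_def Iiff \<sigma>_def)
          qed (use that in \<open>auto simp: \<sigma>_def\<close>)
          obtain G L where GL: "has_laplacian v G L x3" using sup[OF x3\<Omega>(1)] by blast
          have "\<forall>\<^sub>F w in nhds x3. w \<in> \<Omega>" by (rule eventually_nhds_in_open[OF op x3\<Omega>(1)])
          then have "\<forall>\<^sub>F w in nhds x3. v x3 \<le> v w" by eventually_elim (use ge x3\<Omega> in auto)
          from has_laplacian_local_min(2)[OF GL this] have "G x3 = 0" .
          with GL have "(v has_derivative (\<lambda>h. 0)) (at (x3 + 0 *\<^sub>R (x1 - x3)))"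
            by (auto simp: has_laplacian_def dest: eventually_nhds_x_imp_x)
          moreover have "((\<lambda>t. x3 + t *\<^sub>R (x1 - x3)) has_derivative (\<lambda>h. h *\<^sub>R (x1 - x3))) (at 0)"
            by (auto intro!: derivative_eq_intros)
          ultimately have "((\<lambda>t. v (x3 + t *\<^sub>R (x1 - x3))) has_derivative (\<lambda>h. 0)) (at 0)"
            using has_derivative_compose by fastforce
          then have "((\<lambda>t. v (x3 + t *\<^sub>R (x1 - x3))) has_real_derivative 0) (at 0)"
            unfolding has_field_derivative_def by (rule has_derivative_eq_rhs) (simp add: fun_eq_iff)
          moreover have "0 < c * d\<^sup>2" using c d by simp
          ultimately have neg: "((\<lambda>t. v (x3 + t *\<^sub>R (x1 - x3)) - c * d\<^sup>2 * t) has_real_derivative (0 - c * d\<^sup>2)) (at 0)"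
            by (intro DERIV_diff DERIV_cmult_Id)
          obtain e where e: "e > 0"
            "\<And>t. 0 < t \<Longrightarrow> t < e \<Longrightarrow> v (x3 + t *\<^sub>R (x1 - x3)) - c * d\<^sup>2 * t < \<kappa>"
            using DERIV_neg_dec_right[OF neg] \<open>0 < c * d\<^sup>2\<close> x3\<Omega> by auto
          define t where "t = min (e / 2) (\<sigma> / (2 * d\<^sup>2))"
          have t: "0 < t" "t < e" "t \<le> \<sigma> / (2 * d\<^sup>2)" using e \<sigma> d by (auto simp: t_def)
          have "\<sigma> / (2 * d\<^sup>2) \<le> 1 / 2" using \<sigma> d by (simp add: field_simps)
          then have t1: "t \<le> 1 / 2" using t by linarith
          define w where "w = x3 + t *\<^sub>R (x1 - x3)"
          have "x1 - w = (1 - t) *\<^sub>R (x1 - x3)" by (simp add: w_def algebra_simps)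
          then have dw: "dist x1 w = (1 - t) * d" using t1 by (simp add: dist_norm d_def)
          have sw: "d\<^sup>2 - (dist x1 w)\<^sup>2 = d\<^sup>2 * (2 * t - t\<^sup>2)"
            by (simp add: dw power2_eq_square algebra_simps)
          have tt: "t \<le> 2 * t - t\<^sup>2" "2 * t - t\<^sup>2 \<le> 2 * t" using t t1 mult_left_le_one_le[of t t] by (auto simp: power2_eq_square)
          have "d\<^sup>2 * (2 * t - t\<^sup>2) \<le> d\<^sup>2 * (2 * (\<sigma> / (2 * d\<^sup>2)))" by (rule mult_left_mono[OF _ zero_le_power2]) (use tt(2) t(3) in linarith)
          also have "\<dots> = \<sigma>" using d by simp
          finally have "d\<^sup>2 - \<sigma> \<le> (dist x1 w)\<^sup>2" using sw by simp
          moreover have "w \<in> cball x1 d" using dw t t1 d by (simp add: mult_left_le_one_le)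
          ultimately have "\<kappa> + c * (d\<^sup>2 * (2 * t - t\<^sup>2)) \<le> v w" using hopf[of w] sw by simp
          moreover have "c * (d\<^sup>2 * t) \<le> c * (d\<^sup>2 * (2 * t - t\<^sup>2))" using c tt by (intro mult_left_mono) auto
          ultimately show False using e(2)[OF t(1,2)] by (simp add: w_def)
        qed
      qed
      then show "\<exists>e>0. ball x2 e \<subseteq> Z" using r by blast
    qed
    show "Z \<subseteq> \<Omega>" by (auto simp: Z_def)
  qed
  ultimately have "Z = {} \<or> Z = \<Omega>" using con by (auto simp: connected_clopen)
  then show ?thesis using x0 x by (auto simp: Z_def)
qed

section \<open>The normal derivative\<close>

text \<open>First \<open>v \<ge> \<gamma>\<close>, since otherwise \<open>v - \<epsilon> |x|\<^sup>2\<close> has an interior minimum for small \<open>\<epsilon>\<close>, although its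
Laplacian is negative. Then the strong minimum principle leaves the two cases.\<close>

lemma nonneg_boundary_imp_positive_solution:
  fixes \<Omega> :: "'a::euclidean_space set"
  assumes op: "open \<Omega>" and con: "connected \<Omega>" and bd: "bounded \<Omega>"
    and C2: "C_k_on 2 \<Omega> v" and cont: "continuous_on (closure \<Omega>) v"
    and eq: "\<And>x. x \<in> \<Omega> \<Longrightarrow> - laplacian v x = (max (v x) 0) powr p"
    and bdry: "\<And>x. x \<in> frontier \<Omega> \<Longrightarrow> v x = \<gamma>" and \<gamma>: "\<gamma> \<ge> 0"
  shows "positive_solution \<Omega> p \<gamma> v \<or> (\<forall>x\<in>\<Omega>. v x = \<gamma>)"
proof -
  have lap: "has_laplacian v (gradient v) (- (max (v x) 0 powr p)) x" if "x \<in> \<Omega>" for x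
    using C2_has_laplacian[OF C2 op that] eq[OF that] by (metis minus_minus)
  have cl: "x \<in> \<Omega> \<or> x \<in> frontier \<Omega>" if "x \<in> closure \<Omega>" for x
    using that op by (auto simp: frontier_def interior_open)
  have weak: "\<gamma> \<le> v x" if x: "x \<in> closure \<Omega>" for x
  proof (rule ccontr)
    assume "\<not> \<gamma> \<le> v x"
    then have lt: "v x < \<gamma>" by simp
    obtain B where B: "\<And>y. y \<in> closure \<Omega> \<Longrightarrow> norm y \<le> B"
      using bounded_closure[OF bd] by (auto simp: bounded_iff)
    define \<epsilon> where "\<epsilon> = (\<gamma> - v x) / (2 * (B\<^sup>2 + 1))"
    have B1: "0 < B\<^sup>2 + 1" by (simp add: add_nonneg_pos)
    have \<epsilon>: "\<epsilon> > 0" using lt B1 by (simp add: \<epsilon>_def)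
    have "\<epsilon> * (2 * (B\<^sup>2 + 1)) = \<gamma> - v x" using B1 by (simp add: \<epsilon>_def)
    then have \<epsilon>B: "\<epsilon> * B\<^sup>2 < \<gamma> - v x" using \<epsilon> lt by (simp add: algebra_simps)
    define g where "g y = v y - \<epsilon> * (y \<bullet> y)" for y
    have "continuous_on (closure \<Omega>) g" unfolding g_def by (intro continuous_intros cont)
    moreover have "compact (closure \<Omega>)" "closure \<Omega> \<noteq> {}" using bd x by auto
    ultimately obtain x2 where x2: "x2 \<in> closure \<Omega>" "\<And>y. y \<in> closure \<Omega> \<Longrightarrow> g x2 \<le> g y"
      using continuous_attains_inf[of "closure \<Omega>" g] by blast
    have "g x2 \<le> g x" using x2(2)[OF x] .
    also have "g x \<le> v x" using \<epsilon> by (simp add: g_def)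
    finally have g2: "g x2 \<le> v x" .
    have "x2 \<notin> frontier \<Omega>"
    proof
      assume f: "x2 \<in> frontier \<Omega>"
      have "x2 \<bullet> x2 \<le> B\<^sup>2" unfolding dot_square_norm using B[OF x2(1)] by (intro power_mono) auto
      then have "\<epsilon> * (x2 \<bullet> x2) \<le> \<epsilon> * B\<^sup>2" using \<epsilon> by simp
      then show False using g2 bdry[OF f] \<epsilon>B by (simp add: g_def)
    qed
    then have x2\<Omega>: "x2 \<in> \<Omega>" using cl x2 by blast
    have "has_laplacian (\<lambda>y::'a. y \<bullet> y) (\<lambda>y. (2 * 1) *\<^sub>R y) (4 * (x2 \<bullet> x2) * 0 + real (2 * DIM('a)) * 1) x2"
      by (rule has_laplacian_radial[where H="\<lambda>s. s" and ?H1.0="\<lambda>s. 1"])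
        (auto intro!: derivative_eq_intros always_eventually)
    from has_laplacian_diff[OF lap[OF x2\<Omega>] has_laplacian_cmult[OF this, of \<epsilon>]]
    obtain F where F: "has_laplacian g F (- (max (v x2) 0 powr p) - \<epsilon> * (2 * DIM('a))) x2"
      unfolding g_def by auto
    have "\<forall>\<^sub>F y in nhds x2. y \<in> \<Omega>" by (rule eventually_nhds_in_open[OF op x2\<Omega>])
    then have "\<forall>\<^sub>F y in nhds x2. g x2 \<le> g y"
      by eventually_elim (use x2 closure_subset in blast)
    from has_laplacian_local_min(1)[OF F this] have "\<epsilon> * (2 * DIM('a)) \<le> 0"
      using powr_ge_zero[of "max (v x2) 0" p] by linarith
    then show False using \<epsilon> by (simp add: mult_le_0_iff)
  qed
  show ?thesis
  proof (cases "\<forall>x\<in>\<Omega>. \<gamma> < v x")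
    case True
    then show ?thesis
      using C2 cont eq bdry \<gamma> by (auto simp: positive_solution_def max_def)
  next
    case False
    then obtain x0 where x0: "x0 \<in> \<Omega>" "v x0 = \<gamma>"
      using weak closure_subset[of \<Omega>] by (metis in_mono less_le)
    have "v x = \<gamma>" if "x \<in> \<Omega>" for x
    proof (rule strong_minimum_principle[where v=v and \<kappa>=\<gamma>, OF op con _ _ x0 that])
      show "\<exists>G L. has_laplacian v G L x \<and> L \<le> 0" if "x \<in> \<Omega>" for x
        using lap[OF that] by (meson neg_le_0_iff_le powr_ge_zero)
      show "\<gamma> \<le> v x" if "x \<in> \<Omega>" for x using weak closure_subset that by blast
    qed
    then show ?thesis by blast
  qed
qed

text \<open>Outside the exterior ball about \<open>y\<close>, with \<open>s = |x - y|\<^sup>2 - R\<^sup>2\<close>, the function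
\<open>A (s - N s\<^sup>2/(2 R\<^sup>2))\<close> is superharmonic and comparable to \<open>A s\<close>. For the given \<open>A\<close> it lies above
\<open>u - \<gamma>\<close> in the shell \<open>s \<le> \<sigma>\<close>: there \<open>u \<le> 1/\<delta>\<close>, which bounds \<open>- \<Delta>u\<close>, and on the outer
sphere the function is at least \<open>1/\<delta>\<close>. The constant \<open>A\<close> does not depend on \<open>u\<close>, \<open>\<gamma>\<close> and \<open>x0\<close>.\<close>

lemma boundary_upper_barrier:
  fixes \<Omega> :: "'a::euclidean_space set" and R \<delta> p :: real
  defines "\<sigma> \<equiv> min (R * \<delta>) (R\<^sup>2 / DIM('a))"
  defines "A \<equiv> (1 / \<delta>) powr p + 1 + 2 / (\<delta> * \<sigma>)"
  assumes op: "open \<Omega>" and bd: "bounded \<Omega>" and x0: "x0 \<in> frontier \<Omega>"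
    and R: "R > 0" and ball: "two_sided_ball \<Omega> R x0" and \<delta>: "\<delta> > 0" and p: "p > 1"
    and sol: "positive_solution \<Omega> p \<gamma> u"
    and bound: "\<And>x x0. x \<in> \<Omega> \<Longrightarrow> x0 \<in> frontier \<Omega> \<Longrightarrow> dist x x0 < \<delta> \<Longrightarrow> u x \<le> 1 / \<delta>"
    and t: "0 < t" "t \<le> R" "2 * R * t + t\<^sup>2 \<le> \<sigma>"
  shows "u (x0 - t *\<^sub>R exterior_normal \<Omega> x0) \<le> \<gamma> + 3 * R * A * t"
proof -
  note solD = positive_solutionD[OF sol]
  define N where "N = real DIM('a)"
  have N: "N \<ge> 1" by (simp add: N_def Suc_leI)
  define n where "n = exterior_normal \<Omega> x0"
  define y where "y = x0 + R *\<^sub>R n"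
  have n1: "norm n = 1" using ball by (simp add: two_sided_ball_def n_def)
  have ext: "cball y R \<inter> closure \<Omega> \<subseteq> {x0}"
    using ball by (auto simp: two_sided_ball_def n_def y_def)
  have \<sigma>: "\<sigma> > 0" "\<sigma> \<le> R * \<delta>" "N * \<sigma> \<le> R\<^sup>2"
  proof -
    show "\<sigma> > 0" using R \<delta> by (simp add: \<sigma>_def)
    show "\<sigma> \<le> R * \<delta>" by (simp add: \<sigma>_def)
    have "\<sigma> \<le> R\<^sup>2 / N" by (simp add: \<sigma>_def N_def)
    then show "N * \<sigma> \<le> R\<^sup>2" using N by (simp add: pos_le_divide_eq mult.commute)
  qed
  define M where "M = 1 / \<delta>"
  have M: "M > 0" using \<delta> by (simp add: M_def)
  have A: "A > M powr p" "A * \<sigma> \<ge> 2 * M" "A > 0"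
  proof -
    have "0 < 2 / (\<delta> * \<sigma>)" using \<delta> \<sigma> by simp
    then show "A > M powr p" unfolding A_def M_def by linarith
    then show "A > 0" using powr_ge_zero[of M p] by linarith
    have "2 / (\<delta> * \<sigma>) * \<sigma> \<le> A * \<sigma>" unfolding A_def using \<sigma> by (intro mult_right_mono) auto
    then show "A * \<sigma> \<ge> 2 * M" using \<sigma> by (simp add: M_def)
  qed
  define s where "s x = (x + - y) \<bullet> (x + - y) - R\<^sup>2" for x
  have sd: "s x = (dist x y)\<^sup>2 - R\<^sup>2" for x by (simp add: s_def dot_square_norm dist_norm)
  define b where "b x = A * (s x - N / (2 * R\<^sup>2) * (s x)\<^sup>2)" for x
  define T where "T = {x \<in> closure \<Omega>. s x \<le> \<sigma>}"
  have s0: "0 \<le> s x" if "x \<in> closure \<Omega>" for x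
  proof -
    have "R \<le> dist x y"
      unfolding y_def n_def by (rule two_sided_ball_outward[OF ball _ that]) (use R in simp)
    then have "R\<^sup>2 \<le> (dist x y)\<^sup>2" using R by (intro power_mono) auto
    then show ?thesis by (simp add: sd)
  qed
  have bge: "A * s x / 2 \<le> b x" "b x \<le> A * s x" if "x \<in> T" for x
  proof -
    have sx: "0 \<le> s x" "s x \<le> \<sigma>" using s0 that by (auto simp: T_def)
    have "N * s x \<le> R\<^sup>2" using sx N \<sigma>(3) by (meson mult_left_mono order_trans zero_le_one)
    then have "N / (2 * R\<^sup>2) * s x \<le> 1 / 2" using R by (simp add: divide_simps)
    then have "N / (2 * R\<^sup>2) * s x * s x \<le> 1 / 2 * s x" using sx by (intro mult_right_mono)
    then have "N / (2 * R\<^sup>2) * (s x)\<^sup>2 \<le> s x / 2" by (simp add: power2_eq_square)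
    then have "A * (s x / 2) \<le> b x" unfolding b_def using A by (intro mult_left_mono) auto
    then show "A * s x / 2 \<le> b x" by simp
    have "0 \<le> N / (2 * R\<^sup>2) * (s x)\<^sup>2" using N by simp
    then show "b x \<le> A * s x" unfolding b_def using A by (intro mult_left_mono) auto
  qed
  have uM: "u x \<le> M" if "x \<in> T" "x \<in> \<Omega>" for x
  proof -
    have "(dist x y)\<^sup>2 \<le> R\<^sup>2 + R * \<delta>" using that \<sigma>(2) by (simp add: T_def sd)
    also have "\<dots> < (R + \<delta>)\<^sup>2"
    proof -
      have "0 < R * \<delta>" using R \<delta> by simp
      moreover have "(R + \<delta>)\<^sup>2 = R\<^sup>2 + 2 * (R * \<delta>) + \<delta>\<^sup>2" by (simp add: power2_sum)
      moreover have "0 \<le> \<delta>\<^sup>2" by simp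
      ultimately show ?thesis by linarith
    qed
    finally have "(dist x y)\<^sup>2 < (R + \<delta>)\<^sup>2" .
    then have dxy: "dist x y < R + \<delta>" by (rule power2_less_imp_less) (use R \<delta> in linarith)
    have "R\<^sup>2 \<le> (dist x y)\<^sup>2" using s0[of x] that by (simp add: T_def sd)
    then have Rxy: "R \<le> dist x y" by (rule power2_le_imp_le) simp
    \<comment> \<open>the point of the exterior ball nearest to \<open>x\<close>; the boundary is met on the way there\<close>
    define w where "w = y + (R / dist x y) *\<^sub>R (x - y)"
    have "norm (x - y) > 0" using Rxy R by (simp only: dist_norm)
    then have "dist y w = R" using R by (simp add: w_def dist_norm)
    then have w\<Omega>: "w \<notin> \<Omega>"
      using ext x0 op closure_subset[of \<Omega>] by (auto simp: frontier_def interior_open)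
    have "x - w = (1 - R / dist x y) *\<^sub>R (x - y)" by (simp add: w_def algebra_simps)
    then have "dist x w = \<bar>1 - R / dist x y\<bar> * dist x y" by (simp add: dist_norm)
    also have "\<dots> = dist x y - R"
      using Rxy R \<open>norm (x - y) > 0\<close> by (simp add: abs_of_nonneg divide_le_eq_1 left_diff_distrib)
    finally have dxw: "dist x w < \<delta>" using dxy by simp
    from that(2) w\<Omega> obtain x' where x': "x' \<in> frontier \<Omega>" "dist x x' \<le> dist x w"
      by (rule frontier_point_before_exit)
    then show ?thesis unfolding M_def using bound[OF that(2) x'(1)] x'(2) dxw by simp
  qed
  have contb: "continuous_on Z b" for Z unfolding b_def s_def by (intro continuous_intros)
  have "compact T"
  proof -
    have "T = closure \<Omega> \<inter> {x. s x \<le> \<sigma>}" by (auto simp: T_def)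
    moreover have "closed {x. s x \<le> \<sigma>}" unfolding s_def by (intro closed_Collect_le continuous_intros)
    ultimately show ?thesis using bd by (auto intro!: compact_Int_closed)
  qed
  have le: "u x \<le> \<gamma> + b x" if x: "x \<in> T" for x
  proof (rule ccontr)
    assume neg: "\<not> u x \<le> \<gamma> + b x"
    have "continuous_on T (\<lambda>x. b x - u x)"
      by (intro continuous_intros contb continuous_on_subset[OF solD(2)]) (auto simp: T_def)
    then obtain x1 where x1: "x1 \<in> T" "\<And>x. x \<in> T \<Longrightarrow> b x1 - u x1 \<le> b x - u x"
      using continuous_attains_inf[OF \<open>compact T\<close>] x by blast
    have lt: "b x1 + \<gamma> < u x1" using x1(2)[OF x] neg by simp
    have x1c: "x1 \<in> closure \<Omega>" "s x1 \<le> \<sigma>" "0 \<le> s x1" using x1 s0 by (auto simp: T_def)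
    have "0 \<le> A * s x1 / 2" using A x1c by simp
    then have b0: "0 \<le> b x1" using bge(1)[OF x1(1)] by linarith
    have x1\<Omega>: "x1 \<in> \<Omega>"
    proof (rule ccontr)
      assume "x1 \<notin> \<Omega>"
      then have "u x1 = \<gamma>" using solD(5)[of x1] x1c op by (simp add: frontier_def interior_open)
      then show False using lt b0 by simp
    qed
    have "s x1 \<noteq> \<sigma>"
    proof
      assume "s x1 = \<sigma>"
      then have "M \<le> b x1" using bge(1)[OF x1(1)] A by simp
      then show False using uM[OF x1(1) x1\<Omega>] lt solD(6) by simp
    qed
    then have s\<sigma>: "s x1 < \<sigma>" using x1c by simp
    define k where "k = N / (2 * R\<^sup>2)"
    have "has_laplacian (\<lambda>x. A * ((x \<bullet> x - R\<^sup>2) - k * (x \<bullet> x - R\<^sup>2)\<^sup>2))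
       (\<lambda>x. (2 * (A * (1 - k * (2 * (x \<bullet> x - R\<^sup>2))))) *\<^sub>R x)
       (4 * ((x1 + - y) \<bullet> (x1 + - y)) * (A * (- (k * 2))) + 2 * DIM('a) * (A * (1 - k * (2 * ((x1 + - y) \<bullet> (x1 + - y) - R\<^sup>2))))) (x1 + - y)"
      by (rule has_laplacian_radial) (auto intro!: derivative_eq_intros always_eventually)
    from has_laplacian_shift[OF this] obtain F where F: "has_laplacian b F
       (4 * (s x1 + R\<^sup>2) * (A * (- (k * 2))) + 2 * N * (A * (1 - k * (2 * s x1)))) x1"
      by (auto simp: b_def[abs_def] s_def N_def k_def)
    have "open {x. s x < \<sigma>}" unfolding s_def by (intro open_Collect_less continuous_intros)
    then have "\<forall>\<^sub>F x in nhds x1. x \<in> \<Omega> \<inter> {x. s x < \<sigma>}"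
      using x1\<Omega> s\<sigma> op by (intro eventually_nhds_in_open) auto
    then have "\<forall>\<^sub>F x in nhds x1. b x1 - u x1 \<le> b x - u x"
      by eventually_elim (rule x1(2), use closure_subset[of \<Omega>] in \<open>auto simp: T_def\<close>)
    from has_laplacian_local_min(1)[OF has_laplacian_diff[OF F positive_solution_has_laplacian[OF sol op x1\<Omega>]] this]
    have "0 \<le> 4 * (s x1 + R\<^sup>2) * (A * (- (k * 2))) + 2 * N * (A * (1 - k * (2 * s x1))) + u x1 powr p" by simp
    moreover have "u x1 powr p \<le> M powr p"
      using uM[OF x1(1) x1\<Omega>] solD(7)[OF x1\<Omega>] p by (intro powr_mono2) auto
    moreover have "4 * (s x1 + R\<^sup>2) * (A * (- (k * 2))) + 2 * N * (A * (1 - k * (2 * s x1)))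
      = - (2 * N * A) - A * k * (8 + 4 * N) * s x1"
    proof -
      have "k * R\<^sup>2 = N / 2" using R by (simp add: k_def)
      then have a: "4 * R\<^sup>2 * (A * (- (k * 2))) = - (4 * N * A)" by algebra
      have "4 * (s x1 + R\<^sup>2) * (A * (- (k * 2))) + 2 * N * (A * (1 - k * (2 * s x1)))
        = 4 * R\<^sup>2 * (A * (- (k * 2))) + 2 * N * A - A * k * (8 + 4 * N) * s x1" by algebra
      then show ?thesis unfolding a by linarith
    qed
    moreover have "0 \<le> A * k * (8 + 4 * N) * s x1" using A N x1c by (simp add: k_def)
    moreover have "A \<le> 2 * N * A" using A N by (simp add: mult_le_cancel_right1)
    ultimately show False using A by linarith
  qed
  define x where "x = x0 - t *\<^sub>R n"
  have "x \<in> \<Omega>" unfolding x_def n_def by (rule two_sided_ball_inward[OF ball t(1,2)])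
  have "x - y = (- (R + t)) *\<^sub>R n" by (simp add: x_def y_def algebra_simps)
  then have "dist x y = \<bar>- (R + t)\<bar>" using n1 by (simp only: dist_norm norm_scaleR mult_1_right)
  then have "dist x y = R + t" using R t by simp
  then have sx: "s x = 2 * R * t + t\<^sup>2" by (simp add: sd power2_eq_square algebra_simps)
  then have xT: "x \<in> T" using t \<open>x \<in> \<Omega>\<close> closure_subset[of \<Omega>] by (auto simp: T_def)
  have "t\<^sup>2 \<le> R * t" using t by (simp add: power2_eq_square)
  then have "s x \<le> 3 * R * t" using sx by simp
  then have "A * s x \<le> A * (3 * R * t)" using A by simp
  then show ?thesis using le[OF xT] bge(2)[OF xT] unfolding x_def n_def by (simp add: mult_ac)
qed

text \<open>The upper bound \<open>C\<close> is uniform over all positive solutions, whereas the lower bound \<open>c\<close>, from the Hopf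
lemma in the interior balls, depends on the solution and only serves to see that the area is finite.\<close>

lemma positive_solution_flux_bounds:
  fixes \<Omega> :: "'a::euclidean_space set" and p :: real
  assumes dom: "bounded_domain_of_class k \<Omega>" "2 \<le> k"
    and dim: "DIM('a) \<ge> 2" and p: "1 < p" "(DIM('a) / 2 - 1) * p < DIM('a) / 2 + 1"
  obtains C where "C > 0"
    "\<And>r \<gamma> u. positive_solution \<Omega> p \<gamma> u \<Longrightarrow> C2_hoelder r \<Omega> u \<Longrightarrow>
       \<exists>c>0. \<forall>x\<in>frontier \<Omega>. c \<le> - normal_deriv \<Omega> u x \<and> - normal_deriv \<Omega> u x \<le> C"
proof -
  have op: "open \<Omega>" and bd: "bounded \<Omega>" using dom(1) by (simp_all add: bounded_domain_of_class_def)
  obtain R where R: "R > 0" "\<And>x. x \<in> frontier \<Omega> \<Longrightarrow> two_sided_ball \<Omega> R x"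
    using uniform_two_sided_ball[OF dom] by blast
  obtain \<delta> where \<delta>: "\<delta> > 0" and bound: "\<And>x x0 \<gamma> u. x \<in> \<Omega> \<Longrightarrow> x0 \<in> frontier \<Omega> \<Longrightarrow> dist x x0 < \<delta> \<Longrightarrow>
      positive_solution \<Omega> p \<gamma> u \<Longrightarrow> u x \<le> 1 / \<delta>"
    using boundary_bound[OF dom dim p] by metis
  define \<sigma> where "\<sigma> = min (R * \<delta>) (R\<^sup>2 / DIM('a))"
  have \<sigma>: "\<sigma> > 0" using R \<delta> by (simp add: \<sigma>_def)
  define A where "A = (1 / \<delta>) powr p + 1 + 2 / (\<delta> * \<sigma>)"
  have A: "A > 0" unfolding A_def using \<sigma> \<delta> powr_ge_zero[of "1 / \<delta>" p] by (intro add_nonneg_pos) auto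
  show thesis
  proof (rule that[of "3 * R * A"])
    show "3 * R * A > 0" using R A by simp
    fix r \<gamma> u assume sol: "positive_solution \<Omega> p \<gamma> u" and C2: "C2_hoelder r \<Omega> u"
    note solD = positive_solutionD[OF sol]
    define \<tau> where "\<tau> = R\<^sup>2 / (real DIM('a) + 2)"
    have \<tau>: "\<tau> > 0" "\<tau> < R\<^sup>2" using R by (auto simp: \<tau>_def divide_less_eq mult_less_cancel_left1)
    \<comment> \<open>the concentric balls in which the Hopf lemma requires \<open>u \<ge> \<gamma> + m\<close> stay at distance \<open>\<eta>\<close> from the boundary\<close>
    define \<eta> where "\<eta> = R - sqrt (R\<^sup>2 - \<tau>)"
    have "sqrt (R\<^sup>2 - \<tau>) < sqrt (R\<^sup>2)" using \<tau> by (intro real_sqrt_less_mono) simp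
    then have \<eta>: "\<eta> > 0" using R by (simp add: \<eta>_def)
    define K where "K = inner_part \<Omega> \<eta>"
    have cK: "compact K" and K\<Omega>: "K \<subseteq> \<Omega>"
      unfolding K_def using compact_inner_part[OF bd] inner_part_subset[OF op \<eta>] by auto
    have "\<exists>m>0. \<forall>x\<in>K. \<gamma> + m \<le> u x"
    proof (cases "K = {}")
      case True then show ?thesis by (intro exI[of _ 1]) auto
    next
      case False
      have "continuous_on K u" by (rule continuous_on_subset[OF solD(2)]) (use K\<Omega> closure_subset in blast)
      then obtain w where w: "w \<in> K" "\<And>x. x \<in> K \<Longrightarrow> u w \<le> u x"
        using continuous_attains_inf[OF cK False] by blast
      then show ?thesis using solD(4)[OF subsetD[OF K\<Omega> w(1)]] by (intro exI[of _ "u w - \<gamma>"]) auto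
    qed
    then obtain m where m: "m > 0" "\<And>x. x \<in> K \<Longrightarrow> \<gamma> + m \<le> u x" by blast
    define c where "c = m / (2 * \<tau>)"
    have c: "c > 0" using m \<tau> by (simp add: c_def)
    have bound': "u x \<le> 1 / \<delta>" if "x \<in> \<Omega>" "x0 \<in> frontier \<Omega>" "dist x x0 < \<delta>" for x x0
      using that sol by (rule bound)
    have "c * R \<le> - normal_deriv \<Omega> u x0 \<and> - normal_deriv \<Omega> u x0 \<le> 3 * R * A" if x0: "x0 \<in> frontier \<Omega>" for x0
    proof -
      define n where "n = exterior_normal \<Omega> x0"
      have n1: "norm n = 1" using R(2)[OF x0] by (simp add: two_sided_ball_def n_def)
      have ux0: "u x0 = \<gamma>" using solD(5)[OF x0] .
      have x0\<Omega>: "x0 \<notin> \<Omega>" "x0 \<in> closure \<Omega>" using x0 op by (auto simp: frontier_def interior_open)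
      define z where "z = x0 - R *\<^sub>R n"
      have int: "cball z R - {x0} \<subseteq> \<Omega>" using R(2)[OF x0] by (auto simp: two_sided_ball_def n_def z_def)
      have bz: "ball z R \<subseteq> \<Omega>"
      proof
        fix w assume w: "w \<in> ball z R"
        have "dist z x0 = R" using n1 R by (simp add: z_def dist_norm)
        then have "w \<noteq> x0" using w by auto
        then show "w \<in> \<Omega>" using int w by auto
      qed
      have cz: "cball z R \<subseteq> closure \<Omega>" using int x0\<Omega> closure_subset[of \<Omega>] by blast
      have inner: "\<gamma> + m \<le> u w" if "(dist z w)\<^sup>2 \<le> R\<^sup>2 - \<tau>" for w
      proof (rule m(2))
        have dzw: "dist z w \<le> R - \<eta>" using that by (simp add: \<eta>_def real_le_rsqrt)
        have "\<eta> \<le> dist w x1" if x1: "x1 \<in> frontier \<Omega>" for x1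
        proof (rule ccontr)
          assume "\<not> \<eta> \<le> dist w x1"
          then have "x1 \<in> ball z R" using dzw dist_triangle[of z x1 w] by simp
          then show False using bz x1 op by (auto simp: frontier_def interior_open)
        qed
        moreover have "w \<in> closure \<Omega>" using cz dzw \<eta> by auto
        ultimately show "w \<in> K" by (auto simp: K_def inner_part_def)
      qed
      have hopf: "\<gamma> + c * (R\<^sup>2 - (dist z w)\<^sup>2) \<le> u w" if "R\<^sup>2 - \<tau> \<le> (dist z w)\<^sup>2" "w \<in> cball z R" for w
        unfolding c_def \<tau>_def
      proof (rule hopf_lower_bound[OF R(1) continuous_on_subset[OF solD(2) cz] _ _ _ m(1)])
        show "\<exists>G L. has_laplacian u G L w \<and> L \<le> 0" if "w \<in> ball z R" for w
          using positive_solution_has_laplacian[OF sol op, of w] that bz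
          by (meson in_mono neg_le_0_iff_le powr_ge_zero)
        show "\<gamma> \<le> u w" if "w \<in> cball z R" for w using solD(8) cz that by blast
        show "\<gamma> + m \<le> u w" if "(dist z w)\<^sup>2 \<le> R\<^sup>2 - R\<^sup>2 / (real DIM('a) + 2)" for w
          using inner that by (simp add: \<tau>_def)
      qed (use that in \<open>auto simp: \<tau>_def\<close>)
      define t0 where "t0 = min R (min (\<tau> / (2 * R)) (\<sigma> / (3 * R)))"
      have t0: "t0 > 0" using R \<tau> \<sigma> by (simp add: t0_def)
      have quot: "c * R \<le> (u (x0 - t *\<^sub>R n) - u x0) / t \<and> (u (x0 - t *\<^sub>R n) - u x0) / t \<le> 3 * R * A"
        if t: "0 < t" "t < t0" for t
      proof -
        have tR: "t \<le> R" "2 * R * t \<le> \<tau>" "3 * R * t \<le> \<sigma>"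
          using t R by (auto simp: t0_def pos_less_divide_eq mult_ac)
        have "t\<^sup>2 \<le> R * t" using t tR by (simp add: power2_eq_square)
        then have "2 * R * t + t\<^sup>2 \<le> \<sigma>" using tR by simp
        from this[unfolded \<sigma>_def] have "u (x0 - t *\<^sub>R n) \<le> \<gamma> + 3 * R * A * t"
          unfolding n_def A_def \<sigma>_def
          by (intro boundary_upper_barrier[OF op bd x0 R(1) R(2)[OF x0] \<delta> p(1) sol _ t(1) tR(1)] bound')
        then have up: "(u (x0 - t *\<^sub>R n) - u x0) / t \<le> 3 * R * A"
          using t by (simp add: pos_divide_le_eq ux0)
        have "z - (x0 - t *\<^sub>R n) = (t - R) *\<^sub>R n" by (simp add: z_def algebra_simps)
        then have dz: "dist z (x0 - t *\<^sub>R n) = R - t" using tR n1 by (simp add: dist_norm)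
        have e: "R\<^sup>2 - (R - t)\<^sup>2 = 2 * R * t - t\<^sup>2" by (simp add: power2_eq_square algebra_simps)
        have "R\<^sup>2 - \<tau> \<le> (dist z (x0 - t *\<^sub>R n))\<^sup>2" unfolding dz using e tR zero_le_power2[of t] by linarith
        moreover have "x0 - t *\<^sub>R n \<in> cball z R" using dz t by simp
        ultimately have "\<gamma> + c * (2 * R * t - t\<^sup>2) \<le> u (x0 - t *\<^sub>R n)" using hopf dz e by metis
        moreover have "c * (R * t) \<le> c * (2 * R * t - t\<^sup>2)" using c \<open>t\<^sup>2 \<le> R * t\<close> by simp
        ultimately have "c * R \<le> (u (x0 - t *\<^sub>R n) - u x0) / t"
          using t by (simp add: pos_le_divide_eq ux0)
        with up show ?thesis by simp
      qed
      have ev: "\<forall>\<^sub>F t in at_right 0. 0 < t \<and> t < t0"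
        using eventually_at_right_real[OF t0] by eventually_elim auto
      note lim = normal_difference_quotient_tendsto[OF C2 op x0 R(1) R(2)[OF x0], folded n_def]
      have "c * R \<le> - normal_deriv \<Omega> u x0"
        by (rule tendsto_lowerbound[OF lim]) (use ev quot in \<open>auto elim!: eventually_mono\<close>)
      moreover have "- normal_deriv \<Omega> u x0 \<le> 3 * R * A"
        by (rule tendsto_upperbound[OF lim]) (use ev quot in \<open>auto elim!: eventually_mono\<close>)
      ultimately show ?thesis by simp
    qed
    then show "\<exists>c>0. \<forall>x\<in>frontier \<Omega>. c \<le> - normal_deriv \<Omega> u x \<and> - normal_deriv \<Omega> u x \<le> 3 * R * A"
      using c R by (intro exI[of _ "c * R"]) simp
  qed
qed

text \<open>If \<open>f\<close> is integrable over \<open>S\<close>, then \<open>f \<ge> c > 0\<close> makes \<open>S\<close> measurable and its measure finite; otherwise the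
left-hand side is 0 by convention.\<close>

lemma set_integral_le_bound_times_measure:
  fixes f :: "'a \<Rightarrow> real"
  assumes C: "C > 0" and c: "c > 0" and f: "\<And>x. x \<in> S \<Longrightarrow> c \<le> f x \<and> f x \<le> C"
  shows "(LINT x:S|M. f x) \<le> C * measure M (S \<inter> space M)"
proof (cases "set_integrable M S f")
  case True
  then have int: "integrable M (\<lambda>x. indicator S x *\<^sub>R f x)" by (simp add: set_integrable_def)
  define A where "A = S \<inter> space M"
  have "A = {x \<in> space M. indicator S x *\<^sub>R f x \<noteq> 0}"
    using f c by (force simp: A_def indicator_def)
  also have "\<dots> \<in> sets M" using borel_measurable_integrable[OF int] by measurable
  finally have A: "A \<in> sets M" .
  have "integrable M (\<lambda>x. indicator A x :: real)"
  proof (rule Bochner_Integration.integrable_bound)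
    show "integrable M (\<lambda>x. (1 / c) *\<^sub>R (indicator S x *\<^sub>R f x))" using int by (rule integrable_scaleR_right)
    show "AE x in M. norm (indicator A x :: real) \<le> norm ((1 / c) *\<^sub>R (indicator S x *\<^sub>R f x))"
    proof (rule AE_I2)
      fix x
      show "norm (indicator A x :: real) \<le> norm ((1 / c) *\<^sub>R (indicator S x *\<^sub>R f x))"
      proof (cases "x \<in> S")
        case True
        then have "1 \<le> \<bar>f x\<bar> / c" using f[OF True] c by (simp add: pos_le_divide_eq)
        then show ?thesis using True c by (simp add: indicator_def)
      qed (simp add: A_def indicator_def)
    qed
  qed (use A in measurable)
  then have intA: "integrable M (\<lambda>x. C * indicator A x)" by simp
  have "(LINT x:S|M. f x) \<le> (LINT x|M. C * indicator A x)"
    unfolding set_lebesgue_integral_def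
    by (rule integral_mono[OF int intA]) (use f in \<open>auto simp: A_def indicator_def\<close>)
  also have "\<dots> = C * measure M A" using A by (simp add: A_def)
  finally show ?thesis by (simp add: A_def)
next
  case False
  then have "(LINT x:S|M. f x) = 0"
    by (simp add: set_lebesgue_integral_def set_integrable_def not_integrable_integral_eq)
  then show ?thesis using C by simp
qed

section \<open>The integral of the nonlinearity\<close>

lemma integral_lborel_translate:
  fixes f :: "'a::euclidean_space \<Rightarrow> real"
  assumes "f \<in> borel_measurable borel"
  shows "(LINT x|lborel. f (c + x)) = (LINT x|lborel. f x)"
proof -
  have "(LINT x|distr lborel borel ((+) c). f x) = (LINT x|lborel. f (c + x))"
    by (rule integral_distr) (use assms in auto)
  then show ?thesis by (simp add: lborel_distr_plus)
qed

lemma integrable_continuous_compact_support: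
  fixes f :: "'a::euclidean_space \<Rightarrow> real"
  assumes "continuous_on UNIV f" "\<And>x. x \<notin> cball a B \<Longrightarrow> f x = 0"
  shows "integrable lborel f"
proof -
  have "integrable lborel (\<lambda>x. indicator (cball a B) x *\<^sub>R f x)"
    by (rule borel_integrable_compact) (auto intro: continuous_on_subset[OF assms(1)])
  moreover have "(\<lambda>x. indicator (cball a B) x *\<^sub>R f x) = f"
    using assms(2) by (auto simp: indicator_def fun_eq_iff)
  ultimately show ?thesis by simp
qed

text \<open>By translation invariance all difference quotients have integral 0, and they converge
boundedly with a common bounded support.\<close>

lemma integral_directional_derivative_eq_0:
  fixes f :: "'a::euclidean_space \<Rightarrow> real"
  assumes d: "\<And>x. (f has_derivative D x) (at x)" and cont: "continuous_on UNIV (\<lambda>x. D x e)"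
    and supp: "\<And>x. x \<notin> cball a B \<Longrightarrow> f x = 0" and e: "norm e = 1"
  shows "integrable lborel (\<lambda>x. D x e)" "(LINT x|lborel. D x e) = 0"
proof -
  have cf: "continuous_on UNIV f" using d has_derivative_continuous by (blast intro: continuous_at_imp_continuous_on)
  have fint: "integrable lborel f" by (rule integrable_continuous_compact_support[OF cf supp])
  have fm: "f \<in> borel_measurable borel" using cf by (rule borel_measurable_continuous_onI)
  define q where "q n x = (f (inverse (Suc n) *\<^sub>R e + x) - f x) * Suc n" for n :: nat and x
  have qm: "q n \<in> borel_measurable borel" for n
    unfolding q_def using fm by measurable
  have q0: "(LINT x|lborel. q n x) = 0" for n
  proof -
    have "integrable (distr lborel borel ((+) (inverse (Suc n) *\<^sub>R e))) f" using fint by (simp add: lborel_distr_plus)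
    then have "integrable lborel (\<lambda>x. f (inverse (Suc n) *\<^sub>R e + x))"
      by (subst (asm) integrable_distr_eq) (use fm in auto)
    then show ?thesis unfolding q_def using fint integral_lborel_translate[OF fm, of "inverse (Suc n) *\<^sub>R e"] by simp
  qed
  have "bounded ((\<lambda>x. D x e) ` cball a (B + 2))"
    by (intro compact_imp_bounded compact_continuous_image continuous_on_subset[OF cont]) auto
  then obtain L where L: "L > 0" "\<And>x. x \<in> cball a (B + 2) \<Longrightarrow> \<bar>D x e\<bar> \<le> L"
    by (auto simp: bounded_pos)
  have line: "((\<lambda>t. f (t *\<^sub>R e + x)) has_real_derivative D (t *\<^sub>R e + x) e) (at t)" for t x
  proof -
    have "((\<lambda>t. t *\<^sub>R e + x) has_derivative (\<lambda>h. h *\<^sub>R e)) (at t)"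
      by (auto intro!: derivative_eq_intros)
    from has_derivative_compose[OF this d]
    have "((\<lambda>t. f (t *\<^sub>R e + x)) has_derivative (\<lambda>h. D (t *\<^sub>R e + x) (h *\<^sub>R e))) (at t)" .
    moreover interpret D: bounded_linear "D (t *\<^sub>R e + x)" using d by (rule has_derivative_bounded_linear)
    have "(\<lambda>h. D (t *\<^sub>R e + x) (h *\<^sub>R e)) = (*) (D (t *\<^sub>R e + x) e)"
      by (simp add: fun_eq_iff D.scaleR)
    ultimately show ?thesis unfolding has_field_derivative_def by simp
  qed
  have bnd: "\<bar>q n x\<bar> \<le> L * indicator (cball a (B + 1)) x" for n x
  proof (cases "x \<in> cball a (B + 1)")
    case True
    obtain t where t: "0 < t" "t < inverse (Suc n)"
      "f (inverse (Suc n) *\<^sub>R e + x) - f (0 *\<^sub>R e + x) = (inverse (Suc n) - 0) * D (t *\<^sub>R e + x) e"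
      using MVT2[of 0 "inverse (real (Suc n))" "\<lambda>t. f (t *\<^sub>R e + x)" "\<lambda>t. D (t *\<^sub>R e + x) e"] line by auto
    have "inverse (real (Suc n)) \<le> 1" by (simp add: inverse_eq_divide)
    then have "dist x (t *\<^sub>R e + x) \<le> 1" using t(1,2) e by (simp add: dist_norm)
    then have "t *\<^sub>R e + x \<in> cball a (B + 2)"
      using True dist_triangle[of a "t *\<^sub>R e + x" x] by simp
    moreover have "q n x = D (t *\<^sub>R e + x) e" using t(3) by (simp add: q_def)
    ultimately show ?thesis using L True by simp
  next
    case False
    have "inverse (real (Suc n)) \<le> 1" by (simp add: inverse_eq_divide)
    then have "dist x (inverse (Suc n) *\<^sub>R e + x) \<le> 1" using e by (simp add: dist_norm)
    then have "inverse (Suc n) *\<^sub>R e + x \<notin> cball a B" 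
      using False dist_triangle[of a x "inverse (Suc n) *\<^sub>R e + x"] by (auto simp: dist_commute)
    moreover have "x \<notin> cball a B" using False by auto
    ultimately show ?thesis using False supp by (simp add: q_def)
  qed
  have lim: "(\<lambda>n. q n x) \<longlonglongrightarrow> D x e" for x
  proof -
    have "((\<lambda>h. (f (h *\<^sub>R e + x) - f x) / h) \<longlongrightarrow> D x e) (at 0)"
      using line[of x 0] by (simp add: DERIV_def)
    moreover have "filterlim (\<lambda>n. inverse (real (Suc n))) (at 0) sequentially"
      unfolding filterlim_at using LIMSEQ_inverse_real_of_nat by auto
    ultimately have "(\<lambda>n. (f (inverse (real (Suc n)) *\<^sub>R e + x) - f x) / inverse (real (Suc n))) \<longlonglongrightarrow> D x e"
      by (rule filterlim_compose)
    then show ?thesis by (simp add: q_def divide_inverse)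
  qed
  have w: "integrable lborel (\<lambda>x. L * indicator (cball a (B + 1)) x :: real)"
    using emeasure_lborel_cball_finite[of a "B + 1"] by (intro integrable_mult_right integrable_real_indicator) auto
  have Dm: "(\<lambda>x. D x e) \<in> borel_measurable lborel" using borel_measurable_continuous_onI[OF cont] by simp
  have qm': "q n \<in> borel_measurable lborel" for n using qm by simp
  show "integrable lborel (\<lambda>x. D x e)"
    by (rule integrable_dominated_convergence[where s=q, OF Dm qm' w]) (use lim bnd in auto)
  have "(\<lambda>n. LINT x|lborel. q n x) \<longlonglongrightarrow> (LINT x|lborel. D x e)"
    by (rule integral_dominated_convergence[where s=q, OF Dm qm' w]) (use lim bnd in auto)
  then show "(LINT x|lborel. D x e) = 0" by (simp add: q0 LIMSEQ_const_iff)
qed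

text \<open>At 0 both sides meet by the factorisation of \<open>max z 0 ^ (k + 2)\<close> through \<open>z\<close>.\<close>

lemma has_real_derivative_pos_part_power:
  "((\<lambda>s::real. max s 0 ^ (k + 2)) has_real_derivative real (k + 2) * max s 0 ^ (k + 1)) (at s)"
proof -
  consider "s > 0" | "s < 0" | "s = 0" by linarith
  then show ?thesis
  proof cases
    case 1
    have "((\<lambda>s::real. s ^ (k + 2)) has_real_derivative real (k + 2) * max s 0 ^ (k + 1)) (at s)"
      by (rule DERIV_cong[OF DERIV_pow]) (use 1 in auto)
    then show ?thesis
      by (rule has_field_derivative_transform_within_open[of _ _ _ "{0<..}"]) (use 1 in auto)
  next
    case 2
    have "((\<lambda>s::real. 0) has_real_derivative real (k + 2) * max s 0 ^ (k + 1)) (at s)"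
      using 2 by (auto intro!: derivative_eq_intros)
    then show ?thesis
      by (rule has_field_derivative_transform_within_open[of _ _ _ "{..<0}"]) (use 2 in auto)
  next
    case 3
    show ?thesis
      unfolding CARAT_DERIV
    proof (intro exI[of _ "\<lambda>z. max z 0 ^ (k + 1)"] conjI allI)
      show "max z 0 ^ (k + 2) - max s 0 ^ (k + 2) = max z 0 ^ (k + 1) * (z - s)" for z :: real
        using 3 by (auto simp: max_def)
      show "isCont (\<lambda>z. max z 0 ^ (k + 1)) s" by (intro continuous_intros)
    qed (use 3 in auto)
  qed
qed

text \<open>The test function \<open>P\<^bsup>n+3\<^esup>\<close> vanishes outside the ball; the exponent makes it twice continuously
differentiable. \<open>\<psi>\<close> is the divergence of \<open>P\<^bsup>n+3\<^esup> \<nabla>u - u \<nabla>P\<^bsup>n+3\<^esup>\<close>, extended by 0, so each of its terms is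
a directional derivative of a function with compact support.\<close>

lemma laplacian_integration_by_parts:
  fixes \<Omega> :: "'a::euclidean_space set" and z :: 'a and r :: real and n :: nat and P :: "'a \<Rightarrow> real"
  defines "P \<equiv> \<lambda>x. max (r\<^sup>2 - (x - z) \<bullet> (x - z)) 0"
  assumes op: "open \<Omega>" and sub: "cball z r \<subseteq> \<Omega>" and r: "r > 0" and C2: "C_k_on 2 \<Omega> u"
  defines "\<psi> \<equiv> \<lambda>x. if x \<in> \<Omega> then P x ^ (n + 3) * laplacian u x
      - u x * (4 * ((x - z) \<bullet> (x - z)) * ((n + 3) * ((n + 2) * P x ^ (n + 1))) - 2 * DIM('a) * ((n + 3) * P x ^ (n + 2))) else 0"
  shows "integrable lborel \<psi>" "(LINT x|lborel. \<psi> x) = 0"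
proof -
  define \<phi> where "\<phi> x = P x ^ (n + 3)" for x
  define \<Phi> where "\<Phi> x = (- 2 * ((n + 3) * P x ^ (n + 2))) *\<^sub>R (x - z)" for x
  define D\<Phi> where "D\<Phi> x h = (- 2 * ((n + 3) * P x ^ (n + 2))) *\<^sub>R h
    + (4 * ((n + 3) * ((n + 2) * P x ^ (n + 1))) * ((x - z) \<bullet> h)) *\<^sub>R (x - z)" for x h
  have P0: "P x = 0" if "x \<notin> cball z r" for x
  proof -
    have "r\<^sup>2 \<le> (dist z x)\<^sup>2" using that r by (intro power_mono) auto
    then show ?thesis by (simp add: P_def dot_square_norm dist_norm norm_minus_commute)
  qed
  have contP: "continuous_on A P" for A unfolding P_def by (intro continuous_intros)
  have dP: "((\<lambda>x. P x ^ (k + 2)) has_derivative (\<lambda>h. - 2 * (real (k + 2) * P x ^ (k + 1)) * ((x - z) \<bullet> h))) (at x)" for k x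
  proof -
    have "((\<lambda>x. r\<^sup>2 - (x - z) \<bullet> (x - z)) has_derivative (\<lambda>h. - 2 * ((x - z) \<bullet> h))) (at x)"
      by (auto intro!: derivative_eq_intros simp: inner_commute)
    from has_derivative_compose[OF this has_real_derivative_pos_part_power[of k, unfolded has_field_derivative_def]]
    have "((\<lambda>x. P x ^ (k + 2)) has_derivative (\<lambda>h. real (k + 2) * P x ^ (k + 1) * (- 2 * ((x - z) \<bullet> h)))) (at x)"
      unfolding P_def .
    then show ?thesis by (rule has_derivative_eq_rhs) (simp add: fun_eq_iff mult_ac)
  qed
  have d\<phi>: "(\<phi> has_derivative (\<lambda>h. \<Phi> x \<bullet> h)) (at x)" for x
    using dP[of "n + 1" x] unfolding \<phi>_def[abs_def] \<Phi>_def
    by (simp add: numeral_3_eq_3 algebra_simps)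
  have d\<Phi>: "(\<Phi> has_derivative D\<Phi> x) (at x)" for x
  proof -
    have 1: "((\<lambda>x. - 2 * (real (n + 3) * P x ^ (n + 2))) has_derivative 
      (\<lambda>h. - 2 * (real (n + 3) * (- 2 * (real (n + 2) * P x ^ (n + 1)) * ((x - z) \<bullet> h))))) (at x)"
      by (intro has_derivative_mult_right dP)
    have 2: "((\<lambda>x. x - z) has_derivative (\<lambda>h. h)) (at x)"
      by (auto intro!: derivative_eq_intros)
    show ?thesis
      unfolding \<Phi>_def[abs_def] D\<Phi>_def[abs_def]
      by (rule has_derivative_eq_rhs[OF has_derivative_scaleR[OF 1 2]]) (simp add: fun_eq_iff)
  qed
  have cont\<phi>: "continuous_on A \<phi>" for A unfolding \<phi>_def by (intro continuous_intros contP)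
  have cont\<Phi>: "continuous_on A \<Phi>" for A unfolding \<Phi>_def by (intro continuous_intros contP)
  have contD\<Phi>: "continuous_on A (\<lambda>x. D\<Phi> x h)" for A h unfolding D\<Phi>_def by (intro continuous_intros contP)
  define Hu where "Hu x h = (\<Sum>j\<in>Basis. frechet_derivative (partial_deriv j u) (at x) h *\<^sub>R j)" for x h
  have du: "u differentiable (at x)" "\<And>i. i \<in> Basis \<Longrightarrow> partial_deriv i u differentiable (at x)" if "x \<in> \<Omega>" for x
    using C2 op that by (auto simp: numeral_2_eq_2 differentiable_on_eq_differentiable_at)
  have dgu: "(gradient u has_derivative Hu x) (at x)" if "x \<in> \<Omega>" for x
    unfolding gradient_def[abs_def] Hu_def[abs_def]
    by (intro has_derivative_sum has_derivative_scaleR_left)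
      (use du[OF that] frechet_derivative_works in blast)
  have Hui: "Hu x i \<bullet> i = partial_deriv i (partial_deriv i u) x" if "i \<in> Basis" for x i
    unfolding Hu_def using that
    by (simp add: inner_sum_left inner_Basis sum.delta' if_distrib partial_deriv_def[of _ "partial_deriv _ _"] cong: if_cong)
  have cu: "continuous_on \<Omega> u" "continuous_on \<Omega> (gradient u)"
    "\<And>i. i \<in> Basis \<Longrightarrow> continuous_on \<Omega> (\<lambda>x. Hu x i \<bullet> i)"
  proof -
    show "continuous_on \<Omega> u" using C2 by (auto simp: numeral_2_eq_2 intro: differentiable_imp_continuous_on)
    show "continuous_on \<Omega> (gradient u)"
      using dgu has_derivative_continuous by (blast intro: continuous_at_imp_continuous_on)
    show "continuous_on \<Omega> (\<lambda>x. Hu x i \<bullet> i)" if "i \<in> Basis" for i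
      unfolding Hui[OF that] using C2 that by (simp add: numeral_2_eq_2)
  qed
  \<comment> \<open>\<open>D i\<close> is the derivative of the \<open>i\<close>-th component \<open>f i\<close> of the vector field\<close>
  define D where "D i x h = (if x \<in> \<Omega> then (\<phi> x *\<^sub>R Hu x h + (\<Phi> x \<bullet> h) *\<^sub>R gradient u x
     - (u x *\<^sub>R D\<Phi> x h + (gradient u x \<bullet> h) *\<^sub>R \<Phi> x)) \<bullet> i else 0)" for i x h
  define f where "f i x = (if x \<in> \<Omega> then (\<phi> x *\<^sub>R gradient u x - u x *\<^sub>R \<Phi> x) \<bullet> i else 0)" for i x
  have zero: "\<phi> x = 0" "\<Phi> x = 0" "D\<Phi> x h = 0" if "x \<notin> cball z r" for x h
    using P0[OF that] by (simp_all add: \<phi>_def \<Phi>_def D\<Phi>_def)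
  have cover: "\<Omega> \<union> - cball z r = UNIV" using sub by auto
  have "integrable lborel (\<lambda>x. D i x i) \<and> (LINT x|lborel. D i x i) = 0" if i: "i \<in> Basis" for i
  proof -
    have d: "(f i has_derivative D i x) (at x)" for x
    proof (cases "x \<in> \<Omega>")
      case True
      have "((\<lambda>x. (\<phi> x *\<^sub>R gradient u x - u x *\<^sub>R \<Phi> x) \<bullet> i) has_derivative (\<lambda>h. (\<phi> x *\<^sub>R Hu x h + (\<Phi> x \<bullet> h) *\<^sub>R gradient u x
         - (u x *\<^sub>R D\<Phi> x h + (gradient u x \<bullet> h) *\<^sub>R \<Phi> x)) \<bullet> i)) (at x)"
        by (intro has_derivative_inner_left has_derivative_diff has_derivative_scaleR d\<phi> d\<Phi> dgu True
            gradient_has_derivative du)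
      then have "((\<lambda>x. (\<phi> x *\<^sub>R gradient u x - u x *\<^sub>R \<Phi> x) \<bullet> i) has_derivative D i x) (at x)"
        by (rule has_derivative_eq_rhs) (use True in \<open>simp add: D_def fun_eq_iff\<close>)
      then show ?thesis
        by (rule has_derivative_transform_within_open[OF _ op True]) (simp add: f_def)
    next
      case False
      then have x: "x \<in> - cball z r" using sub by auto
      have "((\<lambda>x. 0) has_derivative D i x) (at x)"
        by (rule has_derivative_eq_rhs[OF has_derivative_const]) (use False in \<open>simp add: D_def fun_eq_iff\<close>)
      then show ?thesis
        by (rule has_derivative_transform_within_open[OF _ _ x]) (auto simp: f_def zero)
    qed
    have "continuous_on \<Omega> (\<lambda>x. (\<phi> x *\<^sub>R Hu x i + (\<Phi> x \<bullet> i) *\<^sub>R gradient u x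
     - (u x *\<^sub>R D\<Phi> x i + (gradient u x \<bullet> i) *\<^sub>R \<Phi> x)) \<bullet> i)"
      unfolding inner_diff_left inner_add_left inner_scaleR_left
      by (intro continuous_intros cu cont\<phi> cont\<Phi> contD\<Phi> i)
    then have "continuous_on \<Omega> (\<lambda>x. D i x i)" by (rule continuous_on_eq) (simp add: D_def)
    moreover have "continuous_on (- cball z r) (\<lambda>x. D i x i)"
      by (rule continuous_on_eq[of _ "\<lambda>x. 0"]) (auto simp: D_def zero)
    ultimately have "continuous_on (\<Omega> \<union> - cball z r) (\<lambda>x. D i x i)"
      by (intro continuous_on_open_Un op) auto
    then have c: "continuous_on UNIV (\<lambda>x. D i x i)" unfolding cover .
    have s: "f i x = 0" if "x \<notin> cball z r" for x using zero[OF that] by (simp add: f_def)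
    show ?thesis using integral_directional_derivative_eq_0[OF d c s] i by simp
  qed
  moreover have "\<psi> = (\<lambda>x. \<Sum>i\<in>Basis. D i x i)"
  proof
    fix x show "\<psi> x = (\<Sum>i\<in>Basis. D i x i)"
    proof (cases "x \<in> \<Omega>")
      case True
      have lu: "(\<Sum>i\<in>Basis. Hu x i \<bullet> i) = laplacian u x" unfolding laplacian_def by (intro sum.cong refl Hui)
      have e: "(\<Sum>i\<in>Basis. ((x - z) \<bullet> i) * ((x - z) \<bullet> i)) = (x - z) \<bullet> (x - z)"
        by (simp only: euclidean_inner[of "x - z" "x - z"])
      have l\<phi>: "(\<Sum>i\<in>Basis. D\<Phi> x i \<bullet> i) = 4 * ((x - z) \<bullet> (x - z)) * ((n + 3) * ((n + 2) * P x ^ (n + 1))) - 2 * DIM('a) * ((n + 3) * P x ^ (n + 2))"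
      proof -
        have "(\<Sum>i\<in>Basis. D\<Phi> x i \<bullet> i) = (\<Sum>i\<in>Basis. - 2 * ((n + 3) * P x ^ (n + 2))
          + 4 * ((n + 3) * ((n + 2) * P x ^ (n + 1))) * (((x - z) \<bullet> i) * ((x - z) \<bullet> i)))"
          by (intro sum.cong refl) (simp add: D\<Phi>_def inner_add_left inner_diff_left)
        also have "\<dots> = DIM('a) * (- 2 * ((n + 3) * P x ^ (n + 2))) + 4 * ((n + 3) * ((n + 2) * P x ^ (n + 1))) * ((x - z) \<bullet> (x - z))"
          by (simp only: sum.distrib sum_distrib_left[symmetric] e sum_constant) (simp add: algebra_simps)
        finally show ?thesis by (simp add: algebra_simps)
      qed
      have "(\<Sum>i\<in>Basis. D i x i) = (\<Sum>i\<in>Basis. \<phi> x * (Hu x i \<bullet> i) - u x * (D\<Phi> x i \<bullet> i))"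
        using True by (intro sum.cong refl) (simp add: D_def inner_add_left inner_diff_left)
      also have "\<dots> = \<phi> x * laplacian u x - u x * (\<Sum>i\<in>Basis. D\<Phi> x i \<bullet> i)"
        by (simp only: sum_subtractf sum_distrib_left[symmetric] lu)
      finally show ?thesis using True unfolding l\<phi> by (simp add: \<psi>_def \<phi>_def)
    qed (simp add: \<psi>_def D_def)
  qed
  ultimately show "integrable lborel \<psi>" "(LINT x|lborel. \<psi> x) = 0" by (simp_all add: integral_sum)
qed

text \<open>Testing the equation with \<open>P\<^sup>k\<close>, \<open>k = n + 3\<close>, bounds \<open>\<integral>P\<^sup>k u\<^sup>p\<close> by a multiple of
\<open>\<integral>P\<^bsup>k-1\<^esup> u\<close>; the part of \<open>\<Delta>P\<^sup>k\<close> with \<open>P\<^bsup>k-2\<^esup>\<close> has the good sign. If \<open>P u\<^bsup>p-1\<^esup>\<close> is large,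
then \<open>P\<^bsup>k-1\<^esup> u\<close> is absorbed by \<open>P\<^sup>k u\<^sup>p\<close>; otherwise \<open>u\<close> is at most a multiple of
\<open>P\<^bsup>-1/(p-1)\<^esup>\<close>, and \<open>P\<^bsup>k-1\<^esup> u\<close> is bounded once \<open>n\<close> is large.\<close>

lemma interior_integral_bound:
  assumes p: "p > 1" and r: "r > 0"
  obtains C where "C \<ge> 0"
    "\<And>\<Omega> \<gamma> u z. open \<Omega> \<Longrightarrow> cball (z::'a::euclidean_space) r \<subseteq> \<Omega> \<Longrightarrow> positive_solution \<Omega> p \<gamma> u \<Longrightarrow>
       (LINT x|lborel. indicator (cball z (r / 2)) x * u x powr p) \<le> C"
proof -
  define N where "N = real DIM('a)"
  have N: "N \<ge> 1" by (simp add: N_def Suc_leI)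
  obtain n :: nat where n: "1 / (p - 1) \<le> real n" using real_arch_simple by blast
  define E where "E = 4 * N * (n + 3)"
  have E: "E > 0" using N by (simp add: E_def)
  define K where "K = E / 2 * (E powr (1 / (p - 1)) * (r\<^sup>2) powr (n + 2 - 1 / (p - 1)))"
  have K: "K \<ge> 0" using E by (simp add: K_def)
  have absorb: "u * (2 * N * (n + 3) * P ^ (n + 2)) \<le> P ^ (n + 3) * u powr p / 2 + K"
    if u: "u > 0" and P: "0 \<le> P" "P \<le> r\<^sup>2" for u P :: real
  proof (cases "P = 0")
    case True then show ?thesis using K by simp
  next
    case False
    then have P0: "P > 0" using P by simp
    have up: "u powr p = u powr (p - 1) * u" using u by (simp add: powr_diff)
    have lhs: "u * (2 * N * (n + 3) * P ^ (n + 2)) = E / 2 * (u * P ^ (n + 2))" by (simp add: E_def)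
    show ?thesis
    proof (cases "E \<le> P * u powr (p - 1)")
      case True
      then have "E * (u * P ^ (n + 2)) \<le> P * u powr (p - 1) * (u * P ^ (n + 2))"
        using u P by (intro mult_right_mono) auto
      also have "\<dots> = P ^ (n + 3) * u powr p" unfolding up by (simp add: numeral_3_eq_3 mult_ac)
      finally show ?thesis unfolding lhs using K by simp
    next
      case False
      then have "u powr (p - 1) \<le> E / P" using P0 by (simp add: pos_le_divide_eq mult.commute)
      then have "(u powr (p - 1)) powr (1 / (p - 1)) \<le> (E / P) powr (1 / (p - 1))"
        using p by (intro powr_mono2) auto
      moreover have "(u powr (p - 1)) powr (1 / (p - 1)) = u" using p u by (simp add: powr_powr)
      ultimately have "u \<le> (E / P) powr (1 / (p - 1))" by simp
      then have "u * P ^ (n + 2) \<le> (E / P) powr (1 / (p - 1)) * P ^ (n + 2)"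
        using P by (intro mult_right_mono) auto
      also have "(E / P) powr (1 / (p - 1)) * P ^ (n + 2) = (E / P) powr (1 / (p - 1)) * P powr (n + 2)"
        by (simp only: powr_realpow[OF P0])
      also have "(E / P) powr (1 / (p - 1)) * P powr (n + 2) = E powr (1 / (p - 1)) * P powr (n + 2 - 1 / (p - 1))"
        using E P0 by (simp add: powr_divide powr_diff)
      also have "\<dots> \<le> E powr (1 / (p - 1)) * (r\<^sup>2) powr (n + 2 - 1 / (p - 1))"
        using P n by (intro mult_left_mono powr_mono2) auto
      finally have "E / 2 * (u * P ^ (n + 2)) \<le> K" unfolding K_def by (rule mult_left_mono) (use E in simp)
      then have "u * (2 * N * (n + 3) * P ^ (n + 2)) \<le> K" unfolding lhs .
      moreover have "0 \<le> P ^ (n + 3) * u powr p / 2" using P by simp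
      ultimately show ?thesis by linarith
    qed
  qed
  define B where "B = 3 * r\<^sup>2 / 4"
  have B: "B > 0" using r by (simp add: B_def)
  define V where "V = measure lborel (cball (0::'a) r)"
  show thesis
  proof (rule that[of "2 / B ^ (n + 3) * (K * V)"])
    show "2 / B ^ (n + 3) * (K * V) \<ge> 0" using B K by (simp add: V_def)
    fix \<Omega> \<gamma> u and z :: 'a assume op: "open \<Omega>" and sub: "cball z r \<subseteq> \<Omega>" and sol: "positive_solution \<Omega> p \<gamma> u"
    note solD = positive_solutionD[OF sol]
    define P where "P x = max (r\<^sup>2 - (x - z) \<bullet> (x - z)) 0" for x
    define \<psi> where "\<psi> x = (if x \<in> \<Omega> then P x ^ (n + 3) * laplacian u x
      - u x * (4 * ((x - z) \<bullet> (x - z)) * ((n + 3) * ((n + 2) * P x ^ (n + 1))) - 2 * DIM('a) * ((n + 3) * P x ^ (n + 2))) else 0)" for x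
    have \<psi>: "integrable lborel \<psi>" "(LINT x|lborel. \<psi> x) = 0"
      using laplacian_integration_by_parts[OF op sub r solD(1), of n] unfolding \<psi>_def[abs_def] P_def by simp_all
    have Pd: "P x = max (r\<^sup>2 - (dist z x)\<^sup>2) 0" for x
      by (simp add: P_def dot_square_norm dist_norm norm_minus_commute)
    have key: "indicator (cball z (r / 2)) x * u x powr p \<le> 2 / B ^ (n + 3) * (K * indicator (cball z r) x - \<psi> x)" for x
    proof (cases "x \<in> cball z r")
      case False
      then have "r\<^sup>2 \<le> (dist z x)\<^sup>2" using r by (intro power_mono) auto
      then have "P x = 0" by (simp add: Pd)
      then have "\<psi> x = 0" by (simp add: \<psi>_def)
      then show ?thesis using False r by auto
    next
      case True
      then have x\<Omega>: "x \<in> \<Omega>" using sub by auto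
      have u: "u x > 0" using solD(7)[OF x\<Omega>] .
      have P: "0 \<le> P x" "P x \<le> r\<^sup>2" by (auto simp: Pd)
      have lap: "laplacian u x = - (u x powr p)" using solD(3)[OF x\<Omega>] by simp
      have "- \<psi> x = P x ^ (n + 3) * u x powr p + u x * (4 * ((x - z) \<bullet> (x - z)) * ((n + 3) * ((n + 2) * P x ^ (n + 1))))
        - u x * (2 * N * (n + 3) * P x ^ (n + 2))"
        using x\<Omega> unfolding \<psi>_def lap N_def by (simp add: algebra_simps)
      moreover have "0 \<le> u x * (4 * ((x - z) \<bullet> (x - z)) * ((n + 3) * ((n + 2) * P x ^ (n + 1))))"
        using u P by (intro mult_nonneg_nonneg) auto
      ultimately have low: "P x ^ (n + 3) * u x powr p / 2 \<le> K - \<psi> x"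
        using absorb[OF u P] by linarith
      show ?thesis
      proof (cases "x \<in> cball z (r / 2)")
        case False
        have "0 \<le> P x ^ (n + 3) * u x powr p / 2" using P by simp
        then have "0 \<le> 2 / B ^ (n + 3) * (K - \<psi> x)" using low B by simp
        then show ?thesis using False True by simp
      next
        case xr: True
        then have "(dist z x)\<^sup>2 \<le> (r / 2)\<^sup>2" by (intro power_mono) auto
        moreover have "r\<^sup>2 - (dist z x)\<^sup>2 \<le> P x" by (simp add: Pd)
        moreover have "(r / 2)\<^sup>2 = r\<^sup>2 / 4" by (simp add: power_divide)
        ultimately have "B \<le> P x" unfolding B_def by linarith
        then have "B ^ (n + 3) \<le> P x ^ (n + 3)" using B by (intro power_mono) auto
        then have "B ^ (n + 3) * u x powr p \<le> P x ^ (n + 3) * u x powr p" by (intro mult_right_mono) auto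
        also have "\<dots> \<le> 2 * (K - \<psi> x)" using low by simp
        finally have "B ^ (n + 3) * u x powr p \<le> 2 * (K - \<psi> x)" .
        then have "u x powr p \<le> 2 * (K - \<psi> x) / B ^ (n + 3)" using B by (simp add: pos_le_divide_eq mult.commute)
        then show ?thesis using xr True by simp
      qed
    qed
    have iK: "integrable lborel (\<lambda>x. K * indicator (cball z r) x :: real)"
      using emeasure_lborel_cball_finite[of z r] by (intro integrable_mult_right integrable_real_indicator) auto
    have "continuous_on (cball z (r / 2)) (\<lambda>x. u x powr p)"
    proof (intro continuous_on_powr' continuous_intros ballI)
      have s: "cball z (r / 2) \<subseteq> \<Omega>" using sub r by auto
      show "continuous_on (cball z (r / 2)) u"
        by (rule continuous_on_subset[OF solD(2)]) (use s closure_subset in blast)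
      show "0 \<le> u x \<and> (u x = 0 \<longrightarrow> 0 < p)" if "x \<in> cball z (r / 2)" for x
        using solD(7)[of x] s that p by force
    qed
    from borel_integrable_compact[OF compact_cball this]
    have iu: "integrable lborel (\<lambda>x. indicator (cball z (r / 2)) x * u x powr p)" by simp
    have "(LINT x|lborel. indicator (cball z (r / 2)) x * u x powr p)
      \<le> (LINT x|lborel. 2 / B ^ (n + 3) * (K * indicator (cball z r) x - \<psi> x))"
      by (rule integral_mono[OF iu _ key]) (use iK \<psi> in auto)
    also have "\<dots> = 2 / B ^ (n + 3) * (K * measure lborel (cball z r))"
      using iK \<psi> by (simp add: Bochner_Integration.integral_diff)
    also have "measure lborel (cball z r) = V"
      unfolding V_def using content_ball_conv_unit_ball r by (simp add: content_cball)
    finally show "(LINT x|lborel. indicator (cball z (r / 2)) x * u x powr p) \<le> 2 / B ^ (n + 3) * (K * V)" .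
  qed
qed

text \<open>Near the boundary \<open>u\<close> itself is bounded; the rest of \<open>\<Omega>\<close> is covered by finitely many of the balls of
the previous lemma.\<close>

lemma positive_solution_integral_bound:
  fixes \<Omega> :: "'a::euclidean_space set" and p :: real
  assumes dom: "bounded_domain_of_class k \<Omega>" "2 \<le> k"
    and dim: "DIM('a) \<ge> 2" and p: "1 < p" "(DIM('a) / 2 - 1) * p < DIM('a) / 2 + 1"
  obtains C where "C > 0"
    "\<And>\<gamma> u. positive_solution \<Omega> p \<gamma> u \<Longrightarrow> (LINT x:\<Omega>|lborel. u x powr p) \<le> C"
proof -
  have op: "open \<Omega>" and bd: "bounded \<Omega>" using dom(1) by (simp_all add: bounded_domain_of_class_def)
  obtain \<delta> where \<delta>: "\<delta> > 0" and bound: "\<And>x x0 \<gamma> u. x \<in> \<Omega> \<Longrightarrow> x0 \<in> frontier \<Omega> \<Longrightarrow> dist x x0 < \<delta> \<Longrightarrow>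
      positive_solution \<Omega> p \<gamma> u \<Longrightarrow> u x \<le> 1 / \<delta>"
    using boundary_bound[OF dom dim p] by metis
  define r where "r = \<delta> / 2"
  have r: "r > 0" "r < \<delta>" using \<delta> by (auto simp: r_def)
  obtain C where C: "C \<ge> 0" and Cb: "\<And>\<Omega> \<gamma> u z. open \<Omega> \<Longrightarrow> cball (z::'a) r \<subseteq> \<Omega> \<Longrightarrow> positive_solution \<Omega> p \<gamma> u \<Longrightarrow>
       (LINT x|lborel. indicator (cball z (r / 2)) x * u x powr p) \<le> C"
    using interior_integral_bound[OF p(1) r(1)] by metis
  define K where "K = inner_part \<Omega> \<delta>"
  have cK: "compact K" unfolding K_def by (rule compact_inner_part[OF bd])
  have K\<Omega>: "cball x r \<subseteq> \<Omega>" if x: "x \<in> K" for x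
  proof (rule ccontr)
    assume "\<not> ?thesis"
    then obtain w where w: "w \<in> cball x r" "w \<notin> \<Omega>" by blast
    have "x \<in> \<Omega>" using x inner_part_subset[OF op \<delta>] unfolding K_def by blast
    from this w(2) obtain x0 where "x0 \<in> frontier \<Omega>" "dist x x0 \<le> dist x w"
      by (rule frontier_point_before_exit)
    moreover have "dist x w \<le> r" using w by simp
    ultimately show False using x r unfolding K_def inner_part_def by force
  qed
  have "K \<subseteq> \<Union>((\<lambda>c. ball c (r / 2)) ` K)" using r by force
  then obtain F where F: "F \<subseteq> K" "finite F" "K \<subseteq> (\<Union>c\<in>F. ball c (r / 2))"
    using compactE_image[OF cK, of K "\<lambda>c. ball c (r / 2)"] by blast
  define M where "M = (1 / \<delta>) powr p"
  have M: "M > 0" using \<delta> by (simp add: M_def)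
  have \<Omega>fin: "emeasure lborel \<Omega> < \<infinity>" using emeasure_bounded_finite[OF bd] .
  show thesis
  proof (rule that[of "M * measure lborel \<Omega> + card F * C + 1"])
    show "0 < M * measure lborel \<Omega> + card F * C + 1" using M C by (intro add_nonneg_pos add_nonneg_nonneg) auto
    fix \<gamma> u assume sol: "positive_solution \<Omega> p \<gamma> u"
    note solD = positive_solutionD[OF sol]
    have contp: "continuous_on Z (\<lambda>x. u x powr p)" if "Z \<subseteq> closure \<Omega>" for Z
    proof (intro continuous_on_powr' continuous_intros ballI)
      show "continuous_on Z u" by (rule continuous_on_subset[OF solD(2) that])
      show "0 \<le> u x \<and> (u x = 0 \<longrightarrow> 0 < p)" if "x \<in> Z" for x
        using solD(6) solD(8)[of x] that \<open>Z \<subseteq> closure \<Omega>\<close> p by force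
    qed
    have iu: "integrable lborel (\<lambda>x. indicator (cball c (r / 2)) x * u x powr p)" if "c \<in> F" for c
    proof -
      have "cball c (r / 2) \<subseteq> closure \<Omega>"
        using K\<Omega>[of c] that F(1) r closure_subset[of \<Omega>] by force
      from borel_integrable_compact[OF compact_cball contp[OF this]] show ?thesis by simp
    qed
    have iM: "integrable lborel (\<lambda>x. M * indicator \<Omega> x :: real)"
      using \<Omega>fin op by (intro integrable_mult_right integrable_real_indicator) auto
    have key: "indicator \<Omega> x *\<^sub>R u x powr p \<le> M * indicator \<Omega> x + (\<Sum>c\<in>F. indicator (cball c (r / 2)) x * u x powr p)" for x
    proof (cases "x \<in> \<Omega>")
      case False
      then show ?thesis by (auto intro!: sum_nonneg)
    next
      case True
      have nn: "0 \<le> (\<Sum>c\<in>F. indicator (cball c (r / 2)) x * u x powr p)" by (auto intro!: sum_nonneg)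
      show ?thesis
      proof (cases "x \<in> K")
        case False
        then obtain x0 where "x0 \<in> frontier \<Omega>" "dist x x0 < \<delta>"
          using True closure_subset[of \<Omega>] by (force simp: K_def inner_part_def)
        from bound[OF True this sol] have "u x powr p \<le> M"
          unfolding M_def using solD(7)[OF True] p by (intro powr_mono2) auto
        then show ?thesis using True nn by simp
      next
        case inK: True
        then obtain c where c: "c \<in> F" "x \<in> cball c (r / 2)" using F(3) by force
        have "u x powr p = indicator (cball c (r / 2)) x * u x powr p" using c by simp
        also have "\<dots> \<le> (\<Sum>c\<in>F. indicator (cball c (r / 2)) x * u x powr p)"
          by (rule member_le_sum[OF c(1) _ F(2)]) auto
        finally show ?thesis using True M by simp
      qed
    qed
    have "(LINT x:\<Omega>|lborel. u x powr p) \<le> (LINT x|lborel. M * indicator \<Omega> x + (\<Sum>c\<in>F. indicator (cball c (r / 2)) x * u x powr p))"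
    proof (cases "integrable lborel (\<lambda>x. indicator \<Omega> x *\<^sub>R u x powr p)")
      case True
      then show ?thesis unfolding set_lebesgue_integral_def
        by (rule integral_mono[OF _ _ key]) (use iM iu in auto)
    next
      case False
      then have "(LINT x:\<Omega>|lborel. u x powr p) = 0"
        by (simp add: set_lebesgue_integral_def not_integrable_integral_eq)
      also have "0 \<le> (LINT x|lborel. M * indicator \<Omega> x + (\<Sum>c\<in>F. indicator (cball c (r / 2)) x * u x powr p))"
        using M by (intro integral_nonneg_AE AE_I2 add_nonneg_nonneg sum_nonneg) auto
      finally show ?thesis .
    qed
    also have "\<dots> = M * measure lborel \<Omega> + (\<Sum>c\<in>F. LINT x|lborel. indicator (cball c (r / 2)) x * u x powr p)"
      using iM iu op by (simp add: Bochner_Integration.integral_add Bochner_Integration.integral_sum)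
    also have "\<dots> \<le> M * measure lborel \<Omega> + (\<Sum>c\<in>F. C)"
      by (intro add_left_mono sum_mono Cb[OF op _ sol] K\<Omega>) (use F(1) in blast)
    finally show "(LINT x:\<Omega>|lborel. u x powr p) \<le> M * measure lborel \<Omega> + card F * C + 1" by simp
  qed
qed

section \<open>The theorem\<close>

text \<open>The factor \<open>\<kappa>\<close> is chosen so that \<open>\<kappa>\<^bsup>p-1\<^esup> = \<lambda>\<close>, which removes the coefficient \<open>\<lambda>\<close> from the equation.\<close>

lemma solves_P_imp_positive_solution:
  fixes \<Omega> :: "'a::euclidean_space set"
  assumes op: "open \<Omega>" and p: "p > 1" and lam: "lam > 0" and P: "solves_P \<Omega> p r lam \<alpha> \<psi>"
  obtains \<gamma> u where "positive_solution \<Omega> p \<gamma> u" "(LINT x:\<Omega>|lborel. u x powr p) = lam powr (p / (p - 1))"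
proof -
  define \<kappa> where "\<kappa> = lam powr (1 / (p - 1))"
  have \<kappa>: "\<kappa> > 0" using lam by (simp add: \<kappa>_def)
  have \<kappa>p: "\<kappa> powr p = \<kappa> * lam" "\<kappa> powr p = lam powr (p / (p - 1))"
  proof -
    have "\<kappa> powr (p - 1) = lam" using lam p by (simp add: \<kappa>_def powr_powr)
    moreover have "\<kappa> powr p = \<kappa> * \<kappa> powr (p - 1)" using \<kappa> by (simp add: powr_diff)
    ultimately show "\<kappa> powr p = \<kappa> * lam" by simp
    show "\<kappa> powr p = lam powr (p / (p - 1))" by (simp add: \<kappa>_def powr_powr)
  qed
  have D: "C_k_on 2 \<Omega> \<psi>" "continuous_on (closure \<Omega>) \<psi>"
    "\<And>x. x \<in> \<Omega> \<Longrightarrow> - laplacian \<psi> x = (\<alpha> + lam * \<psi> x) powr p"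
    "(LINT x:\<Omega>|lborel. (\<alpha> + lam * \<psi> x) powr p) = 1"
    "\<And>x. x \<in> \<Omega> \<Longrightarrow> \<psi> x > 0" "\<And>x. x \<in> frontier \<Omega> \<Longrightarrow> \<psi> x = 0" "\<alpha> \<ge> 0"
    using P by (auto simp: solves_P_def C2_hoelder_def)
  define u where "u = (\<lambda>x. \<kappa> * \<alpha> + (\<kappa> * lam) * \<psi> x)"
  have uw: "u x = \<kappa> * (\<alpha> + lam * \<psi> x)" for x by (simp add: u_def algebra_simps)
  have w: "\<alpha> + lam * \<psi> x > 0" if "x \<in> \<Omega>" for x using D(5)[OF that] D(7) lam by (simp add: add_nonneg_pos)
  have up: "u x powr p = \<kappa> powr p * (\<alpha> + lam * \<psi> x) powr p" if "x \<in> \<Omega>" for x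
    using w[OF that] \<kappa> by (simp add: uw powr_mult)
  show thesis
  proof (rule that)
    show "positive_solution \<Omega> p (\<kappa> * \<alpha>) u"
      unfolding positive_solution_def
    proof (intro conjI ballI)
      show "C_k_on 2 \<Omega> u" unfolding u_def by (rule C_k_on_affine[OF op D(1)])
      show "continuous_on (closure \<Omega>) u" unfolding u_def by (intro continuous_intros D(2))
      show "- laplacian u x = u x powr p" if "x \<in> \<Omega>" for x
      proof -
        have "- laplacian u x = \<kappa> * lam * (- laplacian \<psi> x)"
          using laplacian_affine[OF op D(1) that, of "\<kappa> * \<alpha>" "\<kappa> * lam"] by (simp add: u_def)
        also have "\<dots> = u x powr p" unfolding D(3)[OF that] up[OF that] \<kappa>p(1) ..
        finally show ?thesis .
      qed
      show "\<kappa> * \<alpha> < u x" if "x \<in> \<Omega>" for x using D(5)[OF that] \<kappa> lam by (simp add: u_def)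
      show "u x = \<kappa> * \<alpha>" if "x \<in> frontier \<Omega>" for x using D(6)[OF that] by (simp add: u_def)
      show "0 \<le> \<kappa> * \<alpha>" using \<kappa> D(7) by simp
    qed
    have "(LINT x:\<Omega>|lborel. u x powr p) = (LINT x:\<Omega>|lborel. \<kappa> powr p * (\<alpha> + lam * \<psi> x) powr p)"
      by (rule set_lebesgue_integral_cong) (use op up in auto)
    also have "\<dots> = \<kappa> powr p * (LINT x:\<Omega>|lborel. (\<alpha> + lam * \<psi> x) powr p)"
      by (rule set_integral_mult_right)
    finally show "(LINT x:\<Omega>|lborel. u x powr p) = lam powr (p / (p - 1))" using D(4) \<kappa>p(2) by simp
  qed
qed

theorem theorem1p2:
  fixes \<Omega> :: "(real ^ 'n) set" and p :: real
  assumes "CARD('n) \<ge> 2"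
    and "bounded_domain_of_class 3 \<Omega>"
    and "1 < p" and "ereal p < critical_exponent CARD('n)"
  shows "\<exists>lambda_bar > 0.
    (\<forall>r lam \<alpha> \<psi>. 0 < r \<and> r < 1 \<and> 0 \<le> lam \<and> solves_P \<Omega> p r lam \<alpha> \<psi>
       \<longrightarrow> lam \<le> lambda_bar) \<and>
    (\<forall>r I \<gamma> v. 0 < r \<and> r < 1 \<and> I > lambda_bar powr (p / (p - 1)) \<and> solves_F \<Omega> p r I \<gamma> v
       \<longrightarrow> \<gamma> < 0)"
proof -
  note dom = assms(2) and p = assms(3)
  have k: "(2::nat) \<le> 3" by simp
  have op: "open \<Omega>" and con: "connected \<Omega>" and bd: "bounded \<Omega>"
    using dom by (simp_all add: bounded_domain_of_class_def)
  define N where "N = real CARD('n)"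
  have dim: "DIM(real ^ 'n) \<ge> 2" using assms(1) by simp
  have NN: "(N - 2) * p < N"
  proof (cases "CARD('n) = 2")
    case False
    then have N: "N > 2" using assms(1) by (simp add: N_def)
    have "p < N / (N - 2)" using assms(4) False by (simp add: critical_exponent_def N_def)
    then show ?thesis using N by (simp add: pos_less_divide_eq mult.commute)
  qed (simp add: N_def)
  have sub: "(DIM(real ^ 'n) / 2 - 1) * p < DIM(real ^ 'n) / 2 + 1"
    using NN by (simp add: N_def algebra_simps)
  obtain C1 where "C1 > 0" and C1: "\<And>\<gamma> u. positive_solution \<Omega> p \<gamma> u \<Longrightarrow> (LINT x:\<Omega>|lborel. u x powr p) \<le> C1"
    using positive_solution_integral_bound[OF dom k dim p sub] by metis
  obtain C2 where C2: "C2 > 0" and flux: "\<And>r \<gamma> u. positive_solution \<Omega> p \<gamma> u \<Longrightarrow> C2_hoelder r \<Omega> u \<Longrightarrow>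
       \<exists>c>0. \<forall>x\<in>frontier \<Omega>. c \<le> - normal_deriv \<Omega> u x \<and> - normal_deriv \<Omega> u x \<le> C2"
    using positive_solution_flux_bounds[OF dom k dim p sub] by metis
  \<comment> \<open>only the number \<open>measure S (frontier \<Omega>)\<close> enters, as a constant that depends on \<open>\<Omega>\<close>\<close>
  define S where "S = surface_measure \<Omega>"
  define M where "M = max 1 (max C1 (C2 * measure S (frontier \<Omega> \<inter> space S)))"
  have M: "M \<ge> 1" "C1 \<le> M" "C2 * measure S (frontier \<Omega> \<inter> space S) \<le> M" by (auto simp: M_def)
  define lambda_bar where "lambda_bar = M powr ((p - 1) / p)"
  have lb: "lambda_bar > 0" "lambda_bar powr (p / (p - 1)) = M"
    using M p by (auto simp: lambda_bar_def powr_powr)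
  have "lam \<le> lambda_bar" if lam: "0 \<le> lam" and P: "solves_P \<Omega> p r lam \<alpha> \<psi>" for r lam \<alpha> \<psi>
  proof (cases "lam = 0")
    case True then show ?thesis using lb by simp
  next
    case False
    then have lam0: "lam > 0" using lam by simp
    obtain \<gamma> u where u: "positive_solution \<Omega> p \<gamma> u" "(LINT x:\<Omega>|lborel. u x powr p) = lam powr (p / (p - 1))"
      using solves_P_imp_positive_solution[OF op p lam0 P] by blast
    have "lam powr (p / (p - 1)) \<le> M" using C1[OF u(1)] u(2) M by simp
    then have "(lam powr (p / (p - 1))) powr ((p - 1) / p) \<le> lambda_bar"
      unfolding lambda_bar_def using p by (intro powr_mono2) auto
    then show ?thesis using lam0 p by (simp add: powr_powr)
  qed
  moreover have "\<gamma> < 0" if I: "I > lambda_bar powr (p / (p - 1))" and F: "solves_F \<Omega> p r I \<gamma> v" for r I \<gamma> v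
  proof (rule ccontr)
    assume "\<not> \<gamma> < 0"
    then have \<gamma>: "\<gamma> \<ge> 0" by simp
    have C2h: "C2_hoelder r \<Omega> v" and flux_eq: "- (LINT x:frontier \<Omega>|S. normal_deriv \<Omega> v x) = I"
      and bdry: "\<And>x. x \<in> frontier \<Omega> \<Longrightarrow> v x = \<gamma>"
      and eq: "\<And>x. x \<in> \<Omega> \<Longrightarrow> - laplacian v x = (max (v x) 0) powr p"
      using F by (auto simp: solves_F_def S_def)
    have "C_k_on 2 \<Omega> v" "continuous_on (closure \<Omega>) v" using C2h by (auto simp: C2_hoelder_def)
    from nonneg_boundary_imp_positive_solution[OF op con bd this eq bdry \<gamma>]
    consider "positive_solution \<Omega> p \<gamma> v" | "\<forall>x\<in>\<Omega>. v x = \<gamma>" by blast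
    then show False
    proof cases
      case 1
      obtain c where c: "c > 0" "\<And>x. x \<in> frontier \<Omega> \<Longrightarrow> c \<le> - normal_deriv \<Omega> v x \<and> - normal_deriv \<Omega> v x \<le> C2"
        using flux[OF 1 C2h] by blast
      have "I = (LINT x:frontier \<Omega>|S. - normal_deriv \<Omega> v x)"
        using flux_eq by (simp add: set_lebesgue_integral_def)
      also have "\<dots> \<le> C2 * measure S (frontier \<Omega> \<inter> space S)"
        by (rule set_integral_le_bound_times_measure[OF C2 c])
      finally show False using I lb M by simp
    next
      case 2
      obtain R where R: "R > 0" "\<And>x. x \<in> frontier \<Omega> \<Longrightarrow> two_sided_ball \<Omega> R x"
        using uniform_two_sided_ball[OF dom k] by metis
      have "normal_deriv \<Omega> v x = 0" if x: "x \<in> frontier \<Omega>" for x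
      proof -
        have ev: "\<forall>\<^sub>F t in at_right 0. 0 < t \<and> t < R"
          using eventually_at_right_real[OF R(1)] by eventually_elim auto
        have "((\<lambda>t::real. 0) \<longlongrightarrow> - normal_deriv \<Omega> v x) (at_right 0)"
        proof (rule Lim_transform_eventually[OF normal_difference_quotient_tendsto[OF C2h op x R(1) R(2)[OF x]]])
          show "\<forall>\<^sub>F t in at_right 0. (v (x - t *\<^sub>R exterior_normal \<Omega> x) - v x) / t = 0"
            using ev
          proof eventually_elim
            case (elim t)
            then have "x - t *\<^sub>R exterior_normal \<Omega> x \<in> \<Omega>"
              by (intro two_sided_ball_inward[OF R(2)[OF x]]) auto
            then show ?case using 2 bdry[OF x] by simp
          qed
        qed
        then show ?thesis by (simp add: tendsto_const_iff)
      qed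
      then have "(LINT x:frontier \<Omega>|S. normal_deriv \<Omega> v x) = 0"
        unfolding set_lebesgue_integral_def by (intro integral_eq_zero_AE AE_I2) (auto simp: indicator_def)
      then show False using flux_eq I lb M by simp
    qed
  qed
  ultimately show ?thesis using lb(1) by blast
qed

end
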